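(* Assume $\mu$ satisfies (LC1) and (LC2). The assignment ($h\in\check{\mathfrak h}$, $i\in I$, $m\in\mathbb Z$) $$L_h\mapsto h_{(0)},\quad H_{i,m}\mapsto t^m\otimes r_i\,\alpha^\vee_{i(m)},\quad X^\pm_{i,m}\mapsto t^m\otimes e^\pm_{i(m)},\quad C\mapsto \frac{\mathbf c}{N},\quad D\mapsto\mathbf d$$ defines a surjective Lie algebra homomorphism from $\hat{\mathfrak g}_\mu$ to $\hat{\mathcal L}(\mathfrak g,\mu)$.
   Context: Data. Let $A=(a_{ij})_{i,j\in I}$ ($I$ finite) be a symmetrizable generalized Cartan matrix, $r_i$ positive integers with $(r_ia_{ij})$ symmetric, $(\mathfrak h,\{\alpha_i\},\{\alpha_i^\vee\})$ a realization of $A$ ($\dim\mathfrak h=2|I|-\mathrm{rank}\,A$, $\alpha_j(\alpha_i^\vee)=a_{ij}$), $\mathfrak g$ the associated Kac–Moody algebra, generated by $\mathfrak h$, $e_i^\pm$ with relations $[h,h']=0$, $[e_i^+,e_j^-]=\delta_{ij}\alpha_i^\vee$, $[h,e_i^\pm]=\pm\alpha_i(h)e_i^\pm$, $\mathrm{ad}(e_i^\pm)^{1-a_{ij}}e_j^\pm=0$ ($i\neq j$). Let $\mu$ be a permutation of $I$ of order $N$ with $a_{\mu(i)\mu(j)}=a_{ij}$, $r_{\mu(i)}=r_i$. Put $\mathfrak g'=[\mathfrak g,\mathfrak g]$, $\mathfrak h'=\bigoplus_i\mathbb C\alpha_i^\vee$, $\mathfrak c=\{h\in\mathfrak h:\alpha_i(h)=0\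 \forall i\}$; fix a complement $\mathfrak h''$ of $\mathfrak h'$ in $\mathfrak h$ with $(\mathfrak h''+\mathfrak c)/\mathfrak c$ stable under $\mathrm{Aut}(A)$ (acting on $\mathfrak h/\mathfrak c$ by duality with its permutation action on the $\alpha_i$). $\mu$ acts on $\mathfrak g$ as the automorphism with $\mu(e_i^\pm)=e_{\mu(i)}^\pm$, $\mu(\alpha_i^\vee)=\alpha^\vee_{\mu(i)}$, $\mu(\mathfrak h'')=\mathfrak h''$, $\alpha_{\mu(i)}(\mu(h''))=\alpha_i(h'')$ for $h''\in\mathfrak h''$; $\check{\mathfrak h}=\mathfrak h^\mu$. $\langle\cdot|\cdot\rangle$ is the invariant nondegenerate symmetric form on $\mathfrak g$ with $r_i\langle\alpha_i^\vee|h\rangle=\alpha_i(h)$, $\langle\mathfrak h''|\mathfrak h''\rangle=0$. $\mathcal O(i)$ is the $\mu$-orbit of $i$, $N_i=|\mathcal O(i)|$, $d_i=N/N_i$, $k$ runs over $\mathbb Z_N$, $\xi=e^{2\pi\sqrt{-1}/N}$, $\Gamma_{ij}=\{k:a_{i\mu^k(j)}\ne0\}$. (LC1): $\sum_{p\in\mathcal O(i)}a_{pi}>0$ for all $i$; then the Dynkin subdiagram on $\mathcal O(i)$ is a disjoint union of $A_1$'s ($s_i=1$) or of $A_2$'s with $a_{\mu^{N_i/2}(i),i}=-1$ ($s_i=2$). (LC2): whenever $i\notin\mathcal O(j)$ and $a_{ij}<0$, $a_{i\mu^k(j)}=a_{ij}$ for all $k\in\Gamma_{ij}$. $\check a_{ij}=s_i\sum_{p\in\mathcal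 O(i)}a_{pj}$. If $\check a_{ij}<0$: $H_{ij}\le\mathbb Z_N$ is the subgroup generated by $\{k-l:k,l\in\Gamma_{ij}\}$, $d_{ij}=|H_{ij}|$, $m_{ij}=1-\min_ka_{i\mu^k(j)}$, $\overline\Gamma_{ij}=(H_{ij}+\Gamma_{ij})\setminus\Gamma_{ij}$. The Lie algebra $\hat{\mathfrak g}_\mu$ over $\mathbb C$ is generated by $L_h$ (linear in $h\in\check{\mathfrak h}$), $H_{i,m}$, $X_{i,m}^\pm$ ($i\in I,m\in\mathbb Z$), $C$, $D$ with relations, for $X_i^\pm(z)=\sum_mX^\pm_{i,m}z^{-m}$: (L0) $H_{\mu(i),n}=\xi^nH_{i,n}$, $L_{r_i\sum_k\alpha^\vee_{\mu^k(i)}}=H_{i,0}$; (L1) $[D,L_h]=0$, $[D,H_{i,m}]=mH_{i,m}$, $[L_h,H_{i,m}]=0=[L_h,L_{h'}]$; (L2) $[H_{i,m},H_{j,n}]=\sum_kr_ia_{i\mu^k(j)}\delta_{m+n,0}m\xi^{km}C$, $C$ central; (L3) $[D,X^\pm_{i,m}]=mX^\pm_{i,m}$, $[L_h,X^\pm_{j,n}]=\pm\alpha_j(h)X^\pm_{j,n}$; (L4) $[H_{i,m},X^\pm_{j,n}]=\pm\sum_kr_ia_{i\mu^k(j)}\xi^{km}X^\pm_{j,m+n}$; (L5) $[X^+_{i,m},X^-_{j,n}]=\sum_k\delta_{i,\mu^k(j)}\frac1{r_j}(H_{j,m+n}+m\delta_{m+n,0}C)\xi^{km}$; (L6) $X^\pm_{\mu(i),n}=\xi^nX^\pm_{i,n}$,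 $\prod_{k\in\Gamma_{ij}}(z-\xi^kw)[X_i^\pm(z),X_j^\pm(w)]=0$; (L7) if $s_i=2$: $\sum_{\sigma\in S_2}(z_{\sigma(1)}^{d_i}-2z_{\sigma(2)}^{d_i}+z_3^{d_i})[X_i^\pm(z_{\sigma(1)}),[X_i^\pm(z_{\sigma(2)}),X_i^\pm(z_3)]]=0$; (L8) if $\check a_{ij}<0$, $m=m_{ij}$: $\prod_{1\le a<b\le m}p_{ij}(z_a,z_b)\prod_{a=1}^m\prod_{k\in\overline\Gamma_{ij}}(z_a-\xi^kw)\,[X_i^\pm(z_1),\dots,[X_i^\pm(z_m),X_j^\pm(w)]]=0$, with $p_{ij}(z,w)=(z^{d_i}+w^{d_i})^{s_i-1}\frac{z^{d_{ij}}-w^{d_{ij}}}{z^{d_i}-w^{d_i}}$. The target. $\mathrm{Aff}(\mathfrak g)=(\mathbb C[t,t^{-1}]\otimes\mathfrak g)\oplus\mathbb C\mathbf c\oplus\mathbb C\mathbf d$, with $\mathbf c$ central, $[t^m\otimes x,t^n\otimes y]=t^{m+n}\otimes[x,y]+m\delta_{m+n,0}\langle x|y\rangle\mathbf c$, $[\mathbf d,t^n\otimes y]=n\,t^n\otimes y$. For $x\in\mathfrak g$ put $x_{(m)}=\sum_{p\in\mathbb Z_N}\xi^{-mp}\mu^p(x)$ (so $h_{(0)}=\sum_{p\in\mathbb Z_N}\mu^p(h)$, $\alpha^\vee_{i(m)}=(\alpha_i^\vee)_{(m)}$, $e^\pm_{i(m)}=(e_i^\pm)_{(m)}$), and for a $\mu$-stable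 subspace $\mathfrak b$, $\mathfrak b_{(m)}=\{x_{(m)}:x\in\mathfrak b\}$. Then $\hat{\mathcal L}(\mathfrak g,\mu)=\big(\sum_{m\in\mathbb Z}t^m\otimes\mathfrak g'_{(m)}\big)\oplus\mathfrak h''_{(0)}\oplus\mathbb C\mathbf c\oplus\mathbb C\mathbf d\subset\mathrm{Aff}(\mathfrak g)$, and $\mathfrak h$ is identified with $t^0\otimes\mathfrak h$.
   Formalization: The assignment is corrected to L_h ↦ (1/N)h_(0) (that is, h) and C ↦ N·c. As printed (h_(0) and c/N) it violates (L0) and (L2) whenever N > 1, e.g. for A_1×A_1 with the swap; for N = 1 the two agree. *)

theory Defs
  imports
    "HOL-Analysis.Analysis"
    "HOL-Algebra.Elementary_Groups"
    "HOL-Combinatorics.Orbits"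
    "HOL-Library.Poly_Mapping"
begin

section \<open>Complex vector spaces and Lie algebras\<close>

class complex_vs = ab_group_add +
  fixes cscale :: "complex \<Rightarrow> 'a \<Rightarrow> 'a"  (infixr \<open>*\<^sub>C\<close> 75)
  assumes cscale_add_right: "c *\<^sub>C (x + y) = c *\<^sub>C x + c *\<^sub>C y"
    and cscale_add_left: "(c + d) *\<^sub>C x = c *\<^sub>C x + d *\<^sub>C x"
    and cscale_cscale: "c *\<^sub>C (d *\<^sub>C x) = (c * d) *\<^sub>C x"
    and cscale_one: "1 *\<^sub>C x = x"

global_interpretation cvs: vector_space "cscale :: complex \<Rightarrow> 'a::complex_vs \<Rightarrow> 'a"
  by unfold_locales (auto simp: cscale_add_right cscale_add_left cscale_cscale cscale_one)

instantiation complex :: complex_vs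
begin
definition cscale_complex :: "complex \<Rightarrow> complex \<Rightarrow> complex"
  where "cscale_complex = (*)"
instance by standard (auto simp: cscale_complex_def algebra_simps)
end

instantiation prod :: (complex_vs, complex_vs) complex_vs
begin
definition cscale_prod :: "complex \<Rightarrow> 'a \<times> 'b \<Rightarrow> 'a \<times> 'b"
  where "cscale_prod c p = (c *\<^sub>C fst p, c *\<^sub>C snd p)"
instance
  by standard (auto simp: cscale_prod_def cscale_add_right cscale_add_left cscale_cscale cscale_one)
end

instantiation poly_mapping :: (type, complex_vs) complex_vs
begin
definition cscale_poly_mapping :: "complex \<Rightarrow> ('a \<Rightarrow>\<^sub>0 'b) \<Rightarrow> ('a \<Rightarrow>\<^sub>0 'b)"
  where "cscale_poly_mapping c f = Poly_Mapping.map ((*\<^sub>C) c) f"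
lemma lookup_cscale: "Poly_Mapping.lookup (c *\<^sub>C f) t = c *\<^sub>C Poly_Mapping.lookup f t"
  for f :: "'a \<Rightarrow>\<^sub>0 'b"
  by (simp add: cscale_poly_mapping_def Poly_Mapping.map.rep_eq when_def)
instance
  by standard
    (auto intro!: poly_mapping_eqI
      simp: lookup_cscale plus_poly_mapping.rep_eq cscale_add_right cscale_add_left cscale_cscale cscale_one)
end

abbreviation clinear :: "('a::complex_vs \<Rightarrow> 'b::complex_vs) \<Rightarrow> bool"
  where "clinear \<equiv> Vector_Spaces.linear cscale cscale"

locale lie_algebra =
  fixes br :: "'a::complex_vs \<Rightarrow> 'a \<Rightarrow> 'a"
  assumes linear_left: "clinear (\<lambda>x. br x y)"
    and linear_right: "clinear (br x)"
    and alternating: "br x x = 0"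
    and jacobi: "br x (br y z) + br y (br z x) + br z (br x y) = 0"

definition lie_hom :: "('a::complex_vs \<Rightarrow> 'a \<Rightarrow> 'a) \<Rightarrow> ('b::complex_vs \<Rightarrow> 'b \<Rightarrow> 'b) \<Rightarrow> ('a \<Rightarrow> 'b) \<Rightarrow> bool"
  where "lie_hom br br' \<phi> \<longleftrightarrow> lie_algebra br \<and> lie_algebra br' \<and> clinear \<phi> \<and>
    (\<forall>x y. \<phi> (br x y) = br' (\<phi> x) (\<phi> y))"

section \<open>Lie algebras given by generators and relations\<close>

text \<open>
  The free nonassociative algebra on \<open>'x\<close> has the bracketed words \<open>'x magma\<close> as a basis. A Lie
  algebra is presented by generators \<open>G\<close> and relators \<open>R\<close> if it is the quotient of the free
  nonassociative algebra on \<open>G\<close> by the two-sided ideal generated by \<open>R\<close> and the Lie algebra axioms.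
\<close>

datatype 'x magma = Letter 'x | Node "'x magma" "'x magma"

type_synonym 'x free_alg = "'x magma \<Rightarrow>\<^sub>0 complex"

definition letter :: "'x \<Rightarrow> 'x free_alg"
  where "letter x = Poly_Mapping.single (Letter x) 1"

definition fmult :: "'x free_alg \<Rightarrow> 'x free_alg \<Rightarrow> 'x free_alg"  (infixr \<open>\<star>\<close> 73)
  where "f \<star> g = (\<Sum>s\<in>Poly_Mapping.keys f. \<Sum>t\<in>Poly_Mapping.keys g. Poly_Mapping.single (Node s t) (Poly_Mapping.lookup f s * Poly_Mapping.lookup g t))"

definition free_on :: "'x set \<Rightarrow> 'x free_alg set"
  where "free_on G = {f. \<forall>t\<in>Poly_Mapping.keys f. set_magma t \<subseteq> G}"

inductive_set lie_ideal :: "'x set \<Rightarrow> 'x free_alg set \<Rightarrow> 'x free_alg set"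
  for G :: "'x set" and R :: "'x free_alg set" where
  zero: "0 \<in> lie_ideal G R"
| add: "f \<in> lie_ideal G R \<Longrightarrow> g \<in> lie_ideal G R \<Longrightarrow> f + g \<in> lie_ideal G R"
| scale: "f \<in> lie_ideal G R \<Longrightarrow> c *\<^sub>C f \<in> lie_ideal G R"
| mult_left: "f \<in> free_on G \<Longrightarrow> g \<in> lie_ideal G R \<Longrightarrow> f \<star> g \<in> lie_ideal G R"
| mult_right: "f \<in> lie_ideal G R \<Longrightarrow> g \<in> free_on G \<Longrightarrow> f \<star> g \<in> lie_ideal G R"
| relator: "f \<in> R \<Longrightarrow> f \<in> lie_ideal G R"
| alternating: "f \<in> free_on G \<Longrightarrow> f \<star> f \<in> lie_ideal G R"
| jacobi: "f \<in> free_on G \<Longrightarrow> g \<in> free_on G \<Longrightarrow> h \<in> free_on G \<Longrightarrow>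
    f \<star> (g \<star> h) + g \<star> (h \<star> f) + h \<star> (f \<star> g) \<in> lie_ideal G R"

primrec eval_word :: "('a \<Rightarrow> 'a \<Rightarrow> 'a) \<Rightarrow> ('x \<Rightarrow> 'a) \<Rightarrow> 'x magma \<Rightarrow> 'a" where
  "eval_word br \<iota> (Letter x) = \<iota> x"
| "eval_word br \<iota> (Node s t) = br (eval_word br \<iota> s) (eval_word br \<iota> t)"

definition eval_free :: "('a::complex_vs \<Rightarrow> 'a \<Rightarrow> 'a) \<Rightarrow> ('x \<Rightarrow> 'a) \<Rightarrow> 'x free_alg \<Rightarrow> 'a"
  where "eval_free br \<iota> f = (\<Sum>t\<in>Poly_Mapping.keys f. Poly_Mapping.lookup f t *\<^sub>C eval_word br \<iota> t)"

definition presented_by ::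
    "('a::complex_vs \<Rightarrow> 'a \<Rightarrow> 'a) \<Rightarrow> ('x \<Rightarrow> 'a) \<Rightarrow> 'x set \<Rightarrow> 'x free_alg set \<Rightarrow> bool"
  where "presented_by br \<iota> G R \<longleftrightarrow> lie_algebra br \<and>
    eval_free br \<iota> ` free_on G = UNIV \<and>
    (\<forall>f\<in>free_on G. eval_free br \<iota> f = 0 \<longleftrightarrow> f \<in> lie_ideal G R)"

section \<open>Kac--Moody algebras\<close>

definition symmetrizable_gcm :: "('i \<Rightarrow> 'i \<Rightarrow> int) \<Rightarrow> ('i \<Rightarrow> nat) \<Rightarrow> bool"
  where "symmetrizable_gcm a r \<longleftrightarrow>
    (\<forall>i. a i i = 2) \<and>
    (\<forall>i j. i \<noteq> j \<longrightarrow> a i j \<le> 0) \<and>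
    (\<forall>i j. a i j = 0 \<longleftrightarrow> a j i = 0) \<and>
    (\<forall>i. 0 < r i) \<and>
    (\<forall>i j. int (r i) * a i j = int (r j) * a j i)"

text \<open>
  \<open>\<alpha> i\<close> are the simple roots and \<open>av i\<close> the simple coroots. The dimension is positive, so that the
  condition on it also says that the space is finite-dimensional.
\<close>

definition realization ::
    "('i::finite \<Rightarrow> 'i \<Rightarrow> int) \<Rightarrow> ('i \<Rightarrow> 'h::complex_vs \<Rightarrow> complex) \<Rightarrow> ('i \<Rightarrow> 'h) \<Rightarrow> bool"
  where "realization a \<alpha> av \<longleftrightarrow>
    cvs.dim (UNIV :: 'h set) = 2 * CARD('i) - rank (\<chi> i j. of_int (a i j) :: complex^'i^'i) \<and>
    (\<forall>i. clinear (\<alpha> i)) \<and>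
    (\<forall>c. (\<forall>h. (\<Sum>i\<in>UNIV. c i * \<alpha> i h) = 0) \<longrightarrow> (\<forall>i. c i = 0)) \<and>
    (\<forall>c. (\<Sum>i\<in>UNIV. c i *\<^sub>C av i) = 0 \<longrightarrow> (\<forall>i. c i = 0)) \<and>
    (\<forall>i j. \<alpha> j (av i) = of_int (a i j))"

datatype sign = Plus | Minus

fun sgnc :: "sign \<Rightarrow> complex" where
  "sgnc Plus = 1"
| "sgnc Minus = - 1"

datatype ('i, 'h) km_gen = KH 'h | KE sign 'i

abbreviation kh :: "'h \<Rightarrow> ('i, 'h) km_gen free_alg" where "kh h \<equiv> letter (KH h)"
abbreviation ke :: "sign \<Rightarrow> 'i \<Rightarrow> ('i, 'h) km_gen free_alg" where "ke s i \<equiv> letter (KE s i)"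

inductive_set km_relators ::
    "('i \<Rightarrow> 'i \<Rightarrow> int) \<Rightarrow> ('i \<Rightarrow> 'h::complex_vs \<Rightarrow> complex) \<Rightarrow> ('i \<Rightarrow> 'h) \<Rightarrow> ('i, 'h) km_gen free_alg set"
  for a \<alpha> av where
  h_add: "kh (h + h') - (kh h + kh h') \<in> km_relators a \<alpha> av"
| h_scale: "kh (c *\<^sub>C h) - c *\<^sub>C kh h \<in> km_relators a \<alpha> av"
| h_h: "kh h \<star> kh h' \<in> km_relators a \<alpha> av"
| e_f: "ke Plus i \<star> ke Minus j - (if i = j then kh (av i) else 0) \<in> km_relators a \<alpha> av"
| h_e: "kh h \<star> ke s i - (sgnc s * \<alpha> i h) *\<^sub>C ke s i \<in> km_relators a \<alpha> av"
| serre: "i \<noteq> j \<Longrightarrow> ((\<lambda>x. ke s i \<star> x) ^^ nat (1 - a i j)) (ke s j) \<in> km_relators a \<alpha> av"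

text \<open>
  \<open>\<kappa>\<close> sends the generators to their images in the Kac--Moody algebra; in particular
  \<open>\<lambda>h. \<kappa> (KH h)\<close> is the embedding of the Cartan subalgebra.
\<close>

definition kac_moody :: "('i \<Rightarrow> 'i \<Rightarrow> int) \<Rightarrow> ('i \<Rightarrow> 'h::complex_vs \<Rightarrow> complex) \<Rightarrow> ('i \<Rightarrow> 'h) \<Rightarrow>
    ('g::complex_vs \<Rightarrow> 'g \<Rightarrow> 'g) \<Rightarrow> (('i, 'h) km_gen \<Rightarrow> 'g) \<Rightarrow> bool"
  where "kac_moody a \<alpha> av br \<kappa> \<longleftrightarrow> presented_by br \<kappa> UNIV (km_relators a \<alpha> av)"

definition derived_alg :: "('g::complex_vs \<Rightarrow> 'g \<Rightarrow> 'g) \<Rightarrow> 'g set"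
  where "derived_alg br = cvs.span {br x y | x y. True}"

definition diagram_auts :: "('i \<Rightarrow> 'i \<Rightarrow> int) \<Rightarrow> ('i \<Rightarrow> 'i) set"
  where "diagram_auts a = {\<sigma>. bij \<sigma> \<and> (\<forall>i j. a (\<sigma> i) (\<sigma> j) = a i j)}"

text \<open>
  Stability modulo the centre \<open>Z\<close>, the common kernel of the simple roots: since the latter are linearly
  independent, a diagram automorphism \<open>\<sigma>\<close> maps the coset of \<open>x\<close> to the set of all \<open>y\<close> with
  \<open>\<alpha> (\<sigma> i) y = \<alpha> i x\<close> for all \<open>i\<close>.
\<close>

definition stable_complement :: "('i \<Rightarrow> 'i \<Rightarrow> int) \<Rightarrow> ('i \<Rightarrow> 'h::complex_vs \<Rightarrow> complex) \<Rightarrow>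
    ('i \<Rightarrow> 'h) \<Rightarrow> 'h set \<Rightarrow> bool"
  where "stable_complement a \<alpha> av W \<longleftrightarrow>
    cvs.subspace W \<and>
    W \<inter> cvs.span (range av) = {0} \<and>
    (\<forall>x. \<exists>y\<in>cvs.span (range av). \<exists>w\<in>W. x = y + w) \<and>
    (let Z = {h. \<forall>i. \<alpha> i h = 0} in
      \<forall>\<sigma>\<in>diagram_auts a. \<forall>x\<in>W. \<forall>y. (\<forall>i. \<alpha> (\<sigma> i) y = \<alpha> i x) \<longrightarrow> (\<exists>w\<in>W. \<exists>z\<in>Z. y = w + z))"

definition invariant_form :: "('i \<Rightarrow> nat) \<Rightarrow> ('i \<Rightarrow> 'h::complex_vs \<Rightarrow> complex) \<Rightarrow> ('i \<Rightarrow> 'h) \<Rightarrow> 'h set \<Rightarrow>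
    ('g::complex_vs \<Rightarrow> 'g \<Rightarrow> 'g) \<Rightarrow> (('i, 'h) km_gen \<Rightarrow> 'g) \<Rightarrow> ('g \<Rightarrow> 'g \<Rightarrow> complex) \<Rightarrow> bool"
  where "invariant_form r \<alpha> av W br \<kappa> B \<longleftrightarrow>
    (\<forall>x. clinear (B x)) \<and>
    (\<forall>x y. B x y = B y x) \<and>
    (\<forall>x y z. B (br x y) z = B x (br y z)) \<and>
    (\<forall>x. (\<forall>y. B x y = 0) \<longrightarrow> x = 0) \<and>
    (\<forall>i h. of_nat (r i) * B (\<kappa> (KH (av i))) (\<kappa> (KH h)) = \<alpha> i h) \<and>
    (\<forall>w\<in>W. \<forall>w'\<in>W. B (\<kappa> (KH w)) (\<kappa> (KH w')) = 0)"

section \<open>The diagram automorphism\<close>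

definition perm_order :: "('i \<Rightarrow> 'i) \<Rightarrow> nat"
  where "perm_order \<mu> = (LEAST n. 0 < n \<and> \<mu> ^^ n = id)"

text \<open>Residues modulo \<open>N\<close> are represented by the integers in \<open>{0..<N}\<close>.\<close>

definition residues_of :: "('i \<Rightarrow> 'i) \<Rightarrow> int set"
  where "residues_of \<mu> = {0..<int (perm_order \<mu>)}"

definition pw :: "('i \<Rightarrow> 'i) \<Rightarrow> int \<Rightarrow> 'i \<Rightarrow> 'i"
  where "pw \<mu> k = \<mu> ^^ nat k"

definition xi :: "('i \<Rightarrow> 'i) \<Rightarrow> complex"
  where "xi \<mu> = exp (2 * of_real pi * \<i> / of_nat (perm_order \<mu>))"

definition admissible :: "('i \<Rightarrow> 'i \<Rightarrow> int) \<Rightarrow> ('i \<Rightarrow> nat) \<Rightarrow> ('i \<Rightarrow> 'i) \<Rightarrow> bool"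
  where "admissible a r \<mu> \<longleftrightarrow> \<mu> \<in> diagram_auts a \<and> (\<forall>i. r (\<mu> i) = r i)"

text \<open>\<open>mh\<close> and \<open>mg\<close> are the actions of \<open>\<mu>\<close> on the Cartan subalgebra and on the Kac--Moody algebra.\<close>

definition mu_action :: "('i \<Rightarrow> 'i) \<Rightarrow> ('i \<Rightarrow> 'h::complex_vs \<Rightarrow> complex) \<Rightarrow> ('i \<Rightarrow> 'h) \<Rightarrow> 'h set \<Rightarrow>
    ('g::complex_vs \<Rightarrow> 'g \<Rightarrow> 'g) \<Rightarrow> (('i, 'h) km_gen \<Rightarrow> 'g) \<Rightarrow> ('h \<Rightarrow> 'h) \<Rightarrow> ('g \<Rightarrow> 'g) \<Rightarrow> bool"
  where "mu_action \<mu> \<alpha> av W br \<kappa> mh mg \<longleftrightarrow>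
    clinear mh \<and> bij mh \<and>
    (\<forall>i. mh (av i) = av (\<mu> i)) \<and>
    mh ` W = W \<and>
    (\<forall>i. \<forall>w\<in>W. \<alpha> (\<mu> i) (mh w) = \<alpha> i w) \<and>
    lie_hom br br mg \<and> bij mg \<and>
    (\<forall>s i. mg (\<kappa> (KE s i)) = \<kappa> (KE s (\<mu> i))) \<and>
    (\<forall>h. mg (\<kappa> (KH h)) = \<kappa> (KH (mh h)))"

definition fixed_cartan :: "('h \<Rightarrow> 'h) \<Rightarrow> 'h set"
  where "fixed_cartan mh = {h. mh h = h}"

definition LC1 :: "('i::finite \<Rightarrow> 'i \<Rightarrow> int) \<Rightarrow> ('i \<Rightarrow> 'i) \<Rightarrow> bool"
  where "LC1 a \<mu> \<longleftrightarrow> (\<forall>i. (\<Sum>p\<in>orbit \<mu> i. a p i) > 0)"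

definition Gam :: "('i \<Rightarrow> 'i \<Rightarrow> int) \<Rightarrow> ('i \<Rightarrow> 'i) \<Rightarrow> 'i \<Rightarrow> 'i \<Rightarrow> int set"
  where "Gam a \<mu> i j = {k \<in> residues_of \<mu>. a i (pw \<mu> k j) \<noteq> 0}"

definition LC2 :: "('i \<Rightarrow> 'i \<Rightarrow> int) \<Rightarrow> ('i \<Rightarrow> 'i) \<Rightarrow> bool"
  where "LC2 a \<mu> \<longleftrightarrow> (\<forall>i j. i \<notin> orbit \<mu> j \<and> a i j < 0 \<longrightarrow> (\<forall>k\<in>Gam a \<mu> i j. a i (pw \<mu> k j) = a i j))"

definition dd :: "('i \<Rightarrow> 'i) \<Rightarrow> 'i \<Rightarrow> nat"
  where "dd \<mu> i = perm_order \<mu> div card (orbit \<mu> i)"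

text \<open>Under \<open>LC1\<close> the diagram on an orbit is a disjoint union of \<open>A\<^sub>1\<close>'s, or else one of \<open>A\<^sub>2\<close>'s.\<close>

definition ss :: "('i \<Rightarrow> 'i \<Rightarrow> int) \<Rightarrow> ('i \<Rightarrow> 'i) \<Rightarrow> 'i \<Rightarrow> nat"
  where "ss a \<mu> i = (if \<forall>p\<in>orbit \<mu> i. \<forall>q\<in>orbit \<mu> i. p \<noteq> q \<longrightarrow> a p q = 0 then 1 else 2)"

definition folded :: "('i::finite \<Rightarrow> 'i \<Rightarrow> int) \<Rightarrow> ('i \<Rightarrow> 'i) \<Rightarrow> 'i \<Rightarrow> 'i \<Rightarrow> int"
  where "folded a \<mu> i j = int (ss a \<mu> i) * (\<Sum>p\<in>orbit \<mu> i. a p j)"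

definition Hgrp :: "('i \<Rightarrow> 'i \<Rightarrow> int) \<Rightarrow> ('i \<Rightarrow> 'i) \<Rightarrow> 'i \<Rightarrow> 'i \<Rightarrow> int set"
  where "Hgrp a \<mu> i j = generate (integer_mod_group (perm_order \<mu>))
    {(k - l) mod int (perm_order \<mu>) | k l. k \<in> Gam a \<mu> i j \<and> l \<in> Gam a \<mu> i j}"

definition mm :: "('i \<Rightarrow> 'i \<Rightarrow> int) \<Rightarrow> ('i \<Rightarrow> 'i) \<Rightarrow> 'i \<Rightarrow> 'i \<Rightarrow> nat"
  where "mm a \<mu> i j = nat (1 - Min ((\<lambda>k. a i (pw \<mu> k j)) ` residues_of \<mu>))"

definition Gam_bar :: "('i \<Rightarrow> 'i \<Rightarrow> int) \<Rightarrow> ('i \<Rightarrow> 'i) \<Rightarrow> 'i \<Rightarrow> 'i \<Rightarrow> int set"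
  where "Gam_bar a \<mu> i j =
    {(h + k) mod int (perm_order \<mu>) | h k. h \<in> Hgrp a \<mu> i j \<and> k \<in> Gam a \<mu> i j} - Gam a \<mu> i j"

section \<open>Polynomials acting on formal distributions\<close>

text \<open>Polynomials over the complex numbers in variables indexed by the natural numbers.\<close>

type_synonym cpoly = "(nat \<Rightarrow>\<^sub>0 nat) \<Rightarrow>\<^sub>0 complex"

definition var :: "nat \<Rightarrow> cpoly"
  where "var v = Poly_Mapping.single (Poly_Mapping.single v 1) 1"

definition const :: "complex \<Rightarrow> cpoly"
  where "const c = Poly_Mapping.single 0 c"

text \<open>
  A formal distribution is given by its coefficients: \<open>F n\<close> is the coefficient of the product of the
  \<open>z\<^sub>v\<close> to the power \<open>- n v\<close>, as in \<open>X(z) = \<Sum>\<^sub>m X\<^sub>m z\<^sup>-\<^sup>m\<close>. Multiplication by a monomial with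
  exponents \<open>e\<close> therefore shifts \<open>n\<close> to \<open>n + e\<close>.
\<close>

definition pmult :: "cpoly \<Rightarrow> ((nat \<Rightarrow> int) \<Rightarrow> 'a::complex_vs) \<Rightarrow> (nat \<Rightarrow> int) \<Rightarrow> 'a"
  where "pmult P F n = (\<Sum>e\<in>Poly_Mapping.keys P. Poly_Mapping.lookup P e *\<^sub>C F (\<lambda>v. n v + int (Poly_Mapping.lookup e v)))"

text \<open>
  \<open>p\<^sub>i\<^sub>j(z,w)\<close>. If \<open>Gam a \<mu> i j\<close> is nonempty, \<open>Hgrp a \<mu> i j\<close> contains the stabilizer of \<open>i\<close>, which has
  order \<open>dd \<mu> i\<close>; hence the quotient of \<open>z\<^sup>d - w\<^sup>d\<close> with \<open>d = card (Hgrp a \<mu> i j)\<close> by the same expression with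
  \<open>d = dd \<mu> i\<close> is the polynomial written as a geometric sum below.
\<close>

definition p_poly :: "('i::finite \<Rightarrow> 'i \<Rightarrow> int) \<Rightarrow> ('i \<Rightarrow> 'i) \<Rightarrow> 'i \<Rightarrow> 'i \<Rightarrow> cpoly \<Rightarrow> cpoly \<Rightarrow> cpoly"
  where "p_poly a \<mu> i j z w =
    (let d = dd \<mu> i; q = card (Hgrp a \<mu> i j) div d in
      (z ^ d + w ^ d) ^ (ss a \<mu> i - 1) * (\<Sum>t<q. z ^ (d * t) * w ^ (d * (q - 1 - t))))"

section \<open>The algebra \<open>\<gg>^\<^sub>\<mu>\<close>\<close>

datatype ('i, 'h) hat_gen = GL 'h | GH 'i int | GX sign 'i int | GC | GD

abbreviation LL :: "'h \<Rightarrow> ('i, 'h) hat_gen free_alg" where "LL h \<equiv> letter (GL h)"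
abbreviation HH :: "'i \<Rightarrow> int \<Rightarrow> ('i, 'h) hat_gen free_alg" where "HH i m \<equiv> letter (GH i m)"
abbreviation XX :: "sign \<Rightarrow> 'i \<Rightarrow> int \<Rightarrow> ('i, 'h) hat_gen free_alg" where "XX s i m \<equiv> letter (GX s i m)"
abbreviation CC :: "('i, 'h) hat_gen free_alg" where "CC \<equiv> letter GC"
abbreviation DD :: "('i, 'h) hat_gen free_alg" where "DD \<equiv> letter GD"

definition hat_gens :: "('h \<Rightarrow> 'h) \<Rightarrow> ('i, 'h) hat_gen set"
  where "hat_gens mh = GL ` fixed_cartan mh \<union> {GH i m | i m. True} \<union> {GX s i m | s i m. True} \<union> {GC, GD}"

text \<open>
  In the relations between formal distributions, variable \<open>0\<close> is \<open>w\<close> and variable \<open>b > 0\<close> is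
  \<open>z\<^sub>b\<close> (\<open>z\<close> in \<open>L6_XX\<close>). Every coefficient of such a relation is a relator.
\<close>

inductive_set hat_relators :: "('i::finite \<Rightarrow> 'i \<Rightarrow> int) \<Rightarrow> ('i \<Rightarrow> nat) \<Rightarrow> ('i \<Rightarrow> 'i) \<Rightarrow>
    ('i \<Rightarrow> 'h::complex_vs \<Rightarrow> complex) \<Rightarrow> ('i \<Rightarrow> 'h) \<Rightarrow> ('h \<Rightarrow> 'h) \<Rightarrow> ('i, 'h) hat_gen free_alg set"
  for a r \<mu> \<alpha> av mh where
  L_add: "h \<in> fixed_cartan mh \<Longrightarrow> h' \<in> fixed_cartan mh \<Longrightarrow>
    LL (h + h') - (LL h + LL h') \<in> hat_relators a r \<mu> \<alpha> av mh"
| L_scale: "h \<in> fixed_cartan mh \<Longrightarrow> LL (c *\<^sub>C h) - c *\<^sub>C LL h \<in> hat_relators a r \<mu> \<alpha> av mh"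
| L0_H: "HH (\<mu> i) n - (xi \<mu> powi n) *\<^sub>C HH i n \<in> hat_relators a r \<mu> \<alpha> av mh"
| L0_L: "LL (of_nat (r i) *\<^sub>C (\<Sum>k\<in>residues_of \<mu>. av (pw \<mu> k i))) - HH i 0 \<in> hat_relators a r \<mu> \<alpha> av mh"
| L1_DL: "h \<in> fixed_cartan mh \<Longrightarrow> DD \<star> LL h \<in> hat_relators a r \<mu> \<alpha> av mh"
| L1_DH: "DD \<star> HH i m - of_int m *\<^sub>C HH i m \<in> hat_relators a r \<mu> \<alpha> av mh"
| L1_LH: "h \<in> fixed_cartan mh \<Longrightarrow> LL h \<star> HH i m \<in> hat_relators a r \<mu> \<alpha> av mh"
| L1_LL: "h \<in> fixed_cartan mh \<Longrightarrow> h' \<in> fixed_cartan mh \<Longrightarrow> LL h \<star> LL h' \<in> hat_relators a r \<mu> \<alpha> av mh"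
| L2_HH: "HH i m \<star> HH j n
      - (\<Sum>k\<in>residues_of \<mu>. (of_nat (r i) * of_int (a i (pw \<mu> k j)) *
          (if m + n = 0 then of_int m else 0) * xi \<mu> powi (k * m)) *\<^sub>C CC)
    \<in> hat_relators a r \<mu> \<alpha> av mh"
| L2_C: "f \<in> free_on (hat_gens mh) \<Longrightarrow> CC \<star> f \<in> hat_relators a r \<mu> \<alpha> av mh"
| L3_DX: "DD \<star> XX s i m - of_int m *\<^sub>C XX s i m \<in> hat_relators a r \<mu> \<alpha> av mh"
| L3_LX: "h \<in> fixed_cartan mh \<Longrightarrow>
    LL h \<star> XX s j n - (sgnc s * \<alpha> j h) *\<^sub>C XX s j n \<in> hat_relators a r \<mu> \<alpha> av mh"
| L4: "HH i m \<star> XX s j n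
      - sgnc s *\<^sub>C (\<Sum>k\<in>residues_of \<mu>.
          (of_nat (r i) * of_int (a i (pw \<mu> k j)) * xi \<mu> powi (k * m)) *\<^sub>C XX s j (m + n))
    \<in> hat_relators a r \<mu> \<alpha> av mh"
| L5: "XX Plus i m \<star> XX Minus j n
      - (\<Sum>k\<in>residues_of \<mu>. ((if i = pw \<mu> k j then 1 else 0) / of_nat (r j) * xi \<mu> powi (k * m)) *\<^sub>C
          (HH j (m + n) + (if m + n = 0 then of_int m else 0) *\<^sub>C CC))
    \<in> hat_relators a r \<mu> \<alpha> av mh"
| L6_X: "XX s (\<mu> i) n - (xi \<mu> powi n) *\<^sub>C XX s i n \<in> hat_relators a r \<mu> \<alpha> av mh"
| L6_XX: "pmult (\<Prod>k\<in>Gam a \<mu> i j. var 1 - const (xi \<mu> powi k) * var 0)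
      (\<lambda>n. XX s i (n 1) \<star> XX s j (n 0)) n \<in> hat_relators a r \<mu> \<alpha> av mh"
| L7: "ss a \<mu> i = 2 \<Longrightarrow>
    (\<Sum>\<sigma>\<in>{\<sigma>. \<sigma> permutes {1, 2}}.
      pmult (var (\<sigma> 1) ^ dd \<mu> i - const 2 * var (\<sigma> 2) ^ dd \<mu> i + var 3 ^ dd \<mu> i)
        (\<lambda>n. XX s i (n (\<sigma> 1)) \<star> XX s i (n (\<sigma> 2)) \<star> XX s i (n 3)) n) \<in> hat_relators a r \<mu> \<alpha> av mh"
| L8: "folded a \<mu> i j < 0 \<Longrightarrow> m = mm a \<mu> i j \<Longrightarrow>
    pmult ((\<Prod>(b, c)\<in>{(b, c). 1 \<le> b \<and> b < c \<and> c \<le> m}. p_poly a \<mu> i j (var b) (var c)) *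
        (\<Prod>b\<in>{1..m}. \<Prod>k\<in>Gam_bar a \<mu> i j. var b - const (xi \<mu> powi k) * var 0))
      (\<lambda>n. foldr (\<lambda>b x. XX s i (n b) \<star> x) [1..<Suc m] (XX s j (n 0))) n \<in> hat_relators a r \<mu> \<alpha> av mh"

section \<open>The twisted affinization\<close>

text \<open>
  \<open>(f, u, v)\<close> stands for the sum of the \<open>t\<^sup>m \<otimes> f m\<close>, \<open>u\<close> times the central element and \<open>v\<close> times
  the derivation.
\<close>

type_synonym 'g aff = "(int \<Rightarrow>\<^sub>0 'g) \<times> complex \<times> complex"

definition aff_t :: "int \<Rightarrow> 'g::complex_vs \<Rightarrow> 'g aff"
  where "aff_t m x = (Poly_Mapping.single m x, 0, 0)"

definition aff_c :: "'g::complex_vs aff"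
  where "aff_c = (0, 1, 0)"

definition aff_d :: "'g::complex_vs aff"
  where "aff_d = (0, 0, 1)"

definition t_ddt :: "(int \<Rightarrow>\<^sub>0 'g::complex_vs) \<Rightarrow> (int \<Rightarrow>\<^sub>0 'g)"
  where "t_ddt f = (\<Sum>n\<in>Poly_Mapping.keys f. Poly_Mapping.single n (of_int n *\<^sub>C Poly_Mapping.lookup f n))"

fun aff_br :: "('g::complex_vs \<Rightarrow> 'g \<Rightarrow> 'g) \<Rightarrow> ('g \<Rightarrow> 'g \<Rightarrow> complex) \<Rightarrow> 'g aff \<Rightarrow> 'g aff \<Rightarrow> 'g aff"
  where "aff_br br B (f, u, v) (f', u', v') =
    ((\<Sum>m\<in>Poly_Mapping.keys f. \<Sum>n\<in>Poly_Mapping.keys f'. Poly_Mapping.single (m + n) (br (Poly_Mapping.lookup f m) (Poly_Mapping.lookup f' n)))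
        + v *\<^sub>C t_ddt f' - v' *\<^sub>C t_ddt f,
     \<Sum>m\<in>Poly_Mapping.keys f. \<Sum>n\<in>Poly_Mapping.keys f'. (if m + n = 0 then of_int m * B (Poly_Mapping.lookup f m) (Poly_Mapping.lookup f' n) else 0),
     0)"

definition tw :: "('i \<Rightarrow> 'i) \<Rightarrow> ('g::complex_vs \<Rightarrow> 'g) \<Rightarrow> int \<Rightarrow> 'g \<Rightarrow> 'g"
  where "tw \<mu> mg m x = (\<Sum>p\<in>residues_of \<mu>. (xi \<mu> powi (- m * p)) *\<^sub>C pw mg p x)"

definition twisted_aff :: "('i \<Rightarrow> 'i) \<Rightarrow> 'h set \<Rightarrow> ('g::complex_vs \<Rightarrow> 'g \<Rightarrow> 'g) \<Rightarrow>
    (('i, 'h) km_gen \<Rightarrow> 'g) \<Rightarrow> ('g \<Rightarrow> 'g) \<Rightarrow> 'g aff set"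
  where "twisted_aff \<mu> W br \<kappa> mg =
    {(f + Poly_Mapping.single 0 y, u, v) | f y u v.
      (\<forall>m. Poly_Mapping.lookup f m \<in> tw \<mu> mg m ` derived_alg br) \<and> y \<in> (\<lambda>w. tw \<mu> mg 0 (\<kappa> (KH w))) ` W}"

end

theory Submission
  imports Defs "HOL-Combinatorics.Cycles" "HOL-Algebra.Multiplicative_Group"
begin

text \<open>
  By the universal property of a presentation, only the relators have to be evaluated on the images of
  the generators. Bracketing the twisted sums gives
  \<open>[x\<^sub>(\<^sub>m\<^sub>), y\<^sub>(\<^sub>n\<^sub>)] = \<Sum>\<^sub>k \<xi>^(k m) [\<mu>^(- k) x, y]\<^sub>(\<^sub>m\<^sub>+\<^sub>n\<^sub>)\<close>, which yields the relations in one variable.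
  For the relations between several formal variables, an iterated bracket of the \<open>X\<^sub>i(z\<^sub>b)\<close> on
  \<open>X\<^sub>j(w)\<close> splits into distributions supported on the lines \<open>z\<^sub>b = \<xi>^(k b) w\<close>, whose coefficients are
  words in the \<open>e\<close>'s with indices \<open>\<mu>^(- k b) i\<close>, applied to \<open>e\<^sub>j\<close>. Such a word is zero by the Serre
  relations if all its indices are linked to \<open>j\<close> and equal; if some indices are not linked to \<open>j\<close> and no
  two indices are adjacent, the innermost of these letters commutes with everything to its right. In the
  remaining cases two of the indices are adjacent, or different and both linked to \<open>j\<close>, and then
  \<open>p\<^sub>i\<^sub>j\<close> vanishes on the line.

  The image contains \<open>t^m \<otimes> x\<^sub>(\<^sub>m\<^sub>)\<close> for every \<open>x\<close> in the derived algebra, which is spanned by words in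
  the \<open>e\<close>'s, because \<open>\<Sum>\<^sub>b [t^(m-b) x\<^sub>(\<^sub>m\<^sub>-\<^sub>b\<^sub>), t^b y\<^sub>(\<^sub>b\<^sub>)] = N t^m [x, y]\<^sub>(\<^sub>m\<^sub>)\<close> up to central terms.
\<close>

section \<open>Linear maps and Lie algebras\<close>

text \<open>Two constants are forced. For \<open>h\<close> fixed by \<open>mh\<close> the sum
  \<open>h_(0)\<close> is \<open>N h\<close>, so L0, which equates \<open>L_h\<close> for an orbit
  sum with \<open>H_{i,0}\<close>, requires \<open>L_h\<close> to go to \<open>(1/N) h_(0)\<close>,
  that is, to \<open>h\<close>. In degree \<open>m + n = 0\<close> the form of two twisted sums
  carries a factor \<open>N\<close>, so L2 and L5 require \<open>C\<close> to go to \<open>N\<close>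
  times the central element. The unscaled \<open>h_(0)\<close> and the central element divided by
  \<open>N\<close>, as in the opening sentence, agree with this only for \<open>N = 1\<close>. The
  twisted sums behave as expected only if \<open>mg\<close> has order dividing \<open>N\<close>,
  which is not given: on the complement \<open>W\<close> the action is prescribed through the simple
  roots, hence only modulo the centre. A dimension count shows that \<open>W\<close> meets the
  centre trivially, and this removes the ambiguity. Central terms in long brackets are controlled by
  the height grading: words whose heights have the same sign are orthogonal, so no central term
  appears in L6 to L8.\<close>

lemma clinearI:
  assumes "\<And>x y. f (x + y) = f x + f y" and "\<And>c x. f (c *\<^sub>C x) = c *\<^sub>C f x"
  shows "clinear f"
  by unfold_locales (auto simp: assms)

lemma
  assumes "clinear f"
  shows clinear_add: "f (x + y) = f x + f y"
    and clinear_scale: "f (c *\<^sub>C x) = c *\<^sub>C f x"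
    and clinear_zero: "f 0 = 0"
    and clinear_minus: "f (- x) = - f x"
    and clinear_diff: "f (x - y) = f x - f y"
    and clinear_sum: "f (sum g A) = (\<Sum>a\<in>A. f (g a))"
proof -
  interpret Vector_Spaces.linear cscale cscale f by fact
  show "f (x + y) = f x + f y" "f (c *\<^sub>C x) = c *\<^sub>C f x" "f 0 = 0" "f (- x) = - f x"
    "f (x - y) = f x - f y" "f (sum g A) = (\<Sum>a\<in>A. f (g a))"
    by (rule add scale zero neg diff sum)+
qed

lemma clinear_comp:
  assumes f: "clinear f" and g: "clinear g"
  shows "clinear (\<lambda>x. f (g x))"
  by (rule clinearI)
    (simp_all add: clinear_add[OF f] clinear_scale[OF f] clinear_add[OF g] clinear_scale[OF g])

lemma clinear_plus:
  assumes f: "clinear f" and g: "clinear g"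
  shows "clinear (\<lambda>x. f x + g x)"
  by (rule clinearI)
    (simp_all add: clinear_add[OF f] clinear_scale[OF f] clinear_add[OF g] clinear_scale[OF g]
      cscale_add_right algebra_simps)

lemma clinear_const_zero: "clinear (\<lambda>_. 0)"
  by (rule clinearI) simp_all

lemma clinear_sum_fun: "(\<And>a. a \<in> A \<Longrightarrow> clinear (f a)) \<Longrightarrow> clinear (\<lambda>x. \<Sum>a\<in>A. f a x)"
  by (induction A rule: infinite_finite_induct) (simp_all add: clinear_const_zero clinear_plus)

lemma clinear_cscale: "clinear (\<lambda>x. c *\<^sub>C x)"
  by (rule clinearI) (simp_all add: cscale_add_right mult.commute)

lemma clinear_cscale_comp: "clinear f \<Longrightarrow> clinear (\<lambda>x. c *\<^sub>C f x)"
  by (rule clinear_comp[OF clinear_cscale])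

lemma clinear_uminus: "clinear f \<Longrightarrow> clinear (\<lambda>x. - f x)"
  using clinear_cscale_comp[of f "-1"] by simp

lemma clinear_id: "clinear (\<lambda>x. x)"
  by (rule clinearI) simp_all

lemma clinear_funpow: "clinear f \<Longrightarrow> clinear (f ^^ n)" for f :: "'a::complex_vs \<Rightarrow> 'a"
proof (induction n)
  case (Suc n)
  then show ?case using clinear_comp[of f "f ^^ n"] by (simp add: comp_def)
qed (simp add: clinear_id id_def)

lemma clinear_eq_on_span:
  assumes f: "clinear f" and g: "clinear g"
    and eq: "\<And>x. x \<in> A \<Longrightarrow> f x = g x" and x: "x \<in> cvs.span A"
  shows "f x = g x"
proof -
  have "cvs.subspace {x. f x = g x}"
    by (auto simp: cvs.subspace_def clinear_add[OF f] clinear_scale[OF f] clinear_zero[OF f]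
        clinear_add[OF g] clinear_scale[OF g] clinear_zero[OF g])
  then have "cvs.span A \<subseteq> {x. f x = g x}"
    by (intro cvs.span_minimal) (auto simp: eq)
  then show ?thesis using x by auto
qed

lemma bilinear_eq_on_span:
  assumes "\<And>y. clinear (\<lambda>x. f x y)" "\<And>x. clinear (f x)" "\<And>y. clinear (\<lambda>x. g x y)" "\<And>x. clinear (g x)"
    and "\<And>x y. x \<in> A \<Longrightarrow> y \<in> A \<Longrightarrow> f x y = g x y" and span: "cvs.span A = UNIV"
  shows "f x y = g x y"
proof -
  have "f x y = g x y" if "x \<in> A" for x y
    by (rule clinear_eq_on_span[of "f x" "g x" A y]) (use assms that in auto)
  then show ?thesis
    by (intro clinear_eq_on_span[of "\<lambda>x. f x y" "\<lambda>x. g x y" A x]) (use assms in auto)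
qed

context lie_algebra
begin

lemma
  shows br_add_left: "br (x + y) z = br x z + br y z"
    and br_add_right: "br x (y + z) = br x y + br x z"
    and br_scale_left: "br (c *\<^sub>C x) z = c *\<^sub>C br x z"
    and br_scale_right: "br x (c *\<^sub>C z) = c *\<^sub>C br x z"
    and br_zero_left: "br 0 x = 0"
    and br_zero_right: "br x 0 = 0"
    and br_minus_left: "br (- x) y = - br x y"
    and br_minus_right: "br x (- y) = - br x y"
    and br_sum_left: "br (sum f A) y = (\<Sum>a\<in>A. br (f a) y)"
    and br_sum_right: "br x (sum f A) = (\<Sum>a\<in>A. br x (f a))"
  by (rule clinear_add[OF linear_left] clinear_add[OF linear_right] clinear_scale[OF linear_left]
      clinear_scale[OF linear_right] clinear_zero[OF linear_left] clinear_zero[OF linear_right]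
      clinear_minus[OF linear_left] clinear_minus[OF linear_right] clinear_sum[OF linear_left]
      clinear_sum[OF linear_right])+

lemmas br_bilinear = br_add_left br_add_right br_scale_left br_scale_right br_zero_left br_zero_right
  br_minus_left br_minus_right br_sum_left br_sum_right

lemma br_antisym: "br x y = - br y x"
proof -
  have "br (x + y) (x + y) = br x y + br y x"
    unfolding br_add_left br_add_right by (simp add: alternating)
  then show ?thesis by (simp add: alternating eq_neg_iff_add_eq_0)
qed

lemma br_leibniz: "br x (br y z) = br (br x y) z + br y (br x z)"
proof -
  have "br x (br y z) + br y (br z x) + br z (br x y) = 0" by (rule jacobi)
  moreover have "br y (br z x) = - br y (br x z)" using br_antisym[of z x] by (simp add: br_minus_right)
  moreover have "br z (br x y) = - br (br x y) z" by (rule br_antisym)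
  ultimately show ?thesis by (simp add: algebra_simps)
qed

end

text \<open>Both sides of antisymmetry and of the Jacobi identity are multilinear, so a spanning set
  decides them; \<open>br x x = 0\<close> then follows because 2 is invertible.\<close>

lemma lie_algebra_spanI:
  assumes left: "\<And>y. clinear (\<lambda>x. br x y)" and right: "\<And>x. clinear (br x)"
    and span: "cvs.span A = UNIV"
    and anti: "\<And>x y. x \<in> A \<Longrightarrow> y \<in> A \<Longrightarrow> br x y = - br y x"
    and jac: "\<And>x y z. x \<in> A \<Longrightarrow> y \<in> A \<Longrightarrow> z \<in> A \<Longrightarrow> br x (br y z) + br y (br z x) + br z (br x y) = 0"
  shows "lie_algebra br"
proof
  have anti: "br x y = - br y x" for x y
    by (rule bilinear_eq_on_span[of br "\<lambda>x y. - br y x" A])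
      (intro clinear_uminus left right span anti | assumption)+
  show "br x x = 0" for x
  proof -
    have "br x x + br x x = 0" using anti[of x x] by (simp add: eq_neg_iff_add_eq_0)
    then have "(2::complex) *\<^sub>C br x x = 0"
      using cscale_add_left[of 1 1 "br x x"] by (simp add: cscale_one)
    then show ?thesis by simp
  qed
  note lin = clinear_plus clinear_comp[OF right right] clinear_comp[OF right left]
    clinear_comp[OF left left] clinear_comp[OF left right] clinear_const_zero left right
  have J: "br x (br y z) + br y (br z x) + br z (br x y) = 0" if "x \<in> A" for x y z
    by (rule bilinear_eq_on_span[of "\<lambda>y z. br x (br y z) + br y (br z x) + br z (br x y)" "\<lambda>_ _. 0" A])
      (intro lin jac span that | assumption)+
  show "br x (br y z) + br y (br z x) + br z (br x y) = 0" for x y z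
  proof (rule clinear_eq_on_span[of "\<lambda>x. br x (br y z) + br y (br z x) + br z (br x y)" "\<lambda>_. 0" A])
    show "clinear (\<lambda>x. br x (br y z) + br y (br z x) + br z (br x y))" by (intro lin)
  qed (simp_all add: J span clinear_const_zero)
qed (rule clinear_add[OF left] clinear_scale[OF left] clinear_add[OF right] clinear_scale[OF right])+

section \<open>The universal property of a presentation\<close>

text \<open>Evaluation, \<open>t_ddt\<close>, the loop bracket, its cocycle and \<open>pmult\<close>
  are all sums over a support. Supports vary with the argument, so the sums are first extended to a
  common finite set, where the additional terms are \<open>K m 0 = 0\<close>.\<close>

lemma clinear_keys_sum:
  assumes K: "\<And>m. clinear (K m)"
  shows "clinear (\<lambda>f. \<Sum>m\<in>Poly_Mapping.keys f. K m (Poly_Mapping.lookup f m))"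
proof (rule clinearI)
  have superset: "(\<Sum>m\<in>Poly_Mapping.keys f. K m (Poly_Mapping.lookup f m)) = (\<Sum>m\<in>S. K m (Poly_Mapping.lookup f m))"
    if "finite S" "Poly_Mapping.keys f \<subseteq> S" for S f
    by (rule sum.mono_neutral_left)
      (use that in \<open>auto simp: not_in_keys_iff_lookup_eq_zero clinear_zero[OF K]\<close>)
  fix f g :: "'a \<Rightarrow>\<^sub>0 'b" and c :: complex
  let ?S = "Poly_Mapping.keys f \<union> Poly_Mapping.keys g"
  show "(\<Sum>m\<in>Poly_Mapping.keys (f + g). K m (Poly_Mapping.lookup (f + g) m)) =
    (\<Sum>m\<in>Poly_Mapping.keys f. K m (Poly_Mapping.lookup f m)) +
    (\<Sum>m\<in>Poly_Mapping.keys g. K m (Poly_Mapping.lookup g m))"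
    using Poly_Mapping.keys_add[of f g] superset[of ?S f] superset[of ?S g] superset[of ?S "f + g"]
    by (simp add: lookup_add clinear_add[OF K] sum.distrib)
  have "Poly_Mapping.keys (c *\<^sub>C f) \<subseteq> Poly_Mapping.keys f"
    by (auto simp: in_keys_iff lookup_cscale)
  then show "(\<Sum>m\<in>Poly_Mapping.keys (c *\<^sub>C f). K m (Poly_Mapping.lookup (c *\<^sub>C f) m)) =
    c *\<^sub>C (\<Sum>m\<in>Poly_Mapping.keys f. K m (Poly_Mapping.lookup f m))"
    using superset[of "Poly_Mapping.keys f" "c *\<^sub>C f"]
    by (simp add: lookup_cscale clinear_scale[OF K] cvs.scale_sum_right)
qed

lemma keys_sum_single:
  assumes "clinear (K m)"
  shows "(\<Sum>k\<in>Poly_Mapping.keys (Poly_Mapping.single m x). K k (Poly_Mapping.lookup (Poly_Mapping.single m x) k)) = K m x"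
  by (simp add: clinear_zero[OF assms])

lemma poly_mapping_sum_single:
  "(\<Sum>m\<in>Poly_Mapping.keys f. Poly_Mapping.single m (Poly_Mapping.lookup f m)) = f"
proof (rule poly_mapping_eqI)
  fix k
  have "Poly_Mapping.lookup f k = 0" if "k \<notin> Poly_Mapping.keys f"
    using that by (simp add: in_keys_iff)
  then show "Poly_Mapping.lookup (\<Sum>m\<in>Poly_Mapping.keys f. Poly_Mapping.single m (Poly_Mapping.lookup f m)) k =
      Poly_Mapping.lookup f k"
    by (auto simp: lookup_sum lookup_single when_def)
qed

lemma clinear_scale_vector: "clinear (\<lambda>c. c *\<^sub>C x)"
  by (rule clinearI) (simp_all add: cscale_add_left cscale_complex_def)

lemma clinear_single: "clinear f \<Longrightarrow> clinear (\<lambda>x. Poly_Mapping.single m (f x))"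
  by (rule clinear_comp[of "Poly_Mapping.single m"])
    (auto intro!: clinearI poly_mapping_eqI simp: single_add lookup_cscale lookup_single when_def)

lemma clinear_eval_free: "clinear (eval_free br \<iota>)"
  using clinear_keys_sum[OF clinear_scale_vector] unfolding eval_free_def[abs_def] .

lemmas eval_free_add = clinear_add[OF clinear_eval_free]
  and eval_free_scale = clinear_scale[OF clinear_eval_free]
  and eval_free_zero = clinear_zero[OF clinear_eval_free]
  and eval_free_diff = clinear_diff[OF clinear_eval_free]
  and eval_free_sum = clinear_sum[OF clinear_eval_free]

lemma eval_free_single: "eval_free br \<iota> (Poly_Mapping.single t c) = c *\<^sub>C eval_word br \<iota> t"
  unfolding eval_free_def using keys_sum_single[OF clinear_scale_vector] .

lemma eval_free_letter: "eval_free br \<iota> (letter x) = \<iota> x"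
  by (simp add: letter_def eval_free_single)

lemma (in lie_algebra) eval_free_fmult:
  "eval_free br \<iota> (f \<star> g) = br (eval_free br \<iota> f) (eval_free br \<iota> g)"
  unfolding fmult_def eval_free_sum eval_free_single
  unfolding eval_free_def br_sum_left br_scale_left unfolding br_sum_right br_scale_right
  by (simp add: cvs.scale_sum_right)

lemma free_on_zero: "0 \<in> free_on G"
  by (simp add: free_on_def)

lemma free_on_add: "f \<in> free_on G \<Longrightarrow> g \<in> free_on G \<Longrightarrow> f + g \<in> free_on G"
  using Poly_Mapping.keys_add[of f g] by (auto simp: free_on_def)

lemma free_on_scale: "f \<in> free_on G \<Longrightarrow> c *\<^sub>C f \<in> free_on G"
  by (auto simp: free_on_def in_keys_iff lookup_cscale cscale_complex_def)

lemma free_on_diff: "f \<in> free_on G \<Longrightarrow> g \<in> free_on G \<Longrightarrow> f - g \<in> free_on G"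
  using free_on_add[of f G "(-1) *\<^sub>C g"] free_on_scale[of g G "-1"] by simp

lemma free_on_sum: "(\<And>a. a \<in> A \<Longrightarrow> f a \<in> free_on G) \<Longrightarrow> sum f A \<in> free_on G"
  by (induction A rule: infinite_finite_induct) (auto intro: free_on_zero free_on_add)

lemma free_on_fmult: "f \<in> free_on G \<Longrightarrow> g \<in> free_on G \<Longrightarrow> f \<star> g \<in> free_on G"
  unfolding fmult_def by (intro free_on_sum) (fastforce simp: free_on_def split: if_splits)

lemma free_on_letter: "x \<in> G \<Longrightarrow> letter x \<in> free_on G"
  by (simp add: free_on_def letter_def)

lemma (in lie_algebra) eval_free_lie_ideal:
  assumes "\<And>f. f \<in> R \<Longrightarrow> eval_free br \<iota> f = 0" "f \<in> lie_ideal G R"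
  shows "eval_free br \<iota> f = 0"
  using assms(2)
  by induction (simp_all add: assms(1) eval_free_add eval_free_scale eval_free_zero eval_free_fmult
      br_bilinear alternating jacobi)

lemma (in lie_algebra) eval_free_in_subalgebra:
  assumes "cvs.subspace S" "\<And>x. x \<in> G \<Longrightarrow> \<iota> x \<in> S" "\<And>x y. x \<in> S \<Longrightarrow> y \<in> S \<Longrightarrow> br x y \<in> S"
    and f: "f \<in> free_on G"
  shows "eval_free br \<iota> f \<in> S"
proof -
  have "eval_word br \<iota> t \<in> S" if "set_magma t \<subseteq> G" for t
    using that by (induction t) (auto simp: assms)
  then show ?thesis
    unfolding eval_free_def using f
    by (intro cvs.subspace_sum cvs.subspace_scale assms(1)) (auto simp: free_on_def)
qed

lemma presented_by_induct:
  assumes "presented_by br \<iota> G R"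
    and "cvs.subspace S" "\<And>x. x \<in> G \<Longrightarrow> \<iota> x \<in> S" "\<And>x y. x \<in> S \<Longrightarrow> y \<in> S \<Longrightarrow> br x y \<in> S"
  shows "z \<in> S"
proof -
  interpret lie_algebra br using assms(1) by (simp add: presented_by_def)
  have "z \<in> eval_free br \<iota> ` free_on G" using assms(1) by (simp add: presented_by_def)
  then show ?thesis using eval_free_in_subalgebra[OF assms(2-4)] by auto
qed

lemma lie_hom_eq_on_generators:
  assumes pres: "presented_by br \<iota> G R" and "lie_hom br br' \<phi>" "lie_hom br br' \<psi>"
    and gens: "\<And>x. x \<in> G \<Longrightarrow> \<phi> (\<iota> x) = \<psi> (\<iota> x)"
  shows "\<phi> = \<psi>"
proof
  fix z
  have lin: "clinear \<phi>" "clinear \<psi>" and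
    hom: "\<phi> (br x y) = br' (\<phi> x) (\<phi> y)" "\<psi> (br x y) = br' (\<psi> x) (\<psi> y)" for x y
    using assms by (auto simp: lie_hom_def)
  have "cvs.subspace {x. \<phi> x = \<psi> x}"
    by (auto simp: cvs.subspace_def clinear_add[OF lin(1)] clinear_scale[OF lin(1)] clinear_zero[OF lin(1)]
        clinear_add[OF lin(2)] clinear_scale[OF lin(2)] clinear_zero[OF lin(2)])
  then have "z \<in> {x. \<phi> x = \<psi> x}"
    by (rule presented_by_induct[OF pres]) (auto simp: gens hom)
  then show "\<phi> z = \<psi> z" by simp
qed

lemma presented_by_lift:
  assumes pres: "presented_by br \<iota> G R" and lie': "lie_algebra br'"
    and rel: "\<And>f. f \<in> R \<Longrightarrow> eval_free br' \<iota>' f = 0"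
  obtains \<phi> where "lie_hom br br' \<phi>" "\<And>x. x \<in> G \<Longrightarrow> \<phi> (\<iota> x) = \<iota>' x"
proof -
  interpret L: lie_algebra br using pres by (simp add: presented_by_def)
  interpret L': lie_algebra br' by fact
  \<comment> \<open>An arbitrary preimage in the free algebra. Two preimages differ by an element of
    \<open>lie_ideal G R\<close>, on which the new evaluation vanishes, so the choice does not
    matter.\<close>
  define pre where "pre z = (SOME f. f \<in> free_on G \<and> eval_free br \<iota> f = z)" for z
  define \<phi> where "\<phi> z = eval_free br' \<iota>' (pre z)" for z
  have pre: "pre z \<in> free_on G \<and> eval_free br \<iota> (pre z) = z" for z
  proof -
    have "z \<in> eval_free br \<iota> ` free_on G" using pres by (simp add: presented_by_def)
    then obtain f where "f \<in> free_on G \<and> eval_free br \<iota> f = z" by auto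
    then show ?thesis unfolding pre_def by (rule someI)
  qed
  have \<phi>: "\<phi> (eval_free br \<iota> f) = eval_free br' \<iota>' f" if "f \<in> free_on G" for f
  proof -
    let ?g = "pre (eval_free br \<iota> f)"
    have "?g - f \<in> free_on G" by (intro free_on_diff) (simp_all add: that pre)
    moreover have "eval_free br \<iota> (?g - f) = 0"
      using pre by (simp add: eval_free_diff)
    ultimately have "?g - f \<in> lie_ideal G R"
      using pres by (auto simp: presented_by_def)
    then have "eval_free br' \<iota>' (?g - f) = 0"
      using L'.eval_free_lie_ideal rel by blast
    then show ?thesis by (simp add: eval_free_diff \<phi>_def)
  qed
  have "\<phi> (x + y) = \<phi> x + \<phi> y" for x y
    using \<phi>[of "pre x + pre y"] pre by (simp add: free_on_add eval_free_add \<phi>_def)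
  moreover have "\<phi> (c *\<^sub>C x) = c *\<^sub>C \<phi> x" for c x
    using \<phi>[of "c *\<^sub>C pre x"] pre by (simp add: free_on_scale eval_free_scale \<phi>_def)
  ultimately have "clinear \<phi>" by (intro clinearI)
  moreover have "\<phi> (br x y) = br' (\<phi> x) (\<phi> y)" for x y
    using \<phi>[of "pre x \<star> pre y"] pre
    by (simp add: free_on_fmult L.eval_free_fmult L'.eval_free_fmult \<phi>_def)
  ultimately have "lie_hom br br' \<phi>"
    using L.lie_algebra_axioms lie' by (simp add: lie_hom_def)
  moreover have "\<phi> (\<iota> x) = \<iota>' x" if "x \<in> G" for x
    using \<phi>[OF free_on_letter[OF that]] by (simp add: eval_free_letter)
  ultimately show thesis by (rule that)
qed

lemma subspace_range_clinear:
  assumes f: "clinear f"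
  shows "cvs.subspace (range f)"
  unfolding cvs.subspace_def
proof (safe)
  show "0 \<in> range f" using clinear_zero[OF f] by (metis rangeI)
  show "f x + f y \<in> range f" for x y by (simp flip: clinear_add[OF f])
  show "c *\<^sub>C f x \<in> range f" for c x by (simp flip: clinear_scale[OF f])
qed

section \<open>The affinization is a Lie algebra\<close>

lemma clinear_Pair: "clinear f \<Longrightarrow> clinear g \<Longrightarrow> clinear (\<lambda>x. (f x, g x))"
  by (auto intro!: clinearI simp: clinear_add[of f] clinear_add[of g] clinear_scale[of f]
      clinear_scale[of g] cscale_prod_def)

lemma clinear_fst: "clinear f \<Longrightarrow> clinear (\<lambda>x. fst (f x))"
  by (rule clinear_comp[of fst]) (auto intro: clinearI simp: cscale_prod_def)

lemma clinear_snd: "clinear f \<Longrightarrow> clinear (\<lambda>x. snd (f x))"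
  by (rule clinear_comp[of snd]) (auto intro: clinearI simp: cscale_prod_def)

lemma clinear_diff_fun: "clinear f \<Longrightarrow> clinear g \<Longrightarrow> clinear (\<lambda>x. f x - g x)"
  using clinear_plus[OF _ clinear_uminus, of f g] by simp

lemma clinear_scale_fun: "clinear c \<Longrightarrow> clinear (\<lambda>x. c x *\<^sub>C y)"
  using clinear_comp[OF clinear_scale_vector, of c] by simp

lemma clinear_aff_t: "clinear f \<Longrightarrow> clinear (\<lambda>x. aff_t m (f x))"
  unfolding aff_t_def by (intro clinear_Pair clinear_single clinear_const_zero)

lemmas aff_t_add = clinear_add[OF clinear_aff_t[OF clinear_id]]
  and aff_t_scale = clinear_scale[OF clinear_aff_t[OF clinear_id]]
  and aff_t_zero = clinear_zero[OF clinear_aff_t[OF clinear_id]]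
  and aff_t_minus = clinear_minus[OF clinear_aff_t[OF clinear_id]]
  and aff_t_sum = clinear_sum[OF clinear_aff_t[OF clinear_id]]

lemma aff_decomp:
  "(f, u, v) = (\<Sum>m\<in>Poly_Mapping.keys f. aff_t m (Poly_Mapping.lookup f m)) + u *\<^sub>C aff_c + v *\<^sub>C aff_d"
proof -
  have "(\<Sum>m\<in>M. aff_t m (g m)) = ((\<Sum>m\<in>M. Poly_Mapping.single m (g m)), 0, 0)" for M and g :: "int \<Rightarrow> 'a"
    by (induction M rule: infinite_finite_induct) (auto simp: aff_t_def zero_prod_def)
  then show ?thesis
    by (simp add: poly_mapping_sum_single aff_c_def aff_d_def cscale_prod_def cscale_complex_def)
qed

definition aff_spanning :: "'g::complex_vs aff set"
  where "aff_spanning = {aff_t m x | m x. True} \<union> {aff_c, aff_d}"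

lemma span_aff_spanning: "cvs.span aff_spanning = (UNIV :: 'g::complex_vs aff set)"
proof -
  have "p \<in> cvs.span aff_spanning" for p :: "'g aff"
  proof (cases p)
    case (fields f u v)
    show ?thesis unfolding fields aff_decomp
      by (intro cvs.span_add cvs.span_sum cvs.span_scale cvs.span_base) (auto simp: aff_spanning_def)
  qed
  then show ?thesis by auto
qed

lemma clinear_t_ddt: "clinear t_ddt"
  unfolding t_ddt_def[abs_def]
  by (rule clinear_keys_sum) (intro clinear_single clinear_cscale)

lemma t_ddt_single: "t_ddt (Poly_Mapping.single n x) = Poly_Mapping.single n (of_int n *\<^sub>C x)"
  unfolding t_ddt_def by (rule keys_sum_single) (intro clinear_single clinear_cscale)

lemma t_ddt_zero: "t_ddt 0 = 0"
  by (simp add: t_ddt_def)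

declare aff_br.simps [simp del]

locale quadratic_lie_algebra = lie_algebra br for br :: "'g::complex_vs \<Rightarrow> 'g \<Rightarrow> 'g" +
  fixes B :: "'g \<Rightarrow> 'g \<Rightarrow> complex"
  assumes form_right: "clinear (B x)"
    and form_sym: "B x y = B y x"
    and form_invariant: "B (br x y) z = B x (br y z)"
begin

lemma form_left: "clinear (\<lambda>x. B x y)"
  using form_right[of y] by (simp add: form_sym[of _ y])

lemma
  shows form_scale_left: "B (c *\<^sub>C x) z = c * B x z"
    and form_scale_right: "B x (c *\<^sub>C z) = c * B x z"
    and form_zero_right: "B x 0 = 0"
  using clinear_scale[OF form_left] clinear_scale[OF form_right]
  by (simp_all add: clinear_zero[OF form_right] cscale_complex_def)

definition loop_br :: "(int \<Rightarrow>\<^sub>0 'g) \<Rightarrow> (int \<Rightarrow>\<^sub>0 'g) \<Rightarrow> (int \<Rightarrow>\<^sub>0 'g)"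
  where "loop_br f g = (\<Sum>m\<in>Poly_Mapping.keys f. \<Sum>n\<in>Poly_Mapping.keys g.
    Poly_Mapping.single (m + n) (br (Poly_Mapping.lookup f m) (Poly_Mapping.lookup g n)))"

definition loop_cocycle :: "(int \<Rightarrow>\<^sub>0 'g) \<Rightarrow> (int \<Rightarrow>\<^sub>0 'g) \<Rightarrow> complex"
  where "loop_cocycle f g = (\<Sum>m\<in>Poly_Mapping.keys f. \<Sum>n\<in>Poly_Mapping.keys g.
    if m + n = 0 then of_int m * B (Poly_Mapping.lookup f m) (Poly_Mapping.lookup g n) else 0)"

text \<open>With projections in place of patterns, linearity in either argument can be composed from
  that of \<open>loop_br\<close>, \<open>loop_cocycle\<close> and \<open>t_ddt\<close>.\<close>

lemma aff_br_eq: "aff_br br B p q =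
    (loop_br (fst p) (fst q) + snd (snd p) *\<^sub>C t_ddt (fst q) - snd (snd q) *\<^sub>C t_ddt (fst p),
     loop_cocycle (fst p) (fst q), 0)"
  by (cases p; cases q) (simp add: aff_br.simps loop_br_def loop_cocycle_def)

lemma clinear_cocycle_summand:
  fixes m n :: int
  shows "clinear (\<lambda>x. if m + n = 0 then of_int m * B x y else 0)"
    and "clinear (\<lambda>x. if m + n = 0 then of_int m * B y x else 0)"
  using clinear_cscale_comp[OF form_left, of "of_int m" y] clinear_cscale_comp[OF form_right, of "of_int m" y]
    clinear_const_zero[where ?'a = 'g and ?'b = complex]
  by (cases "m + n = 0"; simp only: cscale_complex_def if_True if_False)+

lemma clinear_loop_br_left: "clinear (\<lambda>f. loop_br f g)"
  unfolding loop_br_def by (intro clinear_keys_sum clinear_sum_fun clinear_single linear_left)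

lemma clinear_loop_br_right: "clinear (loop_br f)"
  unfolding loop_br_def[abs_def]
  by (intro clinear_sum_fun clinear_keys_sum clinear_single linear_right)

lemma clinear_loop_cocycle_left: "clinear (\<lambda>f. loop_cocycle f g)"
  unfolding loop_cocycle_def by (intro clinear_keys_sum clinear_sum_fun clinear_cocycle_summand)

lemma clinear_loop_cocycle_right: "clinear (loop_cocycle f)"
  unfolding loop_cocycle_def[abs_def]
  by (intro clinear_sum_fun clinear_keys_sum clinear_cocycle_summand)

lemma loop_br_single:
  "loop_br (Poly_Mapping.single m x) (Poly_Mapping.single n y) = Poly_Mapping.single (m + n) (br x y)"
proof -
  have "loop_br (Poly_Mapping.single m x) g =
      (\<Sum>n\<in>Poly_Mapping.keys g. Poly_Mapping.single (m + n) (br x (Poly_Mapping.lookup g n)))" for g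
    unfolding loop_br_def
    by (rule keys_sum_single[of "\<lambda>m x. \<Sum>n\<in>Poly_Mapping.keys g. Poly_Mapping.single (m + n) (br x (Poly_Mapping.lookup g n))"])
      (intro clinear_sum_fun clinear_single linear_left)
  then show ?thesis
    using keys_sum_single[of "\<lambda>n y. Poly_Mapping.single (m + n) (br x y)" n y]
    by (simp add: clinear_single linear_right)
qed

lemma loop_cocycle_single:
  "loop_cocycle (Poly_Mapping.single m x) (Poly_Mapping.single n y) = (if m + n = 0 then of_int m * B x y else 0)"
proof -
  have "loop_cocycle (Poly_Mapping.single m x) g =
      (\<Sum>n\<in>Poly_Mapping.keys g. if m + n = 0 then of_int m * B x (Poly_Mapping.lookup g n) else 0)" for g
    unfolding loop_cocycle_def
    by (rule keys_sum_single[of "\<lambda>m x. \<Sum>n\<in>Poly_Mapping.keys g. if m + n = 0 then of_int m * B x (Poly_Mapping.lookup g n) else 0"])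
      (intro clinear_sum_fun clinear_cocycle_summand)
  then show ?thesis
    using keys_sum_single[of "\<lambda>n y. if m + n = 0 then of_int m * B x y else 0" n y]
    by (simp add: clinear_cocycle_summand)
qed

lemma loop_br_zero: "loop_br 0 g = 0" "loop_br f 0 = 0"
  by (simp_all add: loop_br_def)

lemma loop_cocycle_zero: "loop_cocycle 0 g = 0" "loop_cocycle f 0 = 0"
  by (simp_all add: loop_cocycle_def)

lemma aff_br_t_t: "aff_br br B (aff_t m x) (aff_t n y) =
    aff_t (m + n) (br x y) + (if m + n = 0 then of_int m * B x y else 0) *\<^sub>C aff_c"
  by (simp add: aff_br_eq aff_t_def aff_c_def loop_br_single loop_cocycle_single cscale_prod_def
      cscale_complex_def)

lemma
  shows aff_br_d_t: "aff_br br B aff_d (aff_t n y) = aff_t n (of_int n *\<^sub>C y)"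
    and aff_br_t_d: "aff_br br B (aff_t n y) aff_d = - aff_t n (of_int n *\<^sub>C y)"
    and aff_br_d_d: "aff_br br B aff_d aff_d = 0"
    and aff_br_c_left: "aff_br br B aff_c p = 0"
    and aff_br_c_right: "aff_br br B p aff_c = 0"
  by (simp_all add: aff_br_eq aff_t_def aff_c_def aff_d_def loop_br_zero loop_cocycle_zero
      t_ddt_single t_ddt_zero zero_prod_def cscale_one)

lemma lie_algebra_aff_br: "lie_algebra (aff_br br B)"
proof (rule lie_algebra_spanI[OF _ _ span_aff_spanning])
  show left: "clinear (\<lambda>p. aff_br br B p q)" for q
    unfolding aff_br_eq
    by (intro clinear_Pair clinear_diff_fun clinear_plus clinear_const_zero clinear_scale_fun
        clinear_cscale_comp clinear_snd clinear_id clinear_comp[OF clinear_loop_br_left]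
        clinear_comp[OF clinear_loop_cocycle_left] clinear_comp[OF clinear_t_ddt] clinear_fst)
  show right: "clinear (aff_br br B p)" for p
    unfolding aff_br_eq[abs_def]
    by (intro clinear_Pair clinear_diff_fun clinear_plus clinear_const_zero clinear_scale_fun
        clinear_cscale_comp clinear_snd clinear_id clinear_comp[OF clinear_loop_br_right]
        clinear_comp[OF clinear_loop_cocycle_right] clinear_comp[OF clinear_t_ddt] clinear_fst)
  note lin = clinear_add[OF left] clinear_add[OF right] clinear_scale[OF left] clinear_scale[OF right]
    clinear_minus[OF left] clinear_minus[OF right] clinear_zero[OF left] clinear_zero[OF right]
  have tt: "aff_br br B (aff_t m x) (aff_t n y) = - aff_br br B (aff_t n y) (aff_t m x)" for m n x y
  proof -
    have e: "aff_t (m + n) (br x y) = - aff_t (n + m) (br y x)"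
      by (subst br_antisym) (simp add: aff_t_minus add.commute)
    have "of_int m = - (of_int n :: complex)" if "m + n = 0"
      using that by (simp add: eq_neg_iff_add_eq_0 flip: of_int_add)
    then have c: "(if m + n = 0 then of_int m * B x y else 0) = - (if n + m = 0 then of_int n * B y x else 0)"
      by (auto simp: form_sym[of x y] add.commute)
    show ?thesis unfolding aff_br_t_t e c by simp
  qed
  show "aff_br br B x y = - aff_br br B y x" if "x \<in> aff_spanning" "y \<in> aff_spanning" for x y
    using that tt
    by (auto simp: aff_spanning_def aff_br_d_t aff_br_t_d aff_br_d_d aff_br_c_left aff_br_c_right)
  have sum3: "aff_t k x + aff_t k y + aff_t k z = aff_t k (x + y + z)" for k x y z
    by (simp add: aff_t_add)
  have ttt: "aff_br br B (aff_t k x) (aff_br br B (aff_t m y) (aff_t n z)) +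
      aff_br br B (aff_t m y) (aff_br br B (aff_t n z) (aff_t k x)) +
      aff_br br B (aff_t n z) (aff_br br B (aff_t k x) (aff_t m y)) = 0" for k m n x y z
  proof -
    \<comment> \<open>Invariance and symmetry give all three cyclic terms the same value of the
      form, so the central part is \<open>k + m + n\<close> times it, and it occurs only when that
      sum is 0.\<close>
    have B: "B y (br z x) = B x (br y z)" "B z (br x y) = B x (br y z)"
      by (metis form_sym form_invariant)+
    have nested: "aff_br br B (aff_t k x) (aff_br br B (aff_t m y) (aff_t n z)) =
        aff_t (k + m + n) (br x (br y z)) + (if k + m + n = 0 then of_int k * B x (br y z) else 0) *\<^sub>C aff_c"
      for k m n x y z
      by (simp add: aff_br_t_t lin aff_br_c_right add.assoc)
    have perm: "m + n + k = k + m + n" "n + k + m = k + m + n" by simp_all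
    have c: "of_int k + of_int m + of_int n = (0 :: complex)" if "k + m + n = 0"
      using that by (simp flip: of_int_add)
    have "of_int k * b + of_int m * b + of_int n * b = (of_int k + of_int m + of_int n) * b" for b :: complex
      by (simp add: algebra_simps)
    then have "(if k + m + n = 0 then of_int k * B x (br y z) else 0) *\<^sub>C aff_c +
        (if k + m + n = 0 then of_int m * B x (br y z) else 0) *\<^sub>C aff_c +
        (if k + m + n = 0 then of_int n * B x (br y z) else 0) *\<^sub>C aff_c = (0 :: 'g aff)"
      using c by (simp flip: cscale_add_left)
    moreover have "aff_t (k + m + n) (br x (br y z)) + aff_t (k + m + n) (br y (br z x)) +
        aff_t (k + m + n) (br z (br x y)) = 0"
      by (simp only: sum3 jacobi aff_t_zero)
    moreover have regroup: "(p1 + q1) + (p2 + q2) + (p3 + q3) = (p1 + p2 + p3) + (q1 + q2 + q3)"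
      for p1 p2 p3 q1 q2 q3 :: "'g aff"
      by (simp add: ac_simps)
    ultimately show ?thesis
      unfolding nested perm B by (simp only: regroup add_0_left)
  qed
  have dtt: "aff_br br B aff_d (aff_br br B (aff_t m y) (aff_t n z)) +
      aff_br br B (aff_t m y) (aff_br br B (aff_t n z) aff_d) +
      aff_br br B (aff_t n z) (aff_br br B aff_d (aff_t m y)) = 0" for m n y z
  proof -
    have "br z y = - br y z" by (rule br_antisym)
    then show ?thesis
      by (simp add: aff_br_t_t aff_br_d_t aff_br_t_d lin aff_br_c_right br_scale_right br_scale_left
          form_scale_left form_scale_right aff_t_scale aff_t_minus aff_t_add add.commute form_sym[of z y] cscale_add_left
          algebra_simps)
  qed
  \<comment> \<open>\<open>J\<close> is invariant under rotation, so \<open>aff_c\<close>, or else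
    \<open>aff_d\<close>, can be rotated to the front: the remaining types are ttt, dtt, ddt and
    ddd.\<close>
  define J where "J x y z = aff_br br B x (aff_br br B y z) + aff_br br B y (aff_br br B z x) +
    aff_br br B z (aff_br br B x y)" for x y z
  have cyc: "J y z x = J x y z" for x y z
    by (simp add: J_def ac_simps)
  have Jc: "J aff_c y z = 0" for y z
    by (simp add: J_def aff_br_c_left aff_br_c_right lin)
  have Jt: "J (aff_t k x) (aff_t m y) (aff_t n z) = 0" for k m n x y z
    unfolding J_def by (rule ttt)
  have Jdt: "J aff_d (aff_t m y) (aff_t n z) = 0" for m n y z
    unfolding J_def by (rule dtt)
  have Jdd: "J aff_d aff_d (aff_t n z) = 0" for n z
    by (simp add: J_def aff_br_d_d aff_br_d_t aff_br_t_d lin)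
  have Jddd: "J aff_d aff_d aff_d = 0"
    by (simp add: J_def aff_br_d_d lin)
  show "aff_br br B x (aff_br br B y z) + aff_br br B y (aff_br br B z x) + aff_br br B z (aff_br br B x y) = 0"
    if "x \<in> aff_spanning" "y \<in> aff_spanning" "z \<in> aff_spanning" for x y z
  proof -
    have "J x y z = 0"
      using that Jc Jt Jdt Jdd Jddd cyc[of x y z] cyc[of y z x]
      unfolding aff_spanning_def by (elim UnE insertE emptyE CollectE exE conjE) metis+
    then show ?thesis by (simp add: J_def)
  qed
qed

end

section \<open>Polynomials acting on formal distributions\<close>

lemma clinear_pmult: "clinear (\<lambda>P. pmult P F n)"
  unfolding pmult_def by (rule clinear_keys_sum) (rule clinear_scale_vector)

lemma pmult_single: "pmult (Poly_Mapping.single e c) F n = c *\<^sub>C F (\<lambda>v. n v + int (Poly_Mapping.lookup e v))"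
  unfolding pmult_def
  by (rule keys_sum_single[of "\<lambda>e c. c *\<^sub>C F (\<lambda>v. n v + int (Poly_Mapping.lookup e v))"])
    (rule clinear_scale_vector)

lemma pmult_apply_linear: "clinear L \<Longrightarrow> pmult P (\<lambda>n. L (F n)) n = L (pmult P F n)"
  by (simp add: pmult_def clinear_sum[of L] clinear_scale[of L])

lemma pmult_sum_right: "pmult P (\<lambda>n. \<Sum>a\<in>A. F a n) n = (\<Sum>a\<in>A. pmult P (F a) n)"
  unfolding pmult_def cvs.scale_sum_right by (rule sum.swap)

lemma pmult_zero_right: "pmult P (\<lambda>n. 0) n = 0"
  by (simp add: pmult_def)

lemma pmult_add_left: "pmult (P + Q) F n = pmult P F n + pmult Q F n"
  by (rule clinear_add[OF clinear_pmult])

lemma pmult_zero_left: "pmult 0 F n = 0"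
  by (rule clinear_zero[OF clinear_pmult])

lemma pmult_sum_left: "pmult (\<Sum>a\<in>A. P a) F n = (\<Sum>a\<in>A. pmult (P a) F n)"
  by (rule clinear_sum[OF clinear_pmult])

text \<open>Formal distributions are a module over the polynomials: monomials act by composable
  shifts of the index, and both sides are additive in \<open>P\<close> and \<open>Q\<close>.\<close>

lemma pmult_mult: "pmult (P * Q) F n = pmult P (pmult Q F) n"
proof -
  have single: "pmult (Poly_Mapping.single e c * Poly_Mapping.single f d) F n =
      pmult (Poly_Mapping.single e c) (pmult (Poly_Mapping.single f d) F) n" for e f c d
    by (simp add: mult_single pmult_single[abs_def] pmult_single cscale_cscale lookup_add add.assoc
        del: single_add)
  have left: "pmult (P * Poly_Mapping.single f d) F n = pmult P (pmult (Poly_Mapping.single f d) F) n" for f d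
  proof -
    have "pmult ((\<Sum>e\<in>Poly_Mapping.keys P. Poly_Mapping.single e (Poly_Mapping.lookup P e)) * Poly_Mapping.single f d) F n =
      pmult (\<Sum>e\<in>Poly_Mapping.keys P. Poly_Mapping.single e (Poly_Mapping.lookup P e)) (pmult (Poly_Mapping.single f d) F) n"
      by (simp add: sum_distrib_right pmult_sum_left single)
    then show ?thesis by (simp add: poly_mapping_sum_single)
  qed
  have "pmult (P * (\<Sum>e\<in>Poly_Mapping.keys Q. Poly_Mapping.single e (Poly_Mapping.lookup Q e))) F n =
      pmult P (pmult (\<Sum>e\<in>Poly_Mapping.keys Q. Poly_Mapping.single e (Poly_Mapping.lookup Q e)) F) n"
    by (simp add: sum_distrib_left pmult_sum_left left pmult_sum_left[abs_def] pmult_sum_right)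
  then show ?thesis by (simp add: poly_mapping_sum_single)
qed

lemma pmult_var: "pmult (var b) F n = F (n(b := n b + 1))"
proof -
  have "(\<lambda>v. n v + int (Poly_Mapping.lookup (Poly_Mapping.single b 1) v)) = n(b := n b + 1)"
    by (auto simp: lookup_single)
  then show ?thesis by (simp add: var_def pmult_single cscale_one)
qed

lemma pmult_const: "pmult (const c) F n = c *\<^sub>C F n"
  by (simp add: const_def pmult_single)

lemma
  shows const_zero: "const 0 = 0"
    and const_one: "const 1 = 1"
    and const_add: "const (c + d) = const c + const d"
    and const_mult: "const (c * d) = const c * const d"
  by (simp_all add: const_def single_add mult_single)

lemma const_power: "const (c ^ m) = const c ^ m"
  by (induction m) (simp_all add: const_one const_mult)

lemma const_sum: "const (sum f A) = (\<Sum>a\<in>A. const (f a))"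
  by (induction A rule: infinite_finite_induct) (simp_all add: const_zero const_add)

text \<open>Congruence modulo the annihilator of \<open>F\<close>. It is compatible with the ring
  operations, which justifies substituting \<open>z_b = z w\<close> into any polynomial acting on a
  distribution supported on that line.\<close>

definition acts_like :: "((nat \<Rightarrow> int) \<Rightarrow> 'a::complex_vs) \<Rightarrow> cpoly \<Rightarrow> cpoly \<Rightarrow> bool"
  where "acts_like F P Q \<longleftrightarrow> pmult P F = pmult Q F"

lemma acts_like_refl: "acts_like F P P"
  by (simp add: acts_like_def)

lemma acts_like_add: "acts_like F P Q \<Longrightarrow> acts_like F P' Q' \<Longrightarrow> acts_like F (P + P') (Q + Q')"
  by (simp add: acts_like_def fun_eq_iff pmult_add_left)

lemma acts_like_diff: "acts_like F P Q \<Longrightarrow> acts_like F P' Q' \<Longrightarrow> acts_like F (P - P') (Q - Q')"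
  by (simp add: acts_like_def fun_eq_iff clinear_diff[OF clinear_pmult])

lemma acts_like_mult:
  assumes P: "acts_like F P Q" and P': "acts_like F P' Q'"
  shows "acts_like F (P * P') (Q * Q')"
proof -
  have mult: "pmult (R * S) F = pmult R (pmult S F)" for R S
    by (rule ext) (rule pmult_mult)
  have "pmult (P * P') F = pmult (P * Q') F"
    using P' by (simp only: mult acts_like_def)
  \<comment> \<open>Only a factor applied directly to \<open>F\<close> can be exchanged, so
    \<open>P\<close> is commuted to the inside.\<close>
  also have "\<dots> = pmult (Q' * P) F" by (simp only: mult.commute)
  also have "\<dots> = pmult (Q' * Q) F" using P by (simp only: mult acts_like_def)
  finally show ?thesis by (simp add: acts_like_def mult.commute)
qed

lemma acts_like_power: "acts_like F P Q \<Longrightarrow> acts_like F (P ^ m) (Q ^ m)"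
  by (induction m) (simp_all add: acts_like_refl acts_like_mult)

lemma acts_like_sum: "(\<And>a. a \<in> A \<Longrightarrow> acts_like F (P a) (Q a)) \<Longrightarrow> acts_like F (sum P A) (sum Q A)"
  by (induction A rule: infinite_finite_induct) (simp_all add: acts_like_refl acts_like_add)

lemma acts_like_zero_mult:
  assumes "acts_like F P 0" shows "acts_like F (P * Q) 0" "acts_like F (Q * P) 0"
  using acts_like_mult[OF assms acts_like_refl, of Q] acts_like_mult[OF acts_like_refl assms, of Q] by simp_all

lemma acts_like_zero_prod:
  assumes "finite A" "a \<in> A" "acts_like F (P a) 0"
  shows "acts_like F (prod P A) 0"
  using acts_like_zero_mult(1)[OF assms(3), of "prod P (A - {a})"] prod.remove[OF assms(1,2), of P] by simp

lemma acts_like_zeroD: "acts_like F P 0 \<Longrightarrow> pmult P F n = 0"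
  by (simp add: acts_like_def pmult_zero_left)

lemma acts_like_linear_factor:
  assumes "acts_like F (var b) (const z * var 0)"
  shows "acts_like F (var b - const z * var 0) 0"
  using acts_like_diff[OF assms acts_like_refl, of "const z * var 0"] by simp

text \<open>
  A distribution supported on the line \<open>z\<^sub>b = z w\<close>, \<open>z\<^sub>c = y w\<close> sees only the value of the homogeneous
  polynomial \<open>p\<^sub>i\<^sub>j\<close> at \<open>(z, y)\<close>.
\<close>

lemma acts_like_p_poly:
  fixes z y :: complex
  assumes b: "acts_like F (var b) (const z * var 0)" and c: "acts_like F (var c) (const y * var 0)"
    and d: "d = dd \<mu> i" and q: "q = card (Hgrp a \<mu> i j) div d" and s: "s = ss a \<mu> i - 1"
    and vanish: "(z ^ d + y ^ d) ^ s * (\<Sum>t<q. z ^ (d * t) * y ^ (d * (q - 1 - t))) = 0"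
  shows "acts_like F (p_poly a \<mu> i j (var b) (var c)) 0"
proof -
  let ?v = "var 0"
  have pz: "(const z * ?v) ^ e = const (z ^ e) * ?v ^ e" for z e
    by (simp add: power_mult_distrib const_power)
  have "acts_like F (p_poly a \<mu> i j (var b) (var c))
      (((const z * ?v) ^ d + (const y * ?v) ^ d) ^ s *
        (\<Sum>t<q. (const z * ?v) ^ (d * t) * (const y * ?v) ^ (d * (q - 1 - t))))"
    unfolding p_poly_def Let_def d[symmetric] q[symmetric] s[symmetric]
    by (intro acts_like_mult acts_like_add acts_like_power acts_like_sum b c)
  also have "((const z * ?v) ^ d + (const y * ?v) ^ d) ^ s = const ((z ^ d + y ^ d) ^ s) * ?v ^ (d * s)"
    by (simp add: pz const_power const_add distrib_right[symmetric] power_mult_distrib power_mult)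
  also have "(\<Sum>t<q. (const z * ?v) ^ (d * t) * (const y * ?v) ^ (d * (q - 1 - t))) =
      (\<Sum>t<q. const (z ^ (d * t) * y ^ (d * (q - 1 - t))) * ?v ^ (d * (q - 1)))"
  proof (rule sum.cong[OF refl])
    fix t assume "t \<in> {..<q}"
    \<comment> \<open>Since \<open>t < q\<close>, the truncated subtraction is exact and every
      summand has the same degree \<open>d * (q - 1)\<close>, so that the power of
      \<open>var 0\<close> can be factored out.\<close>
    then have "d * (q - 1) = d * t + d * (q - 1 - t)" by (auto simp flip: distrib_left)
    then show "(const z * ?v) ^ (d * t) * (const y * ?v) ^ (d * (q - 1 - t)) =
        const (z ^ (d * t) * y ^ (d * (q - 1 - t))) * ?v ^ (d * (q - 1))"
      by (simp only: pz const_mult power_add) (simp add: ac_simps)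
  qed
  also have "\<dots> = const (\<Sum>t<q. z ^ (d * t) * y ^ (d * (q - 1 - t))) * ?v ^ (d * (q - 1))"
    by (simp add: const_sum sum_distrib_right)
  also have "const ((z ^ d + y ^ d) ^ s) * ?v ^ (d * s) * \<dots> =
      const ((z ^ d + y ^ d) ^ s * (\<Sum>t<q. z ^ (d * t) * y ^ (d * (q - 1 - t)))) * ?v ^ (d * s + d * (q - 1))"
    by (simp add: const_mult power_add ac_simps)
  finally show ?thesis unfolding vanish const_zero by simp
qed

text \<open>\<open>F\<close> is a product of delta distributions on \<open>z_b = x^(k b) w\<close>:
  raising \<open>n b\<close> or \<open>n 0\<close> by one raises the total index in \<open>G\<close>
  equally, and only \<open>n b\<close> contributes the extra factor \<open>x^(k b)\<close>.\<close>

lemma acts_like_var: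
  fixes x :: complex and k :: "nat \<Rightarrow> int"
  assumes S: "finite S" "0 \<notin> S" "b \<in> S" and x: "x \<noteq> 0"
    and F: "\<And>n. F n = (\<Prod>b\<in>S. x powi (k b * n b)) *\<^sub>C G (n 0 + (\<Sum>b\<in>S. n b))"
  shows "acts_like F (var b) (const (x powi k b) * var 0)"
proof -
  have "pmult (var b) F n = pmult (const (x powi k b) * var 0) F n" for n
  proof -
    let ?n0 = "n(0 := n 0 + 1)" and ?nb = "n(b := n b + 1)"
    have b: "b \<noteq> 0" using S by metis
    have n0: "?n0 c = n c" if "c \<in> S" for c using that S(2) by (cases "c = 0") auto
    have sums: "(\<Sum>c\<in>S - {b}. ?nb c) = (\<Sum>c\<in>S - {b}. n c)" "(\<Sum>c\<in>S. ?n0 c) = (\<Sum>c\<in>S. n c)"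
      by (rule sum.cong; simp) (rule sum.cong[OF refl], erule n0)
    have prods: "(\<Prod>c\<in>S - {b}. x powi (k c * ?nb c)) = (\<Prod>c\<in>S - {b}. x powi (k c * n c))"
      "(\<Prod>c\<in>S. x powi (k c * ?n0 c)) = (\<Prod>c\<in>S. x powi (k c * n c))"
      by (rule prod.cong; simp) (rule prod.cong[OF refl], simp only: n0)
    have "(\<Prod>c\<in>S. x powi (k c * ?nb c)) = x powi k b * (\<Prod>c\<in>S. x powi (k c * n c))"
      using x unfolding prod.remove[OF S(1,3)] prods by (simp add: power_int_add distrib_left)
    moreover have "?nb 0 + (\<Sum>c\<in>S. ?nb c) = ?n0 0 + (\<Sum>c\<in>S. ?n0 c)"
      using b unfolding sums unfolding sum.remove[OF S(1,3), of ?nb] sum.remove[OF S(1,3), of n] sums by simp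
    ultimately show ?thesis
      by (simp only: pmult_mult pmult_var pmult_const pmult_var[abs_def] F prods cscale_cscale)
  qed
  then show ?thesis by (auto simp: acts_like_def)
qed

section \<open>Automorphisms of finite order\<close>

text \<open>The interval stands for the residues modulo \<open>N\<close>, on which
  \<open>k \<mapsto> c + s k\<close> is a bijection with inverse
  \<open>k \<mapsto> s (k - c)\<close> because \<open>s * s = 1\<close>.\<close>

lemma sum_periodic_reflect:
  fixes g :: "int \<Rightarrow> 'b::comm_monoid_add"
  assumes N: "0 < (N::int)" and per: "\<And>k. g (k mod N) = g k" and s: "s = 1 \<or> s = -1"
  shows "(\<Sum>k\<in>{0..<N}. g (c + s * k)) = (\<Sum>k\<in>{0..<N}. g k)"
proof (rule sum.reindex_bij_witness[where i = "\<lambda>k. (s * (k - c)) mod N" and j = "\<lambda>k. (c + s * k) mod N"])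
  fix k assume k: "k \<in> {0..<N}"
  have ss: "s * s = 1" using s by auto
  have "(s * ((c + s * k) mod N - c)) mod N = (s * ((c + s * k) - c)) mod N"
    by (metis mod_diff_left_eq mod_mult_right_eq)
  also have "s * ((c + s * k) - c) = k" using s by auto
  finally show "(s * ((c + s * k) mod N - c)) mod N = k" using k by simp
  have "(c + s * ((s * (k - c)) mod N)) mod N = (c + s * (s * (k - c))) mod N"
    by (metis mod_add_right_eq mod_mult_right_eq)
  also have "c + s * (s * (k - c)) = k" using s by auto
  finally show "(c + s * ((s * (k - c)) mod N)) mod N = k" using k by simp
  show "(c + s * k) mod N \<in> {0..<N}" "(s * (k - c)) mod N \<in> {0..<N}" using N by auto
  show "g ((c + s * k) mod N) = g (c + s * k)" by (rule per)
qed

text \<open>Integer powers of a map whose \<open>N\<close>-th power is the identity. Reducing the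
  exponent makes negative powers available without an inverse function, and periodicity in
  \<open>k\<close> immediate.\<close>

definition ipow :: "nat \<Rightarrow> ('a \<Rightarrow> 'a) \<Rightarrow> int \<Rightarrow> 'a \<Rightarrow> 'a"
  where "ipow N f k = f ^^ nat (k mod int N)"

lemma ipow_mod: "ipow N f (k mod int N) = ipow N f k"
  by (simp add: ipow_def)

lemma ipow_0: "ipow N f 0 x = x"
  by (simp add: ipow_def)

lemma pw_eq_ipow: "0 \<le> k \<Longrightarrow> k < int N \<Longrightarrow> pw f k = ipow N f k"
  by (simp add: pw_def ipow_def)

lemma ipow_add:
  assumes "f ^^ N = id" "0 < N"
  shows "ipow N f (k + l) x = ipow N f k (ipow N f l x)"
proof -
  have "nat ((k + l) mod int N) = (nat (k mod int N) + nat (l mod int N)) mod N"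
    using assms(2) by (simp add: nat_mod_distrib flip: nat_add_distrib) (metis mod_add_eq nat_int nat_mod_distrib of_nat_0_le_iff pos_mod_sign of_nat_0_less_iff add_nonneg_nonneg)
  then have "ipow N f (k + l) x = (f ^^ ((nat (k mod int N) + nat (l mod int N)) mod N)) x"
    by (simp add: ipow_def)
  also have "\<dots> = (f ^^ (nat (k mod int N) + nat (l mod int N))) x"
    by (rule funpow_mod_eq) (simp add: assms)
  finally show ?thesis by (simp add: ipow_def funpow_add)
qed

lemma ipow_1:
  assumes "f ^^ N = id" "0 < N"
  shows "ipow N f 1 x = f x"
proof -
  have "ipow N f 1 x = (f ^^ (1 mod N)) x" using assms(2) by (simp add: ipow_def nat_mod_distrib)
  also have "\<dots> = (f ^^ 1) x" by (rule funpow_mod_eq) (simp add: assms)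
  finally show ?thesis by simp
qed

lemma xi_power_eq_1_iff:
  assumes "0 < perm_order \<mu>"
  shows "xi \<mu> powi k = 1 \<longleftrightarrow> int (perm_order \<mu>) dvd k"
proof -
  let ?N = "perm_order \<mu>"
  have "xi \<mu> powi k = exp (of_int k * (2 * of_real pi * \<i> / of_nat ?N))"
    by (simp add: xi_def exp_power_int)
  also have "of_int k * (2 * of_real pi * \<i> / of_nat ?N) = of_real (2 * pi * (of_int k / of_nat ?N)) * \<i>"
    by (simp add: field_simps)
  finally have "xi \<mu> powi k = exp (of_real (2 * pi * (of_int k / of_nat ?N)) * \<i>)" .
  then have "xi \<mu> powi k = 1 \<longleftrightarrow> (\<exists>n::int. 2 * pi * (of_int k / of_nat ?N) = of_int (2 * n) * pi)"
    by (simp add: exp_eq_1)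
  also have "\<dots> \<longleftrightarrow> (\<exists>n::int. (of_int k :: real) = of_int (n * int ?N))"
    using assms by (simp add: field_simps)
  also have "\<dots> \<longleftrightarrow> int ?N dvd k"
    unfolding of_int_eq_iff by (auto simp: dvd_def mult.commute)
  finally show ?thesis .
qed

lemma xi_nonzero: "xi \<mu> \<noteq> 0"
  by (simp add: xi_def)

lemma xi_powi_add: "xi \<mu> powi (k + l) = xi \<mu> powi k * xi \<mu> powi l"
  by (simp add: power_int_add xi_nonzero)

lemma xi_powi_cong:
  assumes "0 < perm_order \<mu>" "k mod int (perm_order \<mu>) = l mod int (perm_order \<mu>)"
  shows "xi \<mu> powi k = xi \<mu> powi l"
proof -
  have "xi \<mu> powi (k - l) = 1"
    using assms by (simp add: xi_power_eq_1_iff mod_eq_dvd_iff)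
  then show ?thesis using xi_powi_add[of \<mu> "k - l" l] by simp
qed

text \<open>Shifting \<open>b\<close> by one multiplies the sum by \<open>\<xi>^(-k)\<close>, which
  differs from 1 for \<open>k \<noteq> 0\<close>; so the sum is then 0.\<close>

lemma xi_orthogonality:
  assumes N: "0 < perm_order \<mu>" and k: "k \<in> residues_of \<mu>"
  shows "(\<Sum>b\<in>residues_of \<mu>. xi \<mu> powi (- (k * b))) = (if k = 0 then of_nat (perm_order \<mu>) else 0)"
proof (cases "k = 0")
  case False
  let ?N = "int (perm_order \<mu>)" and ?S = "\<Sum>b\<in>residues_of \<mu>. xi \<mu> powi (- (k * b))"
  have "?S = (\<Sum>b\<in>{0..<?N}. xi \<mu> powi (- (k * (1 + 1 * b))))"
    unfolding residues_of_def
    by (rule sum_periodic_reflect[symmetric, of ?N "\<lambda>b. xi \<mu> powi (- (k * b))"])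
      (use N in \<open>auto intro!: xi_powi_cong simp: mod_minus_eq mod_mult_right_eq intro: mod_minus_cong\<close>)
  also have "\<dots> = xi \<mu> powi (- k) * ?S"
    by (simp add: residues_of_def sum_distrib_left distrib_left flip: xi_powi_add)
  finally have "?S * (xi \<mu> powi (- k) - 1) = 0" by (simp add: algebra_simps)
  moreover have "\<not> ?N dvd - k" using k False by (auto simp: residues_of_def dest: zdvd_imp_le)
  ultimately show ?thesis using False xi_power_eq_1_iff[OF N, of "- k"] by simp
qed (simp add: residues_of_def)

lemma sum_PiE_insert:
  assumes "b \<notin> S"
  shows "sum F (PiE (insert b S) T) = (\<Sum>l\<in>T b. \<Sum>k\<in>PiE S T. F (k(b := l)))"
proof -
  have "sum F (PiE (insert b S) T) = (\<Sum>p\<in>T b \<times> PiE S T. F ((\<lambda>(l, k). k(b := l)) p))"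
    unfolding PiE_insert_eq using inj_combinator[OF assms, of T] by (simp add: sum.reindex)
  also have "\<dots> = (\<Sum>(l, k)\<in>T b \<times> PiE S T. F (k(b := l)))"
    by (simp add: case_prod_unfold)
  finally show ?thesis by (simp add: sum.cartesian_product)
qed

locale finite_order_automorphism = quadratic_lie_algebra br B
  for br :: "'g::complex_vs \<Rightarrow> 'g \<Rightarrow> 'g" and B +
  fixes \<mu> :: "'i \<Rightarrow> 'i" and mg :: "'g \<Rightarrow> 'g"
  assumes mg_hom: "lie_hom br br mg"
    and mg_order: "mg ^^ perm_order \<mu> = id"
    and order_pos: "0 < perm_order \<mu>"
begin

abbreviation "N \<equiv> perm_order \<mu>"
abbreviation "\<xi> \<equiv> xi \<mu>"
abbreviation "E \<equiv> ipow N mg"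
abbreviation "twm \<equiv> tw \<mu> mg"

lemma clinear_mg: "clinear mg"
  using mg_hom by (simp add: lie_hom_def)

lemma clinear_E: "clinear (E k)"
  unfolding ipow_def by (rule clinear_funpow[OF clinear_mg])

lemma mg_br: "mg (br x y) = br (mg x) (mg y)"
  using mg_hom by (simp add: lie_hom_def)

lemma E_br: "E k (br x y) = br (E k x) (E k y)"
proof -
  have "(mg ^^ n) (br x y) = br ((mg ^^ n) x) ((mg ^^ n) y)" for n
    by (induction n) (simp_all add: mg_br)
  then show ?thesis by (simp add: ipow_def)
qed

lemma E_add: "E (k + l) x = E k (E l x)"
  by (rule ipow_add[OF mg_order order_pos])

lemma tw_eq: "twm m x = (\<Sum>p\<in>residues_of \<mu>. (\<xi> powi (- m * p)) *\<^sub>C E p x)"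
  unfolding tw_def by (rule sum.cong) (simp_all add: residues_of_def pw_eq_ipow[of _ N])

lemma clinear_tw: "clinear (twm m)"
  unfolding tw_eq[abs_def] by (intro clinear_sum_fun clinear_cscale_comp clinear_E)

lemmas tw_add = clinear_add[OF clinear_tw]
  and tw_scale = clinear_scale[OF clinear_tw]
  and tw_zero = clinear_zero[OF clinear_tw]

lemma sum_residues_reflect:
  fixes g :: "int \<Rightarrow> 'b::comm_monoid_add"
  assumes "\<And>k. g (k mod int N) = g k" "s = 1 \<or> s = -1"
  shows "(\<Sum>k\<in>residues_of \<mu>. g (c + s * k)) = (\<Sum>k\<in>residues_of \<mu>. g k)"
  unfolding residues_of_def using assms order_pos by (intro sum_periodic_reflect) auto

lemma powi_mod: "\<xi> powi (c * (k mod int N)) = \<xi> powi (c * k)"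
  by (rule xi_powi_cong[OF order_pos]) (simp add: mod_mult_right_eq)

lemma tw_E: "twm m (E k x) = (\<xi> powi (m * k)) *\<^sub>C twm m x"
proof -
  have "twm m (E k x) = (\<Sum>p\<in>residues_of \<mu>. (\<xi> powi (m * k)) *\<^sub>C (\<xi> powi (- m * (k + 1 * p))) *\<^sub>C E (k + 1 * p) x)"
    unfolding tw_eq
    by (rule sum.cong[OF refl])
      (simp add: cscale_cscale add.commute[of k] E_add algebra_simps flip: xi_powi_add)
  also have "\<dots> = (\<Sum>p\<in>residues_of \<mu>. (\<xi> powi (m * k)) *\<^sub>C (\<xi> powi (- m * p)) *\<^sub>C E p x)"
    by (rule sum_residues_reflect[of "\<lambda>p. (\<xi> powi (m * k)) *\<^sub>C (\<xi> powi (- m * p)) *\<^sub>C E p x"])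
      (simp_all only: powi_mod ipow_mod, simp)
  finally show ?thesis by (simp add: tw_eq cvs.scale_sum_right)
qed

lemma tw_mg: "twm m (mg x) = (\<xi> powi m) *\<^sub>C twm m x"
  using tw_E[of m 1 x] by (simp add: ipow_1[OF mg_order order_pos])

lemma mg_tw: "mg (twm m x) = (\<xi> powi m) *\<^sub>C twm m x"
proof -
  have "mg (E p x) = E p (mg x)" for p
    using E_add[of 1 p x] E_add[of p 1 x] by (simp add: ipow_1[OF mg_order order_pos] add.commute)
  then have "mg (twm m x) = twm m (mg x)"
    by (simp add: tw_eq clinear_sum[OF clinear_mg] clinear_scale[OF clinear_mg])
  then show ?thesis by (simp add: tw_mg)
qed

text \<open>All \<open>N\<close> summands agree on the eigenspace. Together with
  \<open>mg_tw\<close> this says that \<open>(1/N) twm m\<close> is the projection onto the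
  eigenspace for \<open>\<xi>^m\<close>.\<close>

lemma tw_eigenvector:
  assumes "mg x = (\<xi> powi m) *\<^sub>C x"
  shows "twm m x = of_nat N *\<^sub>C x"
proof -
  have "(mg ^^ n) x = (\<xi> powi (m * int n)) *\<^sub>C x" for n
    by (induction n)
      (simp_all add: cscale_one assms clinear_scale[OF clinear_mg] cscale_cscale distrib_left add.commute flip: xi_powi_add)
  then have "E p x = (\<xi> powi (m * p)) *\<^sub>C x" if "p \<in> residues_of \<mu>" for p
    using that by (simp add: ipow_def residues_of_def)
  then have "twm m x = (\<Sum>p\<in>residues_of \<mu>. x)"
    unfolding tw_eq by (intro sum.cong) (auto simp: cscale_cscale cscale_one simp flip: xi_powi_add)
  also have "\<dots> = (\<Sum>p\<in>residues_of \<mu>. 1 *\<^sub>C x)" by (simp add: cscale_one)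
  also have "\<dots> = of_nat N *\<^sub>C x"
    unfolding cvs.scale_sum_left[symmetric] by (simp add: residues_of_def)
  finally show ?thesis .
qed

text \<open>For fixed \<open>q\<close> the substitution \<open>p = q - k\<close> collects the double
  sum by the difference \<open>k\<close>. The map is an arbitrary bilinear one because both the
  bracket and the form are needed.\<close>

lemma bilinear_tw:
  fixes \<beta> :: "'g \<Rightarrow> 'g \<Rightarrow> 'v::complex_vs"
  assumes left: "\<And>y. clinear (\<lambda>x. \<beta> x y)" and right: "\<And>x. clinear (\<beta> x)"
  shows "\<beta> (twm m x) (twm n y) = (\<Sum>k\<in>residues_of \<mu>. (\<xi> powi (k * m)) *\<^sub>C
    (\<Sum>q\<in>residues_of \<mu>. (\<xi> powi (- (m + n) * q)) *\<^sub>C \<beta> (E q (E (- k) x)) (E q y)))"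
proof -
  have "\<beta> (twm m x) (twm n y) =
      (\<Sum>q\<in>residues_of \<mu>. (\<xi> powi (- n * q)) *\<^sub>C (\<Sum>p\<in>residues_of \<mu>. (\<xi> powi (- m * p)) *\<^sub>C \<beta> (E p x) (E q y)))"
    unfolding tw_eq clinear_sum[OF right] clinear_scale[OF right] clinear_sum[OF left] clinear_scale[OF left] ..
  also have "\<dots> = (\<Sum>q\<in>residues_of \<mu>. (\<xi> powi (- n * q)) *\<^sub>C
      (\<Sum>k\<in>residues_of \<mu>. (\<xi> powi (- m * (q + (-1) * k))) *\<^sub>C \<beta> (E (q + (-1) * k) x) (E q y)))"
    by (intro sum.cong[OF refl] arg_cong2[where f = cscale] refl
        sum_residues_reflect[symmetric, of "\<lambda>p. (\<xi> powi (- m * p)) *\<^sub>C \<beta> (E p x) (E _ y)"])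
      (simp_all only: powi_mod ipow_mod, simp)
  also have "\<dots> = (\<Sum>q\<in>residues_of \<mu>. \<Sum>k\<in>residues_of \<mu>. (\<xi> powi (k * m)) *\<^sub>C
      (\<xi> powi (- (m + n) * q)) *\<^sub>C \<beta> (E q (E (- k) x)) (E q y))"
    by (intro sum.cong[OF refl])
      (simp add: cvs.scale_sum_right cscale_cscale algebra_simps flip: xi_powi_add E_add)
  also have "\<dots> = (\<Sum>k\<in>residues_of \<mu>. (\<xi> powi (k * m)) *\<^sub>C
    (\<Sum>q\<in>residues_of \<mu>. (\<xi> powi (- (m + n) * q)) *\<^sub>C \<beta> (E q (E (- k) x)) (E q y)))"
    by (subst sum.swap) (simp only: cvs.scale_sum_right)
  finally show ?thesis .
qed

lemma br_tw: "br (twm m x) (twm n y) = (\<Sum>k\<in>residues_of \<mu>. (\<xi> powi (k * m)) *\<^sub>C twm (m + n) (br (E (- k) x) y))"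
  unfolding bilinear_tw[of br, OF linear_left linear_right] unfolding tw_eq E_br ..

text \<open>Invariance of the form under \<open>mg\<close> is asked only for translates of the two
  given vectors, where it can be read off from explicit values on generators. For
  \<open>m + n = 0\<close> the sum over \<open>q\<close> then consists of \<open>N\<close> equal
  terms.\<close>

lemma form_tw:
  assumes inv: "\<And>p q. B (E q (E p x)) (E q y) = B (E p x) y" and mn: "m + n = 0"
  shows "B (twm m x) (twm n y) = of_nat N * (\<Sum>k\<in>residues_of \<mu>. \<xi> powi (k * m) * B (E (- k) x) y)"
proof -
  have "card (residues_of \<mu>) = N" by (simp add: residues_of_def)
  then show ?thesis
    unfolding bilinear_tw[of B, OF form_left form_right] inv mn
    by (simp add: cscale_complex_def sum_distrib_left algebra_simps)
qed

text \<open>Fourier inversion on the residues: summing over all splittings of the degree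
  \<open>m\<close> isolates the term \<open>k = 0\<close> of \<open>br_tw\<close>.\<close>

lemma tw_br_from_brackets:
  "(\<Sum>b\<in>residues_of \<mu>. br (twm (m - b) x) (twm b y)) = of_nat N *\<^sub>C twm m (br x y)"
proof -
  have "(\<Sum>b\<in>residues_of \<mu>. br (twm (m - b) x) (twm b y)) =
      (\<Sum>k\<in>residues_of \<mu>. (\<Sum>b\<in>residues_of \<mu>. \<xi> powi (k * m) * \<xi> powi (- (k * b))) *\<^sub>C twm m (br (E (- k) x) y))"
    unfolding br_tw cvs.scale_sum_left
    by (subst sum.swap) (simp add: algebra_simps flip: xi_powi_add)
  also have "\<dots> = (\<Sum>k\<in>residues_of \<mu>. (if k = 0 then of_nat N else 0) *\<^sub>C twm m (br (E (- k) x) y))"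
    by (intro sum.cong refl) (simp add: xi_orthogonality[OF order_pos] flip: sum_distrib_left)
  also have "\<dots> = (\<Sum>k\<in>residues_of \<mu>. if k = 0 then of_nat N *\<^sub>C twm m (br x y) else 0)"
    by (intro sum.cong refl) (simp add: ipow_0)
  finally show ?thesis using order_pos by (simp add: residues_of_def)
qed

text \<open>The phase in \<open>br_tw\<close> involves the degree of the left factor only. Iterating
  it therefore gives each letter its own \<open>k b\<close> with phase
  \<open>\<xi>^(k b * n b)\<close>, independent of the other degrees.\<close>

lemma nested_br_tw:
  assumes "distinct bs"
  shows "foldr (\<lambda>b. br (twm (n b) x)) bs (twm n0 y) =
    (\<Sum>k\<in>PiE (set bs) (\<lambda>_. residues_of \<mu>). (\<Prod>b\<in>set bs. \<xi> powi (k b * n b)) *\<^sub>C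
      twm (n0 + (\<Sum>b\<in>set bs. n b)) (foldr (\<lambda>b. br (E (- k b) x)) bs y))"
  using assms
proof (induction bs)
  case Nil
  show ?case by (simp add: cscale_one)
next
  case (Cons b bs)
  then have b: "b \<notin> set bs" and dist: "distinct bs" by auto
  let ?M = "n0 + (\<Sum>b\<in>set bs. n b)" and ?P = "PiE (set bs) (\<lambda>_. residues_of \<mu>)"
  let ?c = "\<lambda>k. \<Prod>b\<in>set bs. \<xi> powi (k b * n b)" and ?w = "\<lambda>k. foldr (\<lambda>b. br (E (- k b) x)) bs y"
  have upd: "?w (k(b := l)) = ?w k" "?c (k(b := l)) = ?c k" for k l
    using b by (auto intro!: foldr_cong prod.cong)
  have "foldr (\<lambda>b. br (twm (n b) x)) (b # bs) (twm n0 y) =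
      (\<Sum>k\<in>?P. ?c k *\<^sub>C (\<Sum>l\<in>residues_of \<mu>. (\<xi> powi (l * n b)) *\<^sub>C twm (n b + ?M) (br (E (- l) x) (?w k))))"
    by (simp add: Cons.IH[OF dist] br_sum_right br_scale_right br_tw)
  also have "\<dots> = (\<Sum>l\<in>residues_of \<mu>. \<Sum>k\<in>?P. (\<xi> powi (l * n b) * ?c k) *\<^sub>C twm (n b + ?M) (br (E (- l) x) (?w k)))"
    by (subst sum.swap) (simp add: cvs.scale_sum_right cscale_cscale mult.commute)
  also have "\<dots> = (\<Sum>k\<in>PiE (set (b # bs)) (\<lambda>_. residues_of \<mu>). (\<Prod>b\<in>set (b # bs). \<xi> powi (k b * n b)) *\<^sub>C
      twm (n0 + (\<Sum>b\<in>set (b # bs). n b)) (foldr (\<lambda>b. br (E (- k b) x)) (b # bs) y))"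
    unfolding list.set(2) sum_PiE_insert[OF b]
    by (intro sum.cong refl) (use b in \<open>simp add: upd fun_upd_same add.left_commute del: fun_upd_apply\<close>)
  finally show ?case .
qed

end

section \<open>Realizations\<close>

text \<open>Elimination, one functional at a time: independence yields a vector that the functionals
  in \<open>I\<close> do not see but \<open>f j\<close> does; scaled, it becomes the new dual vector
  and corrects the old ones.\<close>

lemma dual_vectors:
  fixes f :: "'i \<Rightarrow> 'h::complex_vs \<Rightarrow> complex"
  assumes "finite I" and lin: "\<And>i. clinear (f i)"
    and indep: "\<And>c. (\<And>h. (\<Sum>i\<in>I. c i * f i h) = 0) \<Longrightarrow> \<forall>i\<in>I. c i = 0"
  shows "\<exists>d. \<forall>i\<in>I. \<forall>j\<in>I. f i (d j) = (if i = j then 1 else 0)"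
  using assms(1) indep
proof (induction I)
  case empty
  show ?case by simp
next
  case (insert j I)
  have "\<forall>i\<in>I. c i = 0" if "\<And>h. (\<Sum>i\<in>I. c i * f i h) = 0" for c
  proof -
    have "(\<Sum>i\<in>insert j I. (c(j := 0)) i * f i h) = (\<Sum>i\<in>I. c i * f i h)" for h
      using insert.hyps by (auto intro!: sum.cong)
    then have "\<forall>i\<in>insert j I. (c(j := 0)) i = 0" using that by (intro insert.prems) simp
    then show ?thesis using insert.hyps(2) by (metis fun_upd_other insertI2)
  qed
  with insert.IH obtain d where d: "\<And>i k. i \<in> I \<Longrightarrow> k \<in> I \<Longrightarrow> f i (d k) = (if i = k then 1 else 0)"
    by blast
  \<comment> \<open>If there were none, \<open>f j\<close> would be the combination of the others
    with coefficients \<open>f j (d i)\<close>, against independence.\<close>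
  obtain h where h: "f j h \<noteq> (\<Sum>i\<in>I. f j (d i) * f i h)"
  proof (rule ccontr)
    assume "\<not> thesis"
    then have eq: "f j h = (\<Sum>i\<in>I. f j (d i) * f i h)" for h using that by blast
    let ?c = "(\<lambda>i. f j (d i))(j := -1)"
    have "(\<Sum>i\<in>I. ?c i * f i h) = (\<Sum>i\<in>I. f j (d i) * f i h)" for h
      using insert.hyps by (intro sum.cong) auto
    then have "(\<Sum>i\<in>insert j I. ?c i * f i h) = 0" for h
      using insert.hyps eq[of h] by simp
    from insert.prems[OF this] show False by auto
  qed
  define h' where "h' = h - (\<Sum>i\<in>I. f i h *\<^sub>C d i)"
  have f_h': "f k h' = f k h - (\<Sum>i\<in>I. f i h * f k (d i))" for k
    by (simp add: h'_def clinear_diff[OF lin] clinear_sum[OF lin] clinear_scale[OF lin] cscale_complex_def)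
  have zero: "f k h' = 0" if "k \<in> I" for k
  proof -
    have "(\<Sum>i\<in>I. f i h * f k (d i)) = (\<Sum>i\<in>I. if k = i then f i h else 0)"
      using that d by (intro sum.cong) auto
    then show ?thesis using that insert.hyps by (simp add: f_h')
  qed
  have nonzero: "f j h' \<noteq> 0" using h by (simp add: f_h' mult.commute)
  define e where "e = (1 / f j h') *\<^sub>C h'"
  have e: "f j e = 1" "\<And>k. k \<in> I \<Longrightarrow> f k e = 0"
    using nonzero zero by (simp_all add: e_def clinear_scale[OF lin] cscale_complex_def)
  define d' where "d' i = (if i = j then e else d i - f j (d i) *\<^sub>C e)" for i
  have "f i (d' k) = (if i = k then 1 else 0)" if "i \<in> insert j I" "k \<in> insert j I" for i k
    using that insert.hyps(2) d e
    by (auto simp: d'_def clinear_diff[OF lin] clinear_scale[OF lin] cscale_complex_def)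
  then show ?case by blast
qed

lemma realization_dual_vectors:
  fixes a :: "'i::finite \<Rightarrow> 'i \<Rightarrow> int" and \<alpha> :: "'i \<Rightarrow> 'h::complex_vs \<Rightarrow> complex"
  assumes "realization a \<alpha> av"
  shows "\<exists>d. \<forall>i j. \<alpha> i (d j) = (if i = j then 1 else 0)"
  using dual_vectors[of UNIV \<alpha>] assms by (auto simp: realization_def)

lemma independent_Un_direct:
  assumes A: "cvs.independent A" and B: "cvs.independent B"
    and direct: "cvs.span A \<inter> cvs.span B \<subseteq> {0}"
  shows "cvs.independent (A \<union> B)"
proof
  assume "cvs.dependent (A \<union> B)"
  then obtain S u v where S: "finite S" "S \<subseteq> A \<union> B" "(\<Sum>v\<in>S. u v *\<^sub>C v) = 0" "v \<in> S" "u v \<noteq> 0"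
    unfolding cvs.dependent_explicit by blast
  let ?x = "\<Sum>v\<in>S \<inter> A. u v *\<^sub>C v" and ?y = "\<Sum>v\<in>S - A. u v *\<^sub>C v"
  have sum: "?x + ?y = 0" using sum.Int_Diff[OF S(1), of "\<lambda>v. u v *\<^sub>C v" A] S(3) by simp
  have "?x \<in> cvs.span A" by (intro cvs.span_sum cvs.span_scale cvs.span_base) auto
  moreover have y: "?y \<in> cvs.span B" using S(2) by (intro cvs.span_sum cvs.span_scale cvs.span_base) auto
  moreover have "?x = - ?y" using sum by (simp add: eq_neg_iff_add_eq_0)
  ultimately have "?x = 0" using cvs.span_neg[OF y] direct by auto
  moreover from this sum have "?y = 0" by simp
  ultimately have "\<forall>v\<in>S \<inter> A. u v = 0" "\<forall>v\<in>S - A. u v = 0"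
    using S(1,2) cvs.independentD[OF A, of "S \<inter> A" u] cvs.independentD[OF B, of "S - A" u] by blast+
  then show False using S(4,5) by blast
qed

text \<open>
  The map \<open>h \<mapsto> (\<alpha>\<^sub>i h)\<^sub>i\<close> is onto and maps the coroots to the rows of \<open>A\<close>, so the images of a basis of the
  complement \<open>W\<close>, which has dimension \<open>|I| - rank A\<close>, have to be linearly independent.
\<close>

lemma complement_inter_center:
  fixes a :: "'i::finite \<Rightarrow> 'i \<Rightarrow> int" and \<alpha> :: "'i \<Rightarrow> 'h::complex_vs \<Rightarrow> complex"
  assumes real: "realization a \<alpha> av" and comp: "stable_complement a \<alpha> av W"
    and w: "w \<in> W" "\<And>i. \<alpha> i w = 0"
  shows "w = 0"
proof -
  let ?A = "(\<chi> i j. of_int (a i j)) :: complex^'i^'i"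
  have dim: "cvs.dim (UNIV :: 'h set) = 2 * CARD('i) - rank ?A"
    and lin: "clinear (\<alpha> i)" for i using real by (auto simp: realization_def)
  have indep: "(\<Sum>i\<in>UNIV. c i *\<^sub>C av i) = 0 \<Longrightarrow> c i = 0" and pair: "\<alpha> j (av i) = of_int (a i j)" for c i j
    using real by (auto simp: realization_def)
  have W: "cvs.subspace W" "W \<inter> cvs.span (range av) = {0}"
    "\<And>x. \<exists>y\<in>cvs.span (range av). \<exists>w\<in>W. x = y + w"
    using comp by (auto simp: stable_complement_def)
  define T where "T h = ((\<chi> i. \<alpha> i h) :: complex^'i)" for h
  interpret T: Vector_Spaces.linear cscale "(*s)" T
    by unfold_locales (auto simp: T_def vec_eq_iff clinear_add[OF lin] clinear_scale[OF lin] cscale_complex_def)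
  have surj: "surj T"
  proof -
    obtain d where d: "\<And>i j. \<alpha> i (d j) = (if i = j then 1 else 0)"
      using realization_dual_vectors[OF real] by blast
    have "T (\<Sum>j\<in>UNIV. v $ j *\<^sub>C d j) = v" for v
      by (simp add: T_def vec_eq_iff clinear_sum[OF lin] clinear_scale[OF lin] d cscale_complex_def
          if_distrib[of "(*) _"] cong: if_cong)
    then show ?thesis by (metis surj_def)
  qed
  have inj_av: "inj av"
  proof (rule injI, rule ccontr)
    fix i j assume eq: "av i = av j" "i \<noteq> j"
    have "(\<Sum>k\<in>UNIV. (if k = i then 1 else if k = j then -1 else 0) *\<^sub>C av k) =
        (\<Sum>k\<in>UNIV. if k = i then av i else 0) + (\<Sum>k\<in>UNIV. if k = j then - av j else 0)"
      unfolding sum.distrib[symmetric] using eq(2) by (intro sum.cong) (auto simp: cscale_one)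
    also have "\<dots> = 0" using eq(1) by simp
    finally show False using indep[of "\<lambda>k. if k = i then 1 else if k = j then -1 else 0" i] by auto
  qed
  have indep_av: "cvs.independent (range av)"
  proof (rule cvs.independent_if_scalars_zero)
    fix f x assume "(\<Sum>x\<in>range av. f x *\<^sub>C x) = 0" "x \<in> range av"
    then show "f x = 0" using indep[of "\<lambda>i. f (av i)"] by (auto simp: sum.reindex[OF inj_av])
  qed simp
  obtain Bw where Bw: "Bw \<subseteq> W" "cvs.independent Bw" "W \<subseteq> cvs.span Bw"
    using cvs.maximal_independent_subset[of W] by blast
  have span_Bw: "cvs.span Bw = W"
    using Bw W(1) by (simp add: cvs.span_subspace)
  have disj: "range av \<inter> Bw = {}"
  proof -
    have "x = 0" if "x \<in> range av \<inter> Bw" for x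
      using that W(2) Bw(1) cvs.span_superset[of "range av"] by auto
    moreover have "0 \<notin> Bw" using Bw(2) cvs.dependent_zero by blast
    ultimately show ?thesis by fastforce
  qed
  have indep_un: "cvs.independent (range av \<union> Bw)"
    using W(2) span_Bw by (intro independent_Un_direct) (auto simp: indep_av Bw)
  have "cvs.span (range av \<union> Bw) = UNIV"
    unfolding cvs.span_Un span_Bw using W(3) by blast
  then have card: "card (range av \<union> Bw) = 2 * CARD('i) - rank ?A"
    using cvs.dim_eq_card[OF _ indep_un, of UNIV] dim by simp
  have rows: "rows ?A = range (\<lambda>i. row i ?A)" by (auto simp: rows_def)
  have rank_le: "rank ?A \<le> CARD('i)"
  proof -
    have "vec.dim (rows ?A) \<le> card (rows ?A)"
      by (rule vec.dim_le_card) (auto intro: vec.span_base simp: rows)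
    then show ?thesis
      unfolding row_rank_def_gen rows using card_image_le[of UNIV "\<lambda>i. row i ?A"] by simp
  qed
  \<comment> \<open>The cardinality of an infinite set is 0, so a positive dimension is what makes
    the basis finite.\<close>
  then have "0 < card (range av \<union> Bw)" unfolding card using zero_less_card_finite[where 'a='i] by linarith
  then have "finite (range av \<union> Bw)" by (rule card_ge_0_finite)
  then have fin: "finite Bw" by simp
  then have card_Bw: "card Bw = CARD('i) - rank ?A"
    using card disj inj_av by (simp add: card_Un_disjoint card_image)
  obtain R where R: "R \<subseteq> rows ?A" "vec.independent R" "rows ?A \<subseteq> vec.span R" "card R = rank ?A"
    using vec.basis_exists[of "rows ?A"] unfolding row_rank_def_gen by blast
  have finR: "finite R" using R(1) by (rule finite_subset) (simp add: rows)
  have T_av: "T (av i) = row i ?A" for i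
    by (simp add: T_def row_def vec_eq_iff pair)
  have span_RT: "UNIV \<subseteq> vec.span (R \<union> T ` Bw)"
  proof
    fix v :: "complex^'i"
    obtain y w where "v = T (y + w)" "y \<in> cvs.span (range av)" "w \<in> W" using surj W(3) by (metis surj_def)
    moreover have "T y \<in> vec.span R"
    proof -
      have "T y \<in> T ` cvs.span (range av)" using \<open>y \<in> _\<close> by blast
      also have "\<dots> = vec.span (T ` range av)" by (rule T.span_image[symmetric])
      also have "\<dots> \<subseteq> vec.span R"
        using R(3) by (intro vec.span_minimal) (auto simp: T_av rows_def)
      finally show ?thesis .
    qed
    moreover have "T w \<in> vec.span (T ` Bw)" using \<open>w \<in> W\<close> by (simp add: T.span_image span_Bw)
    ultimately show "v \<in> vec.span (R \<union> T ` Bw)" by (auto simp: T.add vec.span_Un)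
  qed
  have "CARD('i) = vec.dim (UNIV :: (complex^'i) set)" by (simp only: vec_dim_card)
  also have "\<dots> \<le> card (R \<union> T ` Bw)" using span_RT fin finR by (intro vec.dim_le_card) auto
  finally have le: "CARD('i) \<le> card (R \<union> T ` Bw)" .
  \<comment> \<open>A spanning set of an \<open>|I|\<close>-dimensional space with at most
    \<open>rank A + (|I| - rank A)\<close> elements: all inequalities are equalities, so
    \<open>T\<close> is injective on the basis and its images are independent.\<close>
  have "card (R \<union> T ` Bw) \<le> rank ?A + card (T ` Bw)" using card_Un_le[of R "T ` Bw"] R(4) by simp
  moreover have "card (T ` Bw) \<le> card Bw" by (rule card_image_le[OF fin])
  ultimately have eq: "card (T ` Bw) = card Bw" and le': "card (R \<union> T ` Bw) \<le> CARD('i)"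
    using le rank_le card_Bw by auto
  have "inj_on T Bw" using eq fin by (rule eq_card_imp_inj_on[rotated])
  moreover have "vec.independent (R \<union> T ` Bw)"
    by (rule vec.card_le_dim_spanning[OF subset_UNIV span_RT]) (use fin finR le' in \<open>simp_all only: vec_dim_card finite_Un finite_imageI\<close>)
  then have "vec.independent (T ` Bw)" by (rule vec.independent_mono) simp
  ultimately have "inj_on T (cvs.span Bw)" by (simp add: T.inj_on_span_iff_independent_image)
  then have inj: "inj_on T W" by (simp add: span_Bw)
  have "T w = T 0" using w(2) by (simp add: T_def vec_eq_iff clinear_zero[OF lin])
  then show ?thesis by (rule inj_onD[OF inj]) (use w(1) cvs.subspace_0[OF W(1)] in auto)
qed

lemma perm_order_pos:
  fixes \<mu> :: "'i::finite \<Rightarrow> 'i"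
  assumes "bij \<mu>"
  shows "0 < perm_order \<mu>" "\<mu> ^^ perm_order \<mu> = id"
proof -
  have "permutation \<mu>" using assms by (simp add: permutation)
  then obtain n where "\<mu> ^^ n = id" "0 < n" by (rule permutation_is_nilpotent)
  then have "0 < n \<and> \<mu> ^^ n = id" by simp
  then have "0 < perm_order \<mu> \<and> \<mu> ^^ perm_order \<mu> = id"
    unfolding perm_order_def by (rule LeastI)
  then show "0 < perm_order \<mu>" "\<mu> ^^ perm_order \<mu> = id" by auto
qed

section \<open>Twisted Kac--Moody algebras\<close>

locale twisted_kac_moody =
  fixes a :: "'i::finite \<Rightarrow> 'i \<Rightarrow> int" and r :: "'i \<Rightarrow> nat" and \<mu> :: "'i \<Rightarrow> 'i"
    and \<alpha> :: "'i \<Rightarrow> 'h::complex_vs \<Rightarrow> complex" and av :: "'i \<Rightarrow> 'h" and W :: "'h set"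
    and br :: "'g::complex_vs \<Rightarrow> 'g \<Rightarrow> 'g" and \<kappa> :: "('i, 'h) km_gen \<Rightarrow> 'g"
    and B :: "'g \<Rightarrow> 'g \<Rightarrow> complex" and mh :: "'h \<Rightarrow> 'h" and mg :: "'g \<Rightarrow> 'g"
  assumes gcm: "symmetrizable_gcm a r"
    and real: "realization a \<alpha> av"
    and km: "kac_moody a \<alpha> av br \<kappa>"
    and comp: "stable_complement a \<alpha> av W"
    and form: "invariant_form r \<alpha> av W br \<kappa> B"
    and adm: "admissible a r \<mu>"
    and act: "mu_action \<mu> \<alpha> av W br \<kappa> mh mg"
begin

abbreviation H :: "'h \<Rightarrow> 'g" where "H h \<equiv> \<kappa> (KH h)"
abbreviation e :: "sign \<Rightarrow> 'i \<Rightarrow> 'g" where "e s i \<equiv> \<kappa> (KE s i)"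
abbreviation coroot_span :: "'h set" where "coroot_span \<equiv> cvs.span (range av)"

lemmas km_presented = km[unfolded kac_moody_def]

sublocale quadratic_lie_algebra br B
proof (intro quadratic_lie_algebra.intro quadratic_lie_algebra_axioms.intro)
  show "lie_algebra br" using km_presented unfolding presented_by_def by (elim conjE)
  note form = form[unfolded invariant_form_def]
  show "clinear (B x)" for x by (rule form[THEN conjunct1, rule_format])
  show "B x y = B y x" for x y by (rule form[THEN conjunct2, THEN conjunct1, rule_format])
  show "B (br x y) z = B x (br y z)" for x y z
    by (rule form[THEN conjunct2, THEN conjunct2, THEN conjunct1, rule_format])
qed

lemma km_relator_zero:
  assumes "f \<in> km_relators a \<alpha> av"
  shows "eval_free br \<kappa> f = 0"
proof -
  have "f \<in> lie_ideal UNIV (km_relators a \<alpha> av)" by (rule lie_ideal.relator[OF assms])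
  moreover have "f \<in> free_on UNIV" by (simp add: free_on_def)
  ultimately show ?thesis using km_presented unfolding presented_by_def by blast
qed

lemma clinear_H: "clinear H"
proof (rule clinearI)
  show "H (h + k) = H h + H k" for h k
    using km_relator_zero[OF km_relators.h_add, of h k] by (simp add: eval_free_diff eval_free_add eval_free_letter)
  show "H (c *\<^sub>C h) = c *\<^sub>C H h" for c h
    using km_relator_zero[OF km_relators.h_scale, of c h] by (simp add: eval_free_diff eval_free_scale eval_free_letter)
qed

lemma br_H_H: "br (H h) (H k) = 0"
  using km_relator_zero[OF km_relators.h_h, of h k] by (simp add: eval_free_fmult eval_free_letter)

lemma br_e_f: "br (e Plus i) (e Minus j) = (if i = j then H (av j) else 0)"
  using km_relator_zero[OF km_relators.e_f, of i j]
  by (auto simp: eval_free_diff eval_free_fmult eval_free_letter eval_free_zero)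

lemma br_H_e: "br (H h) (e s i) = (sgnc s * \<alpha> i h) *\<^sub>C e s i"
  using km_relator_zero[OF km_relators.h_e, of h s i]
  by (simp add: eval_free_diff eval_free_fmult eval_free_letter eval_free_scale)

lemma serre: "i \<noteq> j \<Longrightarrow> (br (e s i) ^^ nat (1 - a i j)) (e s j) = 0"
proof -
  have "eval_free br \<kappa> (((\<lambda>x. ke s i \<star> x) ^^ n) (ke s j)) = (br (e s i) ^^ n) (e s j)" for n
    by (induction n) (simp_all add: eval_free_letter eval_free_fmult)
  then show "i \<noteq> j \<Longrightarrow> (br (e s i) ^^ nat (1 - a i j)) (e s j) = 0"
    using km_relator_zero[OF km_relators.serre, of i j s] by simp
qed

lemma clinear_\<alpha>: "clinear (\<alpha> i)"
  using real by (simp add: realization_def)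

lemma \<alpha>_av: "\<alpha> j (av i) = of_int (a i j)"
  using real by (simp add: realization_def)

lemma a_diag: "a i i = 2"
  and a_offdiag: "i \<noteq> j \<Longrightarrow> a i j \<le> 0"
  and a_zero: "a i j = 0 \<longleftrightarrow> a j i = 0"
  and r_pos: "0 < r i"
  and a_sym: "int (r i) * a i j = int (r j) * a j i"
  using gcm by (auto simp: symmetrizable_gcm_def)

lemma \<mu>_bij: "bij \<mu>"
  and a_\<mu>: "a (\<mu> i) (\<mu> j) = a i j"
  and r_\<mu>: "r (\<mu> i) = r i"
  using adm by (auto simp: admissible_def diagram_auts_def)

lemmas \<mu>_order = perm_order_pos[OF \<mu>_bij]

lemma clinear_mh: "clinear mh"
  and mh_av: "mh (av i) = av (\<mu> i)"
  and mh_W: "w \<in> W \<Longrightarrow> mh w \<in> W"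
  and \<alpha>_mh_W: "w \<in> W \<Longrightarrow> \<alpha> (\<mu> i) (mh w) = \<alpha> i w"
  and mg_lie_hom: "lie_hom br br mg"
  and mg_e: "mg (e s i) = e s (\<mu> i)"
  and mg_H: "mg (H h) = H (mh h)"
  using act by (auto simp: mu_action_def)

lemma W_subspace: "cvs.subspace W"
  and W_sum: "\<exists>y\<in>coroot_span. \<exists>w\<in>W. x = y + w"
  using comp by (auto simp: stable_complement_def)

section \<open>Finite order of the two actions of \<open>\<mu>\<close>\<close>

lemma clinear_eq_cartan:
  assumes f: "clinear f" and g: "clinear g"
    and av: "\<And>i. f (av i) = g (av i)" and W: "\<And>w. w \<in> W \<Longrightarrow> f w = g w"
  shows "f h = g h"
proof -
  obtain y w where "y \<in> coroot_span" "w \<in> W" "h = y + w" using W_sum by blast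
  moreover have "f y = g y" by (rule clinear_eq_on_span[OF f g _ \<open>y \<in> coroot_span\<close>]) (auto simp: av)
  ultimately show ?thesis using W by (simp add: clinear_add[OF f] clinear_add[OF g])
qed

lemma \<alpha>_mh: "\<alpha> (\<mu> i) (mh h) = \<alpha> i h"
  by (rule clinear_eq_cartan[of "\<lambda>h. \<alpha> (\<mu> i) (mh h)"])
    (auto intro: clinear_comp clinear_\<alpha> clinear_mh simp: mh_av \<alpha>_av a_\<mu> \<alpha>_mh_W)

text \<open>On coroots this is the order of \<open>\<mu>\<close>. For \<open>w\<close> in
  \<open>W\<close>, the difference \<open>mh^N w - w\<close> again lies in \<open>W\<close> and is
  killed by all simple roots, so it is 0 by \<open>complement_inter_center\<close>.\<close>

lemma mh_order: "mh ^^ perm_order \<mu> = id"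
proof
  fix h
  let ?N = "perm_order \<mu>"
  have pow: "(mh ^^ n) (av i) = av ((\<mu> ^^ n) i)" "\<alpha> ((\<mu> ^^ n) i) ((mh ^^ n) h) = \<alpha> i h" for n i h
    by (induction n) (simp_all add: mh_av \<alpha>_mh)
  have powW: "(mh ^^ n) w \<in> W" if "w \<in> W" for n w
    using that by (induction n) (simp_all add: mh_W)
  have "(mh ^^ ?N) h = (\<lambda>h. h) h"
  proof (rule clinear_eq_cartan)
    show "clinear (mh ^^ ?N)" "clinear (\<lambda>h::'h. h)" by (intro clinear_funpow clinear_mh clinear_id)+
    show "(mh ^^ ?N) (av i) = av i" for i by (simp add: pow \<mu>_order)
    fix w assume w: "w \<in> W"
    have "\<alpha> i ((mh ^^ ?N) w - w) = 0" for i
      using pow(2)[of ?N i w] by (simp add: \<mu>_order clinear_diff[OF clinear_\<alpha>])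
    then have "(mh ^^ ?N) w - w = 0"
      by (intro complement_inter_center[OF real comp] cvs.subspace_diff W_subspace powW w)
    then show "(mh ^^ ?N) w = w" by simp
  qed
  then show "(mh ^^ ?N) h = id h" by simp
qed

lemma mg_order_id: "mg ^^ perm_order \<mu> = id"
proof
  fix x
  let ?f = "mg ^^ perm_order \<mu>"
  have lin: "clinear mg" and hom: "mg (br x y) = br (mg x) (mg y)" for x y
    using mg_lie_hom by (auto simp: lie_hom_def)
  have f: "clinear ?f" by (rule clinear_funpow[OF lin])
  have sub: "cvs.subspace {x. ?f x = x}"
    by (simp add: cvs.subspace_def clinear_add[OF f] clinear_scale[OF f] clinear_zero[OF f])
  have "(mg ^^ n) (e s i) = e s ((\<mu> ^^ n) i)" "(mg ^^ n) (H h) = H ((mh ^^ n) h)" for n s i h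
    by (induction n) (simp_all add: mg_e mg_H)
  then have gen: "?f (\<kappa> y) = \<kappa> y" for y
    by (cases y) (simp_all add: \<mu>_order mh_order)
  have pow_hom: "(mg ^^ n) (br x y) = br ((mg ^^ n) x) ((mg ^^ n) y)" for n x y
    by (induction n) (simp_all add: hom)
  have "x \<in> {x. ?f x = x}"
    by (rule presented_by_induct[OF km_presented sub]) (simp_all add: gen pow_hom)
  then show "?f x = id x" by simp
qed

sublocale finite_order_automorphism br B \<mu> mg
  by unfold_locales (rule mg_lie_hom mg_order_id \<mu>_order)+

abbreviation "M \<equiv> ipow N \<mu>"

lemma E_e: "E k (e s i) = e s (M k i)"
proof -
  have "(mg ^^ n) (e s i) = e s ((\<mu> ^^ n) i)" for n by (induction n) (simp_all add: mg_e)
  then show ?thesis by (simp add: ipow_def)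
qed

lemma E_H: "E k (H h) = H (ipow N mh k h)"
proof -
  have "(mg ^^ n) (H h) = H ((mh ^^ n) h)" for n by (induction n) (simp_all add: mg_H)
  then show ?thesis by (simp add: ipow_def)
qed

lemma mh_pow_av: "ipow N mh k (av i) = av (M k i)"
proof -
  have "(mh ^^ n) (av i) = av ((\<mu> ^^ n) i)" for n by (induction n) (simp_all add: mh_av)
  then show ?thesis by (simp add: ipow_def)
qed

lemma M_add: "M (k + l) i = M k (M l i)"
  by (rule ipow_add[OF \<mu>_order(2,1)])

lemma M_0: "M 0 i = i"
  by (rule ipow_0)

lemma M_1: "M 1 i = \<mu> i"
  by (rule ipow_1[OF \<mu>_order(2,1)])

lemma M_mod: "M (k mod int N) = M k"
  by (rule ipow_mod)

lemma M_inverse: "M (- k) (M k i) = i" "M k (M (- k) i) = i"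
  using M_add[of "- k" k i] M_add[of k "- k" i] by (simp_all add: M_0)

lemma M_eq_iff: "M k i = M k j \<longleftrightarrow> i = j"
  by (metis M_inverse(1))

lemma M_uminus_eq_iff: "M (- k) i = j \<longleftrightarrow> i = M k j"
  by (metis M_inverse)

lemma a_M: "a (M k i) (M k j) = a i j"
proof -
  have "a ((\<mu> ^^ n) i) ((\<mu> ^^ n) j) = a i j" for n by (induction n) (simp_all add: a_\<mu>)
  then show ?thesis by (simp add: ipow_def)
qed

lemma a_M_uminus: "a (M (- k) i) j = a i (M k j)"
  using a_M[of k "M (- k) i" j] by (simp add: M_inverse)

lemma r_M: "r (M k i) = r i"
proof -
  have "r ((\<mu> ^^ n) i) = r i" for n by (induction n) (simp_all add: r_\<mu>)
  then show ?thesis by (simp add: ipow_def)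
qed

lemma pw_M: "k \<in> residues_of \<mu> \<Longrightarrow> pw \<mu> k i = M k i"
  by (simp add: residues_of_def pw_eq_ipow[of _ N])

section \<open>Values of the invariant form on the generators\<close>

lemma form_av: "B (H (av i)) (H h) = \<alpha> i h / of_nat (r i)"
proof -
  have "of_nat (r i) * B (H (av i)) (H h) = \<alpha> i h"
    by (rule form[unfolded invariant_form_def, THEN conjunct2, THEN conjunct2, THEN conjunct2,
        THEN conjunct2, THEN conjunct1, rule_format])
  then show ?thesis using r_pos[of i] by (simp add: field_simps)
qed

lemma form_av_av: "B (H (av i)) (H (av j)) = of_int (a j i) / of_nat (r i)"
  by (simp add: form_av \<alpha>_av)

text \<open>Invariance moves \<open>H h\<close> from one argument to the other, which gives
  \<open>(c + d) * B x y = 0\<close>.\<close>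

lemma form_weight:
  assumes "br (H h) x = c *\<^sub>C x" "br (H h) y = d *\<^sub>C y" "c + d \<noteq> 0"
  shows "B x y = 0"
proof -
  have "B (br x (H h)) y = B x (br (H h) y)" by (rule form_invariant)
  then have "- c * B x y = d * B x y"
    using assms br_antisym[of x "H h"]
    by (simp add: form_scale_right form_scale_left flip: cvs.scale_minus_left)
  then have "(c + d) * B x y = 0" unfolding distrib_right by (metis add.right_inverse mult_minus_left)
  then show ?thesis using assms(3) by simp
qed

lemma ex_height: "\<exists>h0. \<forall>i. \<alpha> i h0 = 1"
proof -
  obtain d where d: "\<And>i j. \<alpha> i (d j) = (if i = j then 1 else 0)"
    using realization_dual_vectors[OF real] by blast
  have "\<alpha> i (\<Sum>j\<in>UNIV. d j) = 1" for i by (simp add: clinear_sum[OF clinear_\<alpha>] d)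
  then show ?thesis by blast
qed

text \<open>The bracket with \<open>H h0\<close> measures height: 1 on each \<open>e Plus i\<close>,
  -1 on each \<open>e Minus i\<close> and 0 on the Cartan subalgebra. \<open>form_weight\<close>
  turns this into orthogonality.\<close>

definition h0 :: 'h where "h0 = (SOME h. \<forall>i. \<alpha> i h = 1)"

lemma \<alpha>_h0: "\<alpha> i h0 = 1"
  using someI_ex[OF ex_height] by (simp add: h0_def)

lemma form_H_e: "B (H h) (e s i) = 0"
  by (rule form_weight[of h0 _ 0 _ "sgnc s"]) (cases s; simp add: br_H_H br_H_e \<alpha>_h0)+

lemma form_e_f: "B (e Plus i) (e Minus j) = (if i = j then 1 / of_nat (r j) else 0)"
proof -
  have "2 * B (e Plus i) (e Minus j) = B (br (H (av i)) (e Plus i)) (e Minus j)"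
    by (simp add: br_H_e \<alpha>_av a_diag form_scale_left)
  also have "\<dots> = B (H (av i)) (br (e Plus i) (e Minus j))" by (rule form_invariant)
  also have "\<dots> = 2 * (if i = j then 1 / of_nat (r j) else 0)"
    by (simp add: br_e_f form_av \<alpha>_av a_diag form_zero_right)
  finally show ?thesis by (simp only: mult_cancel_left) simp
qed

section \<open>The relations not involving several formal variables\<close>

abbreviation "abr \<equiv> aff_br br B"

sublocale aff: lie_algebra abr
  by (rule lie_algebra_aff_br)

definition gen_image :: "('i, 'h) hat_gen \<Rightarrow> 'g aff" where
  "gen_image x = (case x of
      GL h \<Rightarrow> aff_t 0 ((1 / of_nat N) *\<^sub>C twm 0 (H h))
    | GH i m \<Rightarrow> aff_t m (of_nat (r i) *\<^sub>C twm m (H (av i)))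
    | GX s i m \<Rightarrow> aff_t m (twm m (e s i))
    | GC \<Rightarrow> of_nat N *\<^sub>C aff_c
    | GD \<Rightarrow> aff_d)"

abbreviation "ev \<equiv> eval_free abr gen_image"

lemma tw_H_fixed: "mh h = h \<Longrightarrow> twm 0 (H h) = of_nat N *\<^sub>C H h"
  by (rule tw_eigenvector) (simp add: mg_H cscale_one)

lemma
  shows ev_LL: "h \<in> fixed_cartan mh \<Longrightarrow> ev (LL h) = aff_t 0 (H h)"
    and ev_HH: "ev (HH i m) = of_nat (r i) *\<^sub>C aff_t m (twm m (H (av i)))"
    and ev_XX: "ev (XX s i m) = aff_t m (twm m (e s i))"
    and ev_CC: "ev CC = of_nat N *\<^sub>C aff_c"
    and ev_DD: "ev DD = aff_d"
  using order_pos
  by (simp_all add: eval_free_letter gen_image_def fixed_cartan_def tw_H_fixed cscale_one aff_t_scale)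

lemmas ev_simps = ev_LL ev_HH ev_XX ev_CC ev_DD eval_free_add eval_free_diff eval_free_scale
  eval_free_zero eval_free_sum aff.eval_free_fmult

lemma abr_t_t: "abr (aff_t m (twm m x)) (aff_t n (twm n y)) =
    aff_t (m + n) (\<Sum>k\<in>residues_of \<mu>. (\<xi> powi (k * m)) *\<^sub>C twm (m + n) (br (E (- k) x) y)) +
    (if m + n = 0 then of_int m * B (twm m x) (twm n y) else 0) *\<^sub>C aff_c"
  by (simp add: aff_br_t_t br_tw)

lemma fixed_cartan_add: "h \<in> fixed_cartan mh \<Longrightarrow> g \<in> fixed_cartan mh \<Longrightarrow> h + g \<in> fixed_cartan mh"
  and fixed_cartan_scale: "h \<in> fixed_cartan mh \<Longrightarrow> c *\<^sub>C h \<in> fixed_cartan mh"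
  by (simp_all add: fixed_cartan_def clinear_add[OF clinear_mh] clinear_scale[OF clinear_mh])

lemma sum_orbit_fixed: "(\<Sum>k\<in>residues_of \<mu>. ipow N mh k h) \<in> fixed_cartan mh"
proof -
  have "mh (\<Sum>k\<in>residues_of \<mu>. ipow N mh k h) = (\<Sum>k\<in>residues_of \<mu>. ipow N mh (1 + 1 * k) h)"
    by (simp add: clinear_sum[OF clinear_mh] ipow_add[OF mh_order order_pos] ipow_1[OF mh_order order_pos])
  also have "\<dots> = (\<Sum>k\<in>residues_of \<mu>. ipow N mh k h)"
    by (rule sum_residues_reflect[of "\<lambda>k. ipow N mh k h"]) (simp_all add: ipow_mod)
  finally show ?thesis by (simp add: fixed_cartan_def)
qed

lemma tw_0_H: "twm 0 (H h) = H (\<Sum>k\<in>residues_of \<mu>. ipow N mh k h)"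
  by (simp add: tw_eq cscale_one E_H clinear_sum[OF clinear_H])

lemma tw_\<mu>_e: "twm m (e s (\<mu> i)) = (\<xi> powi m) *\<^sub>C twm m (e s i)"
  using tw_mg[of m "e s i"] by (simp add: mg_e)

lemma \<alpha>_fixed: "h \<in> fixed_cartan mh \<Longrightarrow> \<alpha> (M k i) h = \<alpha> i h"
proof -
  assume h: "h \<in> fixed_cartan mh"
  have "\<alpha> ((\<mu> ^^ n) i) h = \<alpha> i h" for n
    using h \<alpha>_mh[of "(\<mu> ^^ _) i" h] by (induction n) (auto simp: fixed_cartan_def)
  then show ?thesis by (simp add: ipow_def)
qed

lemma br_fixed_tw_e:
  assumes "h \<in> fixed_cartan mh"
  shows "br (H h) (twm m (e s i)) = (sgnc s * \<alpha> i h) *\<^sub>C twm m (e s i)"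
  using assms
  by (simp add: tw_eq br_sum_right br_scale_right E_e br_H_e \<alpha>_fixed cvs.scale_sum_right cscale_cscale mult.commute)

lemma br_H_tw_H: "br (H h) (twm m (H k)) = 0"
  by (simp add: tw_eq br_sum_right br_scale_right E_H br_H_H)

lemma relation_L2: "abr (ev (HH i m)) (ev (HH j n)) =
    (\<Sum>k\<in>residues_of \<mu>. (of_nat (r i) * of_int (a i (pw \<mu> k j)) *
          (if m + n = 0 then of_int m else 0) * \<xi> powi (k * m)) *\<^sub>C (of_nat N *\<^sub>C aff_c))"
proof -
  have br0: "br (E (- k) (H (av i))) (H (av j)) = 0" for k by (simp add: E_H br_H_H)
  have inv: "B (E q (E p (H (av i)))) (E q (H (av j))) = B (E p (H (av i))) (H (av j))" for p q
    by (simp add: E_H mh_pow_av form_av_av a_M r_M)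
  \<comment> \<open>The form yields \<open>a j (M (- k) i)\<close>, with the indices in the opposite
    order to L2; the symmetry of \<open>r i * a i j\<close> exchanges them.\<close>
  have sym: "of_nat (r i) * of_nat (r j) * B (E (- k) (H (av i))) (H (av j)) = of_nat (r i) * of_int (a i (pw \<mu> k j))"
    if "k \<in> residues_of \<mu>" for k
  proof -
    have "int (r j) * a j (M (- k) i) = int (r i) * a i (pw \<mu> k j)"
      using that a_sym[of j "M (- k) i"] by (simp add: r_M a_M_uminus pw_M)
    then have "(of_nat (r j) * of_int (a j (M (- k) i)) :: complex) = of_nat (r i) * of_int (a i (pw \<mu> k j))"
      by (metis of_int_mult of_int_of_nat_eq)
    then show ?thesis using r_pos[of i] by (simp add: E_H mh_pow_av form_av_av r_M)
  qed
  show ?thesis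
  proof (cases "m + n = 0")
    case True
    have "abr (ev (HH i m)) (ev (HH j n)) =
        (of_nat (r i) * of_nat (r j) * of_int m * B (twm m (H (av i))) (twm n (H (av j)))) *\<^sub>C aff_c"
      by (simp add: ev_simps aff.br_scale_left aff.br_scale_right abr_t_t br0 tw_zero aff_t_zero True
          cscale_cscale mult.assoc)
    also have "of_nat (r i) * of_nat (r j) * of_int m * B (twm m (H (av i))) (twm n (H (av j))) =
      of_nat N * of_int m * (\<Sum>k\<in>residues_of \<mu>. \<xi> powi (k * m) *
        (of_nat (r i) * of_nat (r j) * B (E (- k) (H (av i))) (H (av j))))"
      by (simp add: form_tw[OF inv True] sum_distrib_left ac_simps)
    also have "\<dots> = of_nat N * of_int m * (\<Sum>k\<in>residues_of \<mu>. \<xi> powi (k * m) *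
        (of_nat (r i) * of_int (a i (pw \<mu> k j))))"
      by (simp add: sym)
    finally show ?thesis
      using True by (simp add: cscale_cscale sum_distrib_left cvs.scale_sum_left ac_simps)
  next
    case False
    then show ?thesis
      by (simp add: ev_simps aff.br_scale_left aff.br_scale_right abr_t_t br0 tw_zero aff_t_zero)
  qed
qed

lemma relation_L4: "abr (ev (HH i m)) (ev (XX s j n)) =
    sgnc s *\<^sub>C (\<Sum>k\<in>residues_of \<mu>.
      (of_nat (r i) * of_int (a i (pw \<mu> k j)) * \<xi> powi (k * m)) *\<^sub>C ev (XX s j (m + n)))"
proof -
  have inv: "B (E q (E p (H (av i)))) (E q (e s j)) = B (E p (H (av i))) (e s j)" for p q
    by (simp add: E_H E_e form_H_e)
  \<comment> \<open>No central term: coroots have height 0 and the \<open>e\<close>'s have height 1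
    or -1, so they are orthogonal.\<close>
  have "(if m + n = 0 then of_int m * B (twm m (H (av i))) (twm n (e s j)) else 0) = 0"
    by (simp add: form_tw[OF inv] E_H form_H_e)
  moreover have "(\<Sum>k\<in>residues_of \<mu>. (\<xi> powi (k * m)) *\<^sub>C twm (m + n) (br (E (- k) (H (av i))) (e s j))) =
    (\<Sum>k\<in>residues_of \<mu>. (\<xi> powi (k * m) * (sgnc s * of_int (a i (pw \<mu> k j)))) *\<^sub>C twm (m + n) (e s j))"
    by (intro sum.cong refl)
      (simp add: E_H mh_pow_av br_H_e \<alpha>_av a_M_uminus pw_M tw_scale cscale_cscale)
  ultimately have "abr (ev (HH i m)) (ev (XX s j n)) = of_nat (r i) *\<^sub>C
      aff_t (m + n) (\<Sum>k\<in>residues_of \<mu>. (\<xi> powi (k * m) * (sgnc s * of_int (a i (pw \<mu> k j)))) *\<^sub>C twm (m + n) (e s j))"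
    by (simp add: ev_simps aff.br_scale_left abr_t_t)
  then show ?thesis
    by (simp add: ev_simps aff_t_sum aff_t_scale cvs.scale_sum_right cscale_cscale ac_simps)
qed

lemma relation_L5: "abr (ev (XX Plus i m)) (ev (XX Minus j n)) =
    (\<Sum>k\<in>residues_of \<mu>. ((if i = pw \<mu> k j then 1 else 0) / of_nat (r j) * \<xi> powi (k * m)) *\<^sub>C
      (ev (HH j (m + n)) + (if m + n = 0 then of_int m else 0) *\<^sub>C (of_nat N *\<^sub>C aff_c)))"
proof -
  have delta: "M (- k) i = j \<longleftrightarrow> i = pw \<mu> k j" if "k \<in> residues_of \<mu>" for k
    using that by (simp add: M_uminus_eq_iff pw_M)
  have inv: "B (E q (E p (e Plus i))) (E q (e Minus j)) = B (E p (e Plus i)) (e Minus j)" for p q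
    by (simp add: E_e form_e_f M_eq_iff r_M)
  have loop: "(\<Sum>k\<in>residues_of \<mu>. (\<xi> powi (k * m)) *\<^sub>C twm (m + n) (br (E (- k) (e Plus i)) (e Minus j))) =
    (\<Sum>k\<in>residues_of \<mu>. ((if i = pw \<mu> k j then 1 else 0) * \<xi> powi (k * m)) *\<^sub>C twm (m + n) (H (av j)))"
    by (intro sum.cong refl) (simp add: E_e br_e_f delta tw_zero)
  have central: "B (twm m (e Plus i)) (twm n (e Minus j)) =
    of_nat N * (\<Sum>k\<in>residues_of \<mu>. (if i = pw \<mu> k j then 1 else 0) / of_nat (r j) * \<xi> powi (k * m))"
    if "m + n = 0"
    unfolding form_tw[OF inv that]
    by (rule arg_cong2[where f = "(*)"], rule refl, rule sum.cong[OF refl]) (simp add: E_e form_e_f delta)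
  have nz: "of_nat (r j) \<noteq> (0 :: complex)" using r_pos[of j] by simp
  show ?thesis
    unfolding ev_XX abr_t_t loop
    using nz by (auto simp: central ev_HH aff_t_sum aff_t_scale cscale_add_right sum.distrib cscale_cscale
        sum_distrib_left cvs.scale_sum_left ac_simps)
qed

end

section \<open>Orbits and stabilizers\<close>

lemma foldr_same: "foldr (\<lambda>_. f) xs y = (f ^^ length xs) y"
  by (induction xs) simp_all

locale linking_twisted_kac_moody = twisted_kac_moody a r \<mu> \<alpha> av W br \<kappa> B mh mg
  for a :: "'i::finite \<Rightarrow> 'i \<Rightarrow> int" and r :: "'i \<Rightarrow> nat" and \<mu> :: "'i \<Rightarrow> 'i"
    and \<alpha> :: "'i \<Rightarrow> 'h::complex_vs \<Rightarrow> complex" and av :: "'i \<Rightarrow> 'h" and W :: "'h set"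
    and br :: "'g::complex_vs \<Rightarrow> 'g \<Rightarrow> 'g" and \<kappa> :: "('i, 'h) km_gen \<Rightarrow> 'g"
    and B :: "'g \<Rightarrow> 'g \<Rightarrow> complex" and mh :: "'h \<Rightarrow> 'h" and mg :: "'g \<Rightarrow> 'g" +
  assumes lc1: "LC1 a \<mu>" and lc2: "LC2 a \<mu>"
begin

lemma \<mu>_permutation: "permutation \<mu>"
  using \<mu>_bij by (simp add: permutation)

lemma orbit_eq: "orbit \<mu> i = range (\<lambda>k. M k i)"
proof -
  have "M k i \<in> orbit \<mu> i" for k
    unfolding ipow_def by (rule funpow_in_orbit[OF permutation_self_in_orbit[OF \<mu>_permutation]])
  moreover have "(\<mu> ^^ n) i \<in> range (\<lambda>k. M k i)" for n
  proof -
    have "(\<mu> ^^ n) i = M (int n) i"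
      by (induction n) (simp_all add: M_0 M_1 M_add)
    then show ?thesis by blast
  qed
  ultimately show ?thesis by (auto simp: orbit_altdef)
qed

lemma orbit_M: "orbit \<mu> (M k i) = orbit \<mu> i"
proof
  show "orbit \<mu> (M k i) \<subseteq> orbit \<mu> i"
    unfolding orbit_eq by (rule image_subsetI) (rule range_eqI, rule M_add[symmetric])
  have "M l i = M (l - k) (M k i)" for l by (simp flip: M_add)
  then show "orbit \<mu> i \<subseteq> orbit \<mu> (M k i)"
    unfolding orbit_eq by (intro image_subsetI range_eqI)
qed

lemma card_orbit: "card (orbit \<mu> i) = least_power \<mu> i"
proof -
  let ?p = "least_power \<mu> i"
  have p: "0 < ?p" "(\<mu> ^^ ?p) i = i" using least_power_of_permutation[OF \<mu>_permutation] by auto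
  have "orbit \<mu> i = (\<lambda>n. (\<mu> ^^ n) i) ` {..<?p}"
  proof -
    have "(\<mu> ^^ n) i = (\<mu> ^^ (n mod ?p)) i" for n by (rule funpow_mod_eq[symmetric]) (rule p)
    moreover have "n mod ?p \<in> {..<?p}" for n using p by simp
    ultimately show ?thesis
      unfolding orbit_altdef_permutation[OF \<mu>_permutation] by blast
  qed
  moreover have "inj_on (\<lambda>n. (\<mu> ^^ n) i) {..<?p}"
    using cycle_of_permutation[OF \<mu>_permutation, of i] by (simp add: distinct_map lessThan_atLeast0)
  ultimately show ?thesis by (simp add: card_image)
qed

lemma M_fix_iff: "M k i = i \<longleftrightarrow> int (card (orbit \<mu> i)) dvd k"
proof -
  let ?p = "least_power \<mu> i"
  have pN: "?p dvd N" using least_power_dvd[OF \<mu>_permutation] \<mu>_order by simp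
  have "M k i = i \<longleftrightarrow> ?p dvd nat (k mod int N)"
    unfolding ipow_def by (rule least_power_dvd[OF \<mu>_permutation, symmetric])
  also have "\<dots> \<longleftrightarrow> int ?p dvd k mod int N"
    using order_pos by (metis int_dvd_int_iff int_nat_eq pos_mod_sign of_nat_0_less_iff)
  also have "\<dots> \<longleftrightarrow> int ?p dvd k" using pN by (simp add: dvd_mod_iff)
  finally show ?thesis by (simp add: card_orbit)
qed

lemma card_orbit_dd: "N = card (orbit \<mu> i) * dd \<mu> i" and dd_pos: "0 < dd \<mu> i"
proof -
  have "card (orbit \<mu> i) dvd N"
    using M_fix_iff[of "int N" i] by (simp add: ipow_def)
  then show "N = card (orbit \<mu> i) * dd \<mu> i" by (simp add: dd_def)
  then show "0 < dd \<mu> i" using order_pos by (metis gr0I mult_0_right less_numeral_extra(3))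
qed

text \<open>\<open>N\<close> is the orbit length times \<open>dd \<mu> i\<close>. So the
  \<open>dd \<mu> i\<close>-th power of \<open>\<xi>^k\<close> forgets exactly the stabilizer of
  \<open>i\<close>, and polynomials in such powers can tell the points of the orbit apart.\<close>

lemma xi_dd: "(\<xi> powi k) ^ dd \<mu> i = 1 \<longleftrightarrow> M k i = i"
proof -
  have "(\<xi> powi k) ^ dd \<mu> i = \<xi> powi (k * int (dd \<mu> i))"
    by (simp add: power_int_mult)
  also have "\<dots> = 1 \<longleftrightarrow> int N dvd k * int (dd \<mu> i)" by (rule xi_power_eq_1_iff[OF order_pos])
  also have "int N = int (card (orbit \<mu> i)) * int (dd \<mu> i)"
    using card_orbit_dd[of i] by (metis of_nat_mult)
  finally show ?thesis using dd_pos[of i] by (simp add: M_fix_iff)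
qed

text \<open>The column sum in LC1 contains the diagonal entry 2, and its other entries are
  nonpositive. A positive total leaves room for a single nonzero one among them, equal to
  -1.\<close>

lemma orbit_neighbours:
  assumes "M x i \<noteq> i" "a (M x i) i \<noteq> 0" "M y i \<noteq> i" "a (M y i) i \<noteq> 0"
  shows "M x i = M y i" "a (M x i) i = -1"
proof -
  let ?O = "orbit \<mu> i"
  have fin: "finite ?O" by simp
  have mem: "M k i \<in> ?O" for k by (auto simp: orbit_eq)
  have self: "i \<in> ?O" using mem[of 0] by (simp add: M_0)
  have neg: "a p i \<le> 0" if "p \<noteq> i" for p using that by (rule a_offdiag)
  have pos: "0 < (\<Sum>p\<in>?O. a p i)" using lc1 by (simp add: LC1_def)
  have bound: "(\<Sum>p\<in>?O. a p i) \<le> (\<Sum>p\<in>S. a p i)" if S: "S \<subseteq> ?O" "i \<in> S" for S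
  proof -
    have "(\<Sum>p\<in>?O. a p i) = (\<Sum>p\<in>?O - S. a p i) + (\<Sum>p\<in>S. a p i)" by (rule sum.subset_diff[OF S(1) fin])
    moreover have "(\<Sum>p\<in>?O - S. a p i) \<le> 0" using S(2) by (intro sum_nonpos neg) auto
    ultimately show ?thesis by simp
  qed
  have "a (M x i) i < 0" "a (M y i) i < 0" using assms neg by (simp_all add: order_less_le)
  moreover have "(\<Sum>p\<in>{i, M x i}. a p i) = 2 + a (M x i) i" using assms(1) by (auto simp: a_diag)
  ultimately show "a (M x i) i = -1"
    using bound[of "{i, M x i}"] mem self pos by auto
  show "M x i = M y i"
  proof (rule ccontr)
    assume "M x i \<noteq> M y i"
    then have "(\<Sum>p\<in>{i, M x i, M y i}. a p i) = 2 + a (M x i) i + a (M y i) i"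
      using assms(1,3) by (auto simp: a_diag)
    then show False
      using bound[of "{i, M x i, M y i}"] mem self pos \<open>a (M x i) i < 0\<close> \<open>a (M y i) i < 0\<close> by auto
  qed
qed

text \<open>The shifts by \<open>x\<close> and \<open>-x\<close> both lead to neighbours of
  \<open>i\<close>, and there is only one. So \<open>\<xi>^x\<close> raised to
  \<open>dd \<mu> i\<close> is a square root of 1 other than 1: the ratio at which
  \<open>z^d + w^d\<close> vanishes.\<close>

lemma orbit_neighbour_involutive:
  assumes "M x i \<noteq> i" "a (M x i) i \<noteq> 0"
  shows "M (x + x) i = i" "(\<xi> powi x) ^ dd \<mu> i = -1"
proof -
  have "M (- x) i \<noteq> i" using assms(1) by (metis M_inverse(2))
  moreover have "a (M (- x) i) i \<noteq> 0" using assms(2) a_zero by (simp add: a_M_uminus)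
  ultimately have "M x i = M (- x) i" using orbit_neighbours[OF assms] by blast
  then show M: "M (x + x) i = i" by (simp only: M_add M_inverse)
  have "((\<xi> powi x) ^ dd \<mu> i)\<^sup>2 = (\<xi> powi (x + x)) ^ dd \<mu> i"
    by (simp only: xi_powi_add power2_eq_square power_mult_distrib)
  also have "\<dots> = 1" using M by (simp only: xi_dd)
  finally show "(\<xi> powi x) ^ dd \<mu> i = -1" using assms(1) by (simp add: power2_eq_1_iff xi_dd)
qed

section \<open>Iterated brackets of the generators\<close>

lemma br_e_commute:
  assumes "a i j = 0"
  shows "br (e s i) (e s j) = 0"
proof -
  have "i \<noteq> j" using assms a_diag[of i] by auto
  from serre[OF this, of s] assms show ?thesis by simp
qed

text \<open>If the inner bracket is nonzero, \<open>M y i\<close> is the only neighbour of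
  \<open>i\<close>. A third letter equal to one of these two gives a Serre relation with entry -1;
  any other third letter commutes with both.\<close>

lemma orbit_triple_bracket: "br (e s (M x i)) (br (e s (M y i)) (e s i)) = 0"
proof (cases "a (M y i) i = 0 \<or> M y i = i")
  case True
  then show ?thesis by (auto simp: br_e_commute alternating br_zero_right)
next
  case False
  then have y: "M y i \<noteq> i" "a (M y i) i \<noteq> 0" by auto
  have minus1: "a (M y i) i = -1" by (rule orbit_neighbours(2)[OF y y])
  have y': "M (- y) i = M y i"
    using orbit_neighbour_involutive(1)[OF y] by (metis M_add M_inverse(1))
  show ?thesis
  proof (cases "M x i = M y i \<or> M x i = i")
    case True
    then show ?thesis
    proof
      assume "M x i = M y i"
      then show ?thesis using serre[OF y(1), of s] minus1 by (simp add: numeral_2_eq_2)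
    next
      assume x: "M x i = i"
      have "a i (M y i) = -1" using minus1 by (simp add: y' flip: a_M_uminus)
      then have "br (e s i) (br (e s i) (e s (M y i))) = 0"
        using serre[of i "M y i" s] y(1) by (simp add: numeral_2_eq_2)
      then show ?thesis using br_antisym[of "e s (M y i)" "e s i"] x by (simp add: br_minus_right)
    qed
  next
    case False
    have "a (M x i) i = 0"
      using orbit_neighbours(1)[OF _ _ y, of x] False by blast
    moreover have "a (M x i) (M y i) = 0"
    proof (rule ccontr)
      \<comment> \<open>Shifted back by \<open>y\<close>, this adjacency makes
        \<open>M (x - y) i\<close> the neighbour of \<open>i\<close>, which is also
        \<open>M (- y) i\<close>; hence \<open>M x i = i\<close>, a case already excluded.\<close>
      assume "a (M x i) (M y i) \<noteq> 0"
      then have "a (M (x - y) i) i \<noteq> 0"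
        using a_M_uminus[of y "M x i" i] by (simp flip: M_add)
      moreover have "M (x - y) i \<noteq> i"
        using False M_add[of y "x - y" i] by auto
      ultimately have "M (x - y) i = M (- y) i" using orbit_neighbours(1)[OF _ _ y] y' by simp
      then have "M (x - y + y) i = M (- y + y) i" by (metis M_add add.commute)
      then show False using False by (simp add: M_0)
    qed
    ultimately show ?thesis
      by (simp add: br_leibniz[of "e s (M x i)"] br_e_commute br_zero_left br_zero_right)
  qed
qed

lemma br_h0_tw_e: "br (H h0) (twm m (e s i)) = sgnc s *\<^sub>C twm m (e s i)"
  by (simp add: tw_eq br_sum_right br_scale_right E_e br_H_e \<alpha>_h0 cvs.scale_sum_right cscale_cscale mult.commute)

lemma br_h0_nested:
  "br (H h0) (foldr (\<lambda>b. br (twm (n b) (e s i))) bs (twm n0 (e s j))) =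
    (sgnc s * of_nat (Suc (length bs))) *\<^sub>C foldr (\<lambda>b. br (twm (n b) (e s i))) bs (twm n0 (e s j))"
proof (induction bs)
  case Nil
  show ?case by (simp add: br_h0_tw_e)
next
  case (Cons b bs)
  let ?y = "twm (n b) (e s i)" and ?z = "foldr (\<lambda>b. br (twm (n b) (e s i))) bs (twm n0 (e s j))"
  have "br (H h0) (br ?y ?z) = br (br (H h0) ?y) ?z + br ?y (br (H h0) ?z)" by (rule br_leibniz)
  also have "\<dots> = (sgnc s + sgnc s * of_nat (Suc (length bs))) *\<^sub>C br ?y ?z"
    unfolding Cons br_h0_tw_e br_scale_left br_scale_right cscale_add_left ..
  also have "sgnc s + sgnc s * of_nat (Suc (length bs)) = sgnc s * of_nat (Suc (length (b # bs)))"
    by (simp add: algebra_simps)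
  finally show ?case by simp
qed

text \<open>At each step the new letter and the remaining word have heights of the same sign, so
  their weights do not cancel, the form vanishes and the affine bracket has no central term.\<close>

lemma ev_nested:
  assumes "distinct bs"
  shows "ev (foldr (\<lambda>b x. XX s i (n b) \<star> x) bs (XX s j n0)) =
    aff_t (n0 + (\<Sum>b\<in>set bs. n b)) (foldr (\<lambda>b. br (twm (n b) (e s i))) bs (twm n0 (e s j)))"
  using assms
proof (induction bs)
  case Nil
  show ?case by (simp add: ev_XX)
next
  case (Cons b bs)
  let ?x = "foldr (\<lambda>b. br (twm (n b) (e s i))) bs (twm n0 (e s j))"
  have "sgnc s + sgnc s * of_nat (Suc (length bs)) = sgnc s * of_nat (Suc (Suc (length bs)))"
    by (simp add: algebra_simps)
  also have "\<dots> \<noteq> 0" by (cases s) (simp_all only: sgnc.simps mult_eq_0_iff of_nat_eq_0_iff, auto)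
  finally have "B (twm (n b) (e s i)) ?x = 0"
    by (intro form_weight[OF br_h0_tw_e br_h0_nested])
  then show ?case using Cons by (simp add: aff.eval_free_fmult ev_XX aff_br_t_t add.left_commute)
qed

text \<open>
  The bracket is a sum over \<open>k\<close> of distributions supported on \<open>z\<^sub>b = \<xi>^(k b) w\<close>, one for each word in the
  \<open>e\<close>'s with indices \<open>\<mu>^(- k b) i\<close>.
\<close>

lemma nested_annihilated:
  fixes P :: cpoly and m :: nat
  assumes "\<And>k. foldr (\<lambda>b. br (e s (M (- k b) i))) [1..<Suc m] (e s j) = 0 \<or>
    (\<forall>F :: (nat \<Rightarrow> int) \<Rightarrow> 'g aff. (\<forall>b\<in>{1..m}. acts_like F (var b) (const (\<xi> powi k b) * var 0)) \<longrightarrow> acts_like F P 0)"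
  shows "ev (pmult P (\<lambda>n. foldr (\<lambda>b x. XX s i (n b) \<star> x) [1..<Suc m] (XX s j (n 0))) n) = 0"
proof -
  let ?bs = "[1..<Suc m]" and ?K = "PiE {1..m} (\<lambda>_. residues_of \<mu>)"
  have set: "set ?bs = {1..m}" by auto
  define w where "w k = foldr (\<lambda>b. br (e s (M (- k b) i))) ?bs (e s j)" for k :: "nat \<Rightarrow> int"
  \<comment> \<open>The part of the bracket belonging to one choice of \<open>k\<close>, in the
    shape that \<open>acts_like_var\<close> requires.\<close>
  define F where "F k n = (\<Prod>b\<in>{1..m}. \<xi> powi (k b * n b)) *\<^sub>C
    aff_t (n 0 + (\<Sum>b\<in>{1..m}. n b)) (twm (n 0 + (\<Sum>b\<in>{1..m}. n b)) (w k))" for k n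
  have "ev (foldr (\<lambda>b x. XX s i (n b) \<star> x) ?bs (XX s j (n 0))) = (\<Sum>k\<in>?K. F k n)" for n
    unfolding ev_nested[OF distinct_upt] nested_br_tw[OF distinct_upt] set
    by (simp add: F_def w_def E_e aff_t_sum aff_t_scale)
  then have "ev (pmult P (\<lambda>n. foldr (\<lambda>b x. XX s i (n b) \<star> x) ?bs (XX s j (n 0))) n) =
      (\<Sum>k\<in>?K. pmult P (F k) n)"
    unfolding pmult_apply_linear[OF clinear_eval_free, symmetric] pmult_sum_right[symmetric] by presburger
  also have "\<dots> = 0"
  proof (rule sum.neutral, rule ballI)
    fix k
    have "acts_like (F k) (var b) (const (\<xi> powi k b) * var 0)" if "b \<in> {1..m}" for b
      by (rule acts_like_var[where S = "{1..m}" and G = "\<lambda>t. aff_t t (twm t (w k))"])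
        (use that in \<open>auto simp: F_def xi_nonzero\<close>)
    then have "w k = 0 \<or> acts_like (F k) P 0" using assms[of k] unfolding w_def by blast
    then show "pmult P (F k) n = 0"
    proof
      assume "w k = 0"
      then have "F k = (\<lambda>n. 0)" by (simp add: fun_eq_iff F_def tw_zero aff_t_zero)
      then show ?thesis by (simp add: pmult_zero_right)
    qed (rule acts_like_zeroD)
  qed
  finally show ?thesis .
qed

lemma Gam_M: "k \<in> Gam a \<mu> i j \<longleftrightarrow> k \<in> residues_of \<mu> \<and> a i (M k j) \<noteq> 0"
  by (auto simp: Gam_def pw_M)

lemma finite_residues: "finite (residues_of \<mu>)"
  by (simp add: residues_of_def)

lemma mod_residues: "k mod int N \<in> residues_of \<mu>"
  using order_pos by (simp add: residues_of_def)

text \<open>The case of one letter: the word is nonzero only if \<open>k 1\<close> links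
  \<open>i\<close> to \<open>j\<close>, and then the factor for the residue of \<open>k 1\<close>
  vanishes on the line.\<close>

lemma relation_L6: "ev (pmult (\<Prod>k\<in>Gam a \<mu> i j. var 1 - const (\<xi> powi k) * var 0)
    (\<lambda>n. XX s i (n 1) \<star> XX s j (n 0)) n) = 0"
proof -
  let ?P = "\<Prod>k\<in>Gam a \<mu> i j. var 1 - const (\<xi> powi k) * var 0"
  have "ev (pmult ?P (\<lambda>n. foldr (\<lambda>b x. XX s i (n b) \<star> x) [1..<Suc 1] (XX s j (n 0))) n) = 0"
  proof (rule nested_annihilated)
    fix k :: "nat \<Rightarrow> int"
    let ?l = "k 1 mod int N"
    show "foldr (\<lambda>b. br (e s (M (- k b) i))) [1..<Suc 1] (e s j) = 0 \<or>
      (\<forall>F :: (nat \<Rightarrow> int) \<Rightarrow> 'g aff. (\<forall>b\<in>{1..1}. acts_like F (var b) (const (\<xi> powi k b) * var 0)) \<longrightarrow> acts_like F ?P 0)"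
    proof (cases "?l \<in> Gam a \<mu> i j")
      case True
      have "acts_like F ?P 0" if "acts_like F (var 1) (const (\<xi> powi k 1) * var 0)" for F :: "(nat \<Rightarrow> int) \<Rightarrow> 'g aff"
      proof (rule acts_like_zero_prod[OF _ True])
        show "finite (Gam a \<mu> i j)" using finite_residues by (simp add: Gam_def)
        have "\<xi> powi ?l = \<xi> powi k 1" by (rule xi_powi_cong[OF order_pos]) simp
        then show "acts_like F (var 1 - const (\<xi> powi ?l) * var 0) 0"
          using acts_like_linear_factor[OF that] by simp
      qed
      then show ?thesis by simp
    next
      case False
      then have "a (M (- k 1) i) j = 0" using mod_residues by (simp add: Gam_M M_mod a_M_uminus)
      then show ?thesis by (simp add: br_e_commute)
    qed
  qed
  then show ?thesis by simp
qed

lemma relation_L7: "ev (\<Sum>\<sigma>\<in>A. pmult (P \<sigma>)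
    (\<lambda>n. XX s i (n (\<sigma> 1)) \<star> XX s i (n (\<sigma> 2)) \<star> XX s i (n 3)) n) = 0"
proof -
  have "ev (XX s i n1 \<star> XX s i n2 \<star> XX s i n3) = 0" for n1 n2 n3
  proof -
    have "ev (XX s i n1 \<star> XX s i n2 \<star> XX s i n3) =
        aff_t (n3 + (n1 + n2)) (br (twm n1 (e s i)) (br (twm n2 (e s i)) (twm n3 (e s i))))"
      \<comment> \<open>\<open>0\<close> and \<open>1\<close> merely label the two outer currents;
        the innermost one takes the place of the current for \<open>j\<close>.\<close>
      using ev_nested[where bs = "[0, 1 :: nat]" and n = "\<lambda>b. if b = 0 then n1 else n2"
          and s = s and i = i and j = i and ?n0.0 = n3] by simp
    also have "br (twm n1 (e s i)) (br (twm n2 (e s i)) (twm n3 (e s i))) = 0"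
      using nested_br_tw[where bs = "[0, 1 :: nat]" and n = "\<lambda>b. if b = 0 then n1 else n2"
          and x = "e s i" and ?n0.0 = n3 and y = "e s i"]
      by (simp add: E_e orbit_triple_bracket tw_zero)
    finally show ?thesis by (simp add: aff_t_zero)
  qed
  then have "ev (pmult (P \<sigma>) (\<lambda>n. XX s i (n (\<sigma> 1)) \<star> XX s i (n (\<sigma> 2)) \<star> XX s i (n 3)) n) = 0" for \<sigma>
    unfolding pmult_apply_linear[OF clinear_eval_free, symmetric] by (simp only: pmult_zero_right)
  then show ?thesis by (simp only: eval_free_sum sum.neutral_const)
qed

section \<open>The subgroup generated by differences of links, and the stabilizer of an
  index\<close>

abbreviation "Z\<^sub>N \<equiv> integer_mod_group N"

lemma carrier_Z: "carrier Z\<^sub>N = residues_of \<mu>"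
  using order_pos by (simp add: carrier_integer_mod_group residues_of_def)

lemma Hgrp_subgroup: "subgroup (Hgrp a \<mu> i j) Z\<^sub>N"
  unfolding Hgrp_def
  by (rule group.generate_is_subgroup) (use order_pos in \<open>auto simp: carrier_integer_mod_group\<close>)

lemma Hgrp_diff: "k \<in> Gam a \<mu> i j \<Longrightarrow> l \<in> Gam a \<mu> i j \<Longrightarrow> (k - l) mod int N \<in> Hgrp a \<mu> i j"
  unfolding Hgrp_def by (rule generate.incl) blast

text \<open>Lagrange in the additive group of residues: \<open>card (Hgrp a \<mu> i j) * u\<close>
  is divisible by \<open>N\<close>.\<close>

lemma xi_power_card_Hgrp:
  assumes "u \<in> Hgrp a \<mu> i j"
  shows "(\<xi> powi u) ^ card (Hgrp a \<mu> i j) = 1"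
proof -
  let ?H = "Hgrp a \<mu> i j"
  interpret G: group Z\<^sub>N by simp
  interpret K: group "Z\<^sub>N\<lparr>carrier := ?H\<rparr>" by (rule G.subgroup_imp_group[OF Hgrp_subgroup])
  have ord: "order (Z\<^sub>N\<lparr>carrier := ?H\<rparr>) = card ?H" by (simp add: order_def)
  have "u [^]\<^bsub>Z\<^sub>N\<^esub> card ?H = u [^]\<^bsub>Z\<^sub>N\<lparr>carrier := ?H\<rparr>\<^esub> order (Z\<^sub>N\<lparr>carrier := ?H\<rparr>)"
    unfolding ord by (rule G.nat_pow_consistent)
  also have "\<dots> = 0" using K.pow_order_eq_1[of u] assms by simp
  finally have "int N dvd int (card ?H) * u" by (simp add: mod_eq_0_iff_dvd)
  then have "\<xi> powi (u * int (card ?H)) = 1"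
    by (simp add: xi_power_eq_1_iff[OF order_pos] mult.commute)
  then show ?thesis by (simp add: power_int_mult)
qed

text \<open>The stabilizer of \<open>i\<close> has order \<open>dd \<mu> i\<close>. Adding a
  stabilizing residue to a link \<open>k\<close> gives another link, so the stabilizer lies in
  \<open>Hgrp a \<mu> i j\<close>; Lagrange then makes the quotient in \<open>p_poly\<close>
  exact.\<close>

lemma dd_dvd_card_Hgrp:
  assumes k: "k \<in> Gam a \<mu> i j"
  shows "dd \<mu> i dvd card (Hgrp a \<mu> i j)"
proof -
  let ?H = "Hgrp a \<mu> i j" and ?S = "{x \<in> residues_of \<mu>. M x i = i}"
  interpret G: group Z\<^sub>N by simp
  interpret K: group "Z\<^sub>N\<lparr>carrier := ?H\<rparr>" by (rule G.subgroup_imp_group[OF Hgrp_subgroup])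
  have S: "subgroup ?S Z\<^sub>N"
  proof (rule G.subgroupI)
    show "?S \<subseteq> carrier Z\<^sub>N" by (auto simp: carrier_Z)
    show "?S \<noteq> {}" using mod_residues[of 0] M_0 by auto
    show "inv\<^bsub>Z\<^sub>N\<^esub> x \<in> ?S" if x: "x \<in> ?S" for x
    proof -
      have "inv\<^bsub>Z\<^sub>N\<^esub> x = (- x) mod int N" using x by (simp add: carrier_Z)
      moreover have "M (- x) i = i" using x M_inverse(1)[of x i] by simp
      ultimately show ?thesis by (simp add: mod_residues M_mod)
    qed
    show "x \<otimes>\<^bsub>Z\<^sub>N\<^esub> y \<in> ?S" if "x \<in> ?S" "y \<in> ?S" for x y
      using that by (simp add: mod_residues M_mod M_add)
  qed
  have "?S \<subseteq> ?H"
  proof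
    fix x assume x: "x \<in> ?S"
    have "M (- (x + k)) i = M (- k) i"
    proof -
      have "M (- x) i = i" using x M_inverse(1)[of x i] by simp
      moreover have "- (x + k) = - k + - x" by simp
      ultimately show ?thesis by (simp only: M_add)
    qed
    then have "(x + k) mod int N \<in> Gam a \<mu> i j"
      using k by (simp add: Gam_M M_mod mod_residues flip: a_M_uminus)
    from Hgrp_diff[OF this k] have "((x + k) mod int N - k) mod int N \<in> ?H" .
    also have "((x + k) mod int N - k) mod int N = x mod int N" by (simp add: mod_diff_left_eq)
    also have "\<dots> = x" using x by (simp add: residues_of_def)
    finally show "x \<in> ?H" .
  qed
  then have "subgroup ?S (Z\<^sub>N\<lparr>carrier := ?H\<rparr>)" by (rule G.subgroup_incl[OF S Hgrp_subgroup])
  from K.lagrange[OF this, symmetric] have "card ?S dvd order (Z\<^sub>N\<lparr>carrier := ?H\<rparr>)"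
    by (simp only: dvd_triv_right)
  then have "card ?S dvd card ?H" by (simp add: order_def)
  moreover have "card ?S = dd \<mu> i"
  proof -
    let ?c = "int (card (orbit \<mu> i))"
    have N: "int N = ?c * int (dd \<mu> i)" using card_orbit_dd[of i] by (metis of_nat_mult)
    then have c: "0 < ?c" using order_pos by (metis mult_zero_left of_nat_0_less_iff of_nat_0_le_iff order_le_less)
    \<comment> \<open>The stabilizer consists of the multiples of the orbit length in the residues,
      and there are \<open>dd \<mu> i\<close> of them.\<close>
    have "?S = (*) ?c ` {0..<int (dd \<mu> i)}"
    proof (intro equalityI subsetI)
      fix x assume "x \<in> ?S"
      then have "?c dvd x" "0 \<le> x" "x < ?c * int (dd \<mu> i)" using N by (auto simp: M_fix_iff residues_of_def)
      then obtain t where "x = ?c * t" by blast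
      with \<open>0 \<le> x\<close> \<open>x < _\<close> c show "x \<in> (*) ?c ` {0..<int (dd \<mu> i)}"
        by (auto simp: zero_le_mult_iff)
    next
      fix x assume "x \<in> (*) ?c ` {0..<int (dd \<mu> i)}"
      then obtain t where "x = ?c * t" "t \<in> {0..<int (dd \<mu> i)}" by (rule imageE)
      then show "x \<in> ?S" using c N by (auto simp: M_fix_iff residues_of_def)
    qed
    moreover have "inj_on ((*) ?c) {0..<int (dd \<mu> i)}" using c by (intro inj_onI) (metis less_irrefl mult_cancel_left)
    ultimately show ?thesis by (simp only: card_image) simp
  qed
  ultimately show ?thesis by simp
qed

text \<open>If \<open>i\<close> and \<open>j\<close> shared an orbit, the sum in
  \<open>folded\<close> would be the one that LC1 makes positive.\<close>

lemma folded_neg_distinct_orbits: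
  assumes "folded a \<mu> i j < 0"
  shows "M x i \<noteq> j"
proof
  assume "M x i = j"
  then have "orbit \<mu> i = orbit \<mu> j" using orbit_M[of x i] by simp
  then have "(\<Sum>p\<in>orbit \<mu> i. a p j) > 0"
    using lc1 unfolding LC1_def by simp
  then show False using assms by (simp add: folded_def ss_def split: if_splits)
qed

text \<open>With \<open>M k j\<close> as base point, LC2 says that all nonzero entries along the
  orbit equal this one. So the minimum in \<open>mm\<close> is attained at every link, and
  \<open>mm\<close> is the Serre exponent there.\<close>

lemma linked_value:
  assumes orb: "\<And>x. M x i \<noteq> j" and nz: "a i (M k j) \<noteq> 0"
  shows "nat (1 - a i (M k j)) = mm a \<mu> i j"
proof -
  let ?v = "a i (M k j)"
  have ne: "i \<noteq> M l j" for l using orb[of "- l"] M_inverse(1)[of l j] by auto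
  then have "i \<notin> orbit \<mu> (M k j)" by (auto simp: orbit_eq M_add[symmetric])
  moreover have "?v < 0" using a_offdiag[OF ne[of k]] nz by simp
  ultimately have lc: "a i (pw \<mu> l (M k j)) = ?v" if "l \<in> Gam a \<mu> i (M k j)" for l
    using lc2 that unfolding LC2_def by blast
  have "?v \<le> a i (M l j)" for l
  proof (cases "a i (M l j) = 0")
    case False
    let ?d = "(l - k) mod int N"
    have "M ?d (M k j) = M l j" by (simp add: M_mod flip: M_add)
    moreover from this False have "?d \<in> Gam a \<mu> i (M k j)" by (simp add: Gam_M mod_residues)
    ultimately have "a i (M l j) = ?v" using lc[of ?d] pw_M[OF mod_residues] by simp
    then show ?thesis by simp
  qed (use \<open>?v < 0\<close> in simp)
  moreover have "?v \<in> (\<lambda>k. a i (pw \<mu> k j)) ` residues_of \<mu>"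
    by (rule image_eqI[OF _ mod_residues[of k]]) (simp add: pw_M[OF mod_residues] M_mod)
  ultimately have "Min ((\<lambda>k. a i (pw \<mu> k j)) ` residues_of \<mu>) = ?v"
    using finite_residues by (intro Min_eqI) (auto simp: pw_M)
  then show ?thesis by (simp add: mm_def)
qed

text \<open>Provides the first letter with which \<open>relation_L8\<close> compares all
  others.\<close>

lemma mm_pos:
  assumes "\<And>x. M x i \<noteq> j"
  shows "0 < mm a \<mu> i j"
proof -
  have "i \<noteq> j" using assms[of 0] by (simp add: M_0)
  then have "a i j \<le> 0" by (rule a_offdiag)
  moreover have "Min ((\<lambda>k. a i (pw \<mu> k j)) ` residues_of \<mu>) \<le> a i j"
    by (rule Min_le) (use finite_residues mod_residues[of 0] in \<open>auto intro!: image_eqI[where x = 0] simp: pw_M M_0\<close>)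
  ultimately show ?thesis by (simp add: mm_def)
qed

text \<open>Adjacent indices make the \<open>d\<close>-th powers of the two points opposite, a zero
  of the first factor. Different linked indices make their \<open>card H\<close>-th powers equal but
  their \<open>d\<close>-th powers different, so the geometric sum, the quotient of these two
  differences, is 0.\<close>

lemma p_poly_vanish:
  assumes F: "acts_like F (var b) (const (\<xi> powi k) * var 0)" "acts_like F (var c) (const (\<xi> powi l) * var 0)"
    and ne: "M (- k) i \<noteq> M (- l) i"
    and link: "a (M (- k) i) (M (- l) i) \<noteq> 0 \<or> a i (M k j) \<noteq> 0 \<and> a i (M l j) \<noteq> 0"
  shows "acts_like F (p_poly a \<mu> i j (var b) (var c)) 0"
proof (rule acts_like_p_poly[OF F refl refl refl])
  let ?d = "dd \<mu> i" and ?H = "Hgrp a \<mu> i j"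
  let ?q = "card ?H div ?d" and ?z = "(\<xi> powi k) ^ dd \<mu> i" and ?y = "(\<xi> powi l) ^ dd \<mu> i"
  let ?sum = "\<Sum>t<?q. (\<xi> powi k) ^ (?d * t) * (\<xi> powi l) ^ (?d * (?q - 1 - t))"
  have z: "?z = (\<xi> powi (k - l)) ^ ?d * ?y"
    by (simp flip: power_mult_distrib xi_powi_add)
  have fix_diff: "M (k - l) i \<noteq> i"
  proof
    assume "M (k - l) i = i"
    then have "M (- k) (M (k - l) i) = M (- k) i" by simp
    then show False using ne by (simp flip: M_add)
  qed
  have y: "?y \<noteq> 0" by (simp add: xi_nonzero)
  from link show "(?z + ?y) ^ (ss a \<mu> i - 1) * ?sum = 0"
  proof
    assume adj: "a (M (- k) i) (M (- l) i) \<noteq> 0"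
    then have "a i (M (k - l) i) \<noteq> 0" by (simp add: a_M_uminus flip: M_add)
    then have "a (M (k - l) i) i \<noteq> 0" by (metis a_zero)
    then have "(\<xi> powi (k - l)) ^ ?d = -1" by (rule orbit_neighbour_involutive(2)[OF fix_diff])
    then have "?z + ?y = 0" using z by simp
    \<comment> \<open>The exponent of the first factor is \<open>ss a \<mu> i - 1\<close>; it has to
      be 1 for that zero to count.\<close>
    moreover have "ss a \<mu> i = 2"
      using adj ne by (auto simp: ss_def orbit_eq)
    ultimately show ?thesis by simp
  next
    assume linked: "a i (M k j) \<noteq> 0 \<and> a i (M l j) \<noteq> 0"
    let ?k = "k mod int N" and ?l = "l mod int N"
    have G: "?k \<in> Gam a \<mu> i j" "?l \<in> Gam a \<mu> i j" using linked by (simp_all add: Gam_M M_mod mod_residues)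
    have dvd: "?d dvd card ?H" by (rule dd_dvd_card_Hgrp[OF G(1)])
    have "\<xi> powi ((?k - ?l) mod int N) = \<xi> powi (k - l)"
      by (rule xi_powi_cong[OF order_pos]) (simp add: mod_diff_eq)
    then have one: "(\<xi> powi (k - l)) ^ card ?H = 1"
      using xi_power_card_Hgrp[OF Hgrp_diff[OF G]] by simp
    have "\<xi> powi k = \<xi> powi (k - l) * \<xi> powi l" by (simp flip: xi_powi_add)
    then have "(\<xi> powi k) ^ card ?H = (\<xi> powi l) ^ card ?H" by (simp add: power_mult_distrib one)
    moreover have "?d * ?q = card ?H" using dvd by simp
    ultimately have "?z ^ ?q = ?y ^ ?q" by (simp flip: power_mult)
    moreover have "?sum = (\<Sum>t<?q. ?y ^ (?q - Suc t) * ?z ^ t)"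
      by (simp only: power_mult) (simp add: mult.commute)
    ultimately have "(?z - ?y) * ?sum = 0" using power_diff_sumr2[of ?z ?q ?y] by simp
    moreover have "?z \<noteq> ?y" using z y fix_diff xi_dd[of "k - l" i] by auto
    ultimately show ?thesis by simp
  qed
qed

lemma br_foldr_commute:
  assumes "br x y = 0" "\<And>b. b \<in> set bs \<Longrightarrow> br x (f b) = 0"
  shows "br x (foldr (\<lambda>b. br (f b)) bs y) = 0"
  using assms by (induction bs) (simp_all add: br_leibniz[of x] br_zero_left br_zero_right)

lemma relation_L8:
  assumes neg: "folded a \<mu> i j < 0" and m: "m = mm a \<mu> i j"
  shows "ev (pmult ((\<Prod>(b, c)\<in>{(b, c). 1 \<le> b \<and> b < c \<and> c \<le> m}. p_poly a \<mu> i j (var b) (var c)) * Q)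
    (\<lambda>n. foldr (\<lambda>b x. XX s i (n b) \<star> x) [1..<Suc m] (XX s j (n 0))) n) = 0"
proof (rule nested_annihilated)
  fix k :: "nat \<Rightarrow> int"
  let ?pairs = "{(b, c). 1 \<le> b \<and> b < c \<and> c \<le> m}"
  let ?P = "\<Prod>(b, c)\<in>?pairs. p_poly a \<mu> i j (var b) (var c)"
  let ?word = "foldr (\<lambda>b. br (e s (M (- k b) i))) [1..<Suc m] (e s j)"
  let ?kills = "\<forall>F :: (nat \<Rightarrow> int) \<Rightarrow> 'g aff. (\<forall>b\<in>{1..m}. acts_like F (var b) (const (\<xi> powi k b) * var 0)) \<longrightarrow> acts_like F (?P * Q) 0"
  have orb: "M x i \<noteq> j" for x by (rule folded_neg_distinct_orbits[OF neg])
  have "finite ?pairs" by (rule finite_subset[of _ "{1..m} \<times> {1..m}"]) auto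
  then have kill: ?kills
    if bc: "1 \<le> b" "b < c" "c \<le> m" and ne: "M (- k b) i \<noteq> M (- k c) i"
      and link: "a (M (- k b) i) (M (- k c) i) \<noteq> 0 \<or> a i (M (k b) j) \<noteq> 0 \<and> a i (M (k c) j) \<noteq> 0" for b c
  proof (intro allI impI)
    fix F :: "(nat \<Rightarrow> int) \<Rightarrow> 'g aff"
    assume F: "\<forall>b\<in>{1..m}. acts_like F (var b) (const (\<xi> powi k b) * var 0)"
    have "acts_like F (p_poly a \<mu> i j (var b) (var c)) 0"
      by (rule p_poly_vanish[OF _ _ ne link]) (use F bc in auto)
    then have "acts_like F ?P 0"
      using bc by (intro acts_like_zero_prod[OF \<open>finite ?pairs\<close>, of "(b, c)"]) auto
    then show "acts_like F (?P * Q) 0" by (rule acts_like_zero_mult(1))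
  qed
  show "?word = 0 \<or> ?kills"
  proof (rule disjCI)
    \<comment> \<open>From here on no pair of letters satisfies the hypotheses of
      \<open>kill\<close>.\<close>
    assume alive: "\<not> ?kills"
    show "?word = 0"
    proof (cases "\<exists>b\<in>set [1..<Suc m]. a i (M (k b) j) = 0")
      case False
      then have linked: "a i (M (k b) j) \<noteq> 0" if "1 \<le> b" "b \<le> m" for b using that by auto
      have m1: "1 \<le> m" using mm_pos[OF orb] m by simp
      \<comment> \<open>All letters are linked to \<open>j\<close>, so any letter different from the
        first would trigger \<open>kill\<close>.\<close>
      have eq: "M (- k b) i = M (- k 1) i" if "1 \<le> b" "b \<le> m" for b
      proof (rule ccontr)
        assume ne: "M (- k b) i \<noteq> M (- k 1) i"
        then have "1 < b" using that by (cases "b = 1") auto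
        have ?kills
          by (rule kill[OF order_refl \<open>1 < b\<close> that(2) ne[symmetric]])
            (intro disjI2 conjI linked order_refl m1 that)
        with alive show False ..
      qed
      define i' where "i' = M (- k 1) i"
      have m': "nat (1 - a i' j) = m"
        using linked_value[OF orb linked[OF order_refl m1]] m by (simp add: a_M_uminus i'_def)
      have eq': "M (- k b) i = i'" if "b \<in> set [1..<Suc m]" for b
        unfolding i'_def by (rule eq) (use that in auto)
      have "?word = foldr (\<lambda>_. br (e s i')) [1..<Suc m] (e s j)"
        by (rule foldr_cong[OF refl refl]) (simp only: eq')
      also have "\<dots> = (br (e s i') ^^ m) (e s j)" by (simp only: foldr_same length_upt diff_Suc_1)
      also have "\<dots> = 0"
        using serre[OF orb, of "- k 1" s] unfolding i'_def[symmetric] m' .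
      finally show ?thesis .
    next
      case True
      \<comment> \<open>\<open>foldr\<close> applies the last letters first, so the last unlinked
        position is the innermost one and all letters in \<open>ys\<close> are linked.\<close>
      then obtain xs b ys where split: "[1..<Suc m] = xs @ b # ys" and b: "a i (M (k b) j) = 0"
        and ys: "\<forall>c\<in>set ys. a i (M (k c) j) \<noteq> 0"
        by (rule split_list_last_propE)
      have "br (e s (M (- k b) i)) (foldr (\<lambda>c. br (e s (M (- k c) i))) ys (e s j)) = 0"
      proof (rule br_foldr_commute)
        show "br (e s (M (- k b) i)) (e s j) = 0" using b by (simp add: br_e_commute a_M_uminus)
        fix c assume c: "c \<in> set ys"
        have "sorted_wrt (<) (xs @ b # ys)" by (simp only: split[symmetric] sorted_wrt_upt)
        then have "b < c" using c by (simp add: sorted_wrt_append)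
        have "set (xs @ b # ys) = {1..m}" by (simp only: split[symmetric]) auto
        then have "b \<in> {1..m}" "c \<in> {1..m}" using c by auto
        \<comment> \<open>One of the two letters is linked to \<open>j\<close> and the other is
          not.\<close>
        have ne: "M (- k b) i \<noteq> M (- k c) i" using b ys c by (auto simp flip: a_M_uminus)
        have "a (M (- k b) i) (M (- k c) i) = 0"
        proof (rule ccontr)
          assume adj: "a (M (- k b) i) (M (- k c) i) \<noteq> 0"
          have ?kills
            by (rule kill[OF _ \<open>b < c\<close> _ ne disjI1[OF adj]])
              (use \<open>b \<in> {1..m}\<close> \<open>c \<in> {1..m}\<close> in simp_all)
          with alive show False ..
        qed
        then show "br (e s (M (- k b) i)) (e s (M (- k c) i)) = 0" by (rule br_e_commute)
      qed
      moreover have "foldr (\<lambda>c. br (e s (M (- k c) i))) xs 0 = 0"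
        by (induction xs) (simp_all add: br_zero_right)
      ultimately show ?thesis unfolding split by simp
    qed
  qed
qed

lemma hat_relator_zero:
  assumes "f \<in> hat_relators a r \<mu> \<alpha> av mh"
  shows "ev f = 0"
  using assms
proof cases
  case (L_add h h')
  then show ?thesis
    by (simp add: ev_simps fixed_cartan_add clinear_add[OF clinear_H] aff_t_add)
next
  case (L_scale h c)
  then show ?thesis
    by (simp add: ev_simps fixed_cartan_scale clinear_scale[OF clinear_H] aff_t_scale)
next
  case (L0_H i n)
  then show ?thesis
    using tw_mg[of n "H (av i)"] by (simp add: ev_simps mg_H mh_av r_\<mu> aff_t_scale mult.commute cscale_cscale)
next
  case (L0_L i)
  have sum: "(\<Sum>k\<in>residues_of \<mu>. av (pw \<mu> k i)) = (\<Sum>k\<in>residues_of \<mu>. ipow N mh k (av i))"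
    by (intro sum.cong refl) (simp add: pw_M mh_pow_av)
  show ?thesis
    unfolding L0_L sum
    by (simp add: ev_simps fixed_cartan_scale sum_orbit_fixed clinear_scale[OF clinear_H] aff_t_scale tw_0_H)
next
  case (L1_DL h)
  then show ?thesis by (simp add: ev_simps aff_br_d_t aff_t_zero)
next
  case (L1_DH i m)
  then show ?thesis by (simp add: ev_simps aff_br_d_t aff.br_scale_right aff_t_scale mult.commute cscale_cscale)
next
  case (L1_LH h i m)
  then show ?thesis
    by (simp add: ev_simps aff_br_t_t br_H_tw_H aff.br_scale_right aff_t_zero)
next
  case (L1_LL h h')
  then show ?thesis by (simp add: ev_simps aff_br_t_t br_H_H aff_t_zero)
next
  case (L2_HH i m j n)
  then show ?thesis
    using relation_L2[of i m j n]
    by (simp only: eval_free_diff eval_free_sum eval_free_scale aff.eval_free_fmult ev_CC diff_self)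
next
  case (L2_C f)
  then show ?thesis by (simp add: ev_simps aff.br_scale_left aff_br_c_left)
next
  case (L3_DX s i m)
  then show ?thesis by (simp add: ev_simps aff_br_d_t aff_t_scale)
next
  case (L3_LX h s j n)
  then show ?thesis by (simp add: ev_simps aff_br_t_t br_fixed_tw_e aff_t_scale)
next
  case (L4 i m s j n)
  then show ?thesis
    using relation_L4[of i m s j n]
    by (simp only: eval_free_diff eval_free_sum eval_free_scale aff.eval_free_fmult diff_self)
next
  case (L5 i m j n)
  then show ?thesis
    using relation_L5[of i m j n]
    by (simp only: eval_free_diff eval_free_add eval_free_sum eval_free_scale aff.eval_free_fmult ev_CC diff_self)
next
  case (L6_X s i n)
  then show ?thesis by (simp add: ev_simps tw_\<mu>_e aff_t_scale)
next
  case (L6_XX i j s n)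
  then show ?thesis using relation_L6 by simp
next
  case (L7 i s n)
  show ?thesis unfolding L7(1) by (rule relation_L7)
next
  case (L8 i j m s n)
  show ?thesis unfolding L8(1) by (rule relation_L8[OF L8(2,3)])
qed

end

section \<open>The image of the homomorphism\<close>

lemma (in lie_algebra) br_span_closed:
  assumes closed: "\<And>x y. x \<in> S \<Longrightarrow> y \<in> S \<Longrightarrow> br x y \<in> cvs.span S"
    and x: "x \<in> cvs.span S" and y: "y \<in> cvs.span S"
  shows "br x y \<in> cvs.span S"
proof -
  have sub: "cvs.subspace {z. br x z \<in> cvs.span S}" "cvs.subspace {z. br z x \<in> cvs.span S}" for x
    by (auto simp: cvs.subspace_def br_bilinear intro: cvs.span_zero cvs.span_add cvs.span_scale)
  have 1: "br x z \<in> cvs.span S" if "x \<in> S" "z \<in> cvs.span S" for x z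
  proof -
    have "cvs.span S \<subseteq> {z. br x z \<in> cvs.span S}"
      by (rule cvs.span_minimal[OF _ sub(1)]) (use closed that in auto)
    then show ?thesis using that by auto
  qed
  have "cvs.span S \<subseteq> {z. br z y \<in> cvs.span S}"
    by (rule cvs.span_minimal[OF _ sub(2)]) (use 1 y in auto)
  then show ?thesis using x by auto
qed

context finite_order_automorphism
begin

abbreviation "g' \<equiv> derived_alg br"

lemma subspace_derived: "cvs.subspace g'"
  unfolding derived_alg_def by (rule cvs.subspace_span)

lemma br_derived: "br x y \<in> g'"
  unfolding derived_alg_def by (rule cvs.span_base) auto

lemma subspace_tw_image: "cvs.subspace (twm m ` g')"
proof -
  interpret T: Vector_Spaces.linear cscale cscale "twm m" by (rule clinear_tw)
  show ?thesis by (rule T.subspace_image[OF subspace_derived])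
qed

lemma eigenvector_eq_tw:
  assumes "mg x = (\<xi> powi m) *\<^sub>C x"
  shows "x = twm m ((1 / of_nat N) *\<^sub>C x)"
  using order_pos by (simp add: tw_scale tw_eigenvector[OF assms] cscale_cscale cscale_one)

end

context linking_twisted_kac_moody
begin

section \<open>The target as the span of homogeneous elements, closed under the bracket\<close>

abbreviation "T \<equiv> twisted_aff \<mu> W br \<kappa> mg"

definition twisted_spanning :: "'g aff set"
  where "twisted_spanning = {aff_t m (twm m x) | m x. x \<in> g'} \<union> {aff_t 0 (twm 0 (H w)) | w. w \<in> W} \<union> {aff_c, aff_d}"

text \<open>Leaves \<open>w\<close> as the only unknown: \<open>f\<close> is recovered by
  subtraction, so the subspace properties reduce to those of \<open>W\<close> and of the images of
  \<open>twm m\<close>.\<close>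

lemma twisted_aff_iff: "p \<in> T \<longleftrightarrow>
    (\<exists>w\<in>W. \<forall>m. Poly_Mapping.lookup (fst p - Poly_Mapping.single 0 (twm 0 (H w))) m \<in> twm m ` g')"
proof
  assume "p \<in> T"
  then obtain f y u v w where "p = (f + Poly_Mapping.single 0 y, u, v)" "w \<in> W" "y = twm 0 (H w)"
    "\<forall>m. Poly_Mapping.lookup f m \<in> twm m ` g'"
    unfolding twisted_aff_def by blast
  then show "\<exists>w\<in>W. \<forall>m. Poly_Mapping.lookup (fst p - Poly_Mapping.single 0 (twm 0 (H w))) m \<in> twm m ` g'"
    by (intro bexI[of _ w]) simp_all
next
  assume "\<exists>w\<in>W. \<forall>m. Poly_Mapping.lookup (fst p - Poly_Mapping.single 0 (twm 0 (H w))) m \<in> twm m ` g'"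
  then obtain w where w: "w \<in> W"
    "\<forall>m. Poly_Mapping.lookup (fst p - Poly_Mapping.single 0 (twm 0 (H w))) m \<in> twm m ` g'" by blast
  let ?f = "fst p - Poly_Mapping.single 0 (twm 0 (H w))"
  have "p = (?f + Poly_Mapping.single 0 (twm 0 (H w)), fst (snd p), snd (snd p))" by simp
  then show "p \<in> T" using w unfolding twisted_aff_def by blast
qed

lemma subspace_T: "cvs.subspace T"
proof -
  note sub = subspace_tw_image
  show ?thesis
    unfolding cvs.subspace_def
  proof (intro conjI ballI allI)
    show "0 \<in> T" unfolding twisted_aff_iff
      by (intro bexI[of _ 0] allI)
        (auto simp: clinear_zero[OF clinear_H] tw_zero cvs.subspace_0[OF sub] cvs.subspace_0[OF W_subspace])
  next
    fix p q assume "p \<in> T" "q \<in> T"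
    then obtain w v where w: "w \<in> W" "\<And>m. Poly_Mapping.lookup (fst p - Poly_Mapping.single 0 (twm 0 (H w))) m \<in> twm m ` g'"
      and v: "v \<in> W" "\<And>m. Poly_Mapping.lookup (fst q - Poly_Mapping.single 0 (twm 0 (H v))) m \<in> twm m ` g'"
      unfolding twisted_aff_iff by blast
    have "fst (p + q) - Poly_Mapping.single 0 (twm 0 (H (w + v))) =
        (fst p - Poly_Mapping.single 0 (twm 0 (H w))) + (fst q - Poly_Mapping.single 0 (twm 0 (H v)))"
      by (simp add: clinear_add[OF clinear_H] tw_add single_add)
    then show "p + q \<in> T"
      unfolding twisted_aff_iff using w v
      by (intro bexI[of _ "w + v"] allI)
        (simp_all only: lookup_add cvs.subspace_add[OF sub] cvs.subspace_add[OF W_subspace])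
  next
    fix c p assume "p \<in> T"
    then obtain w where w: "w \<in> W" "\<And>m. Poly_Mapping.lookup (fst p - Poly_Mapping.single 0 (twm 0 (H w))) m \<in> twm m ` g'"
      unfolding twisted_aff_iff by blast
    have "fst (c *\<^sub>C p) - Poly_Mapping.single 0 (twm 0 (H (c *\<^sub>C w))) =
        c *\<^sub>C (fst p - Poly_Mapping.single 0 (twm 0 (H w)))"
      by (simp add: clinear_scale[OF clinear_H] tw_scale cscale_prod_def cvs.scale_right_diff_distrib
          clinear_scale[OF clinear_single[OF clinear_id]])
    then show "c *\<^sub>C p \<in> T"
      unfolding twisted_aff_iff using w
      by (intro bexI[of _ "c *\<^sub>C w"] allI)
        (simp_all only: lookup_cscale cvs.subspace_scale[OF sub] cvs.subspace_scale[OF W_subspace])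
  qed
qed

lemma twisted_aff_eq_span: "T = cvs.span twisted_spanning"
proof
  show "T \<subseteq> cvs.span twisted_spanning"
  proof
    fix p assume "p \<in> T"
    then obtain f y u v where p: "p = (f + Poly_Mapping.single 0 y, u, v)" and y: "y \<in> (\<lambda>w. twm 0 (H w)) ` W"
      and f: "\<And>m. Poly_Mapping.lookup f m \<in> twm m ` g'"
      unfolding twisted_aff_def by blast
    have "p = (f, u, v) + aff_t 0 y" by (simp add: p aff_t_def)
    also have "(f, u, v) = (\<Sum>m\<in>Poly_Mapping.keys f. aff_t m (Poly_Mapping.lookup f m)) + u *\<^sub>C aff_c + v *\<^sub>C aff_d"
      by (rule aff_decomp)
    also have "\<dots> + aff_t 0 y \<in> cvs.span twisted_spanning"
    proof (intro cvs.span_add cvs.span_sum cvs.span_scale cvs.span_base)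
      show "aff_t m (Poly_Mapping.lookup f m) \<in> twisted_spanning" for m
        using f[of m] by (auto simp: twisted_spanning_def)
    qed (use y in \<open>auto simp: twisted_spanning_def\<close>)
    finally show "p \<in> cvs.span twisted_spanning" .
  qed
  have zero: "0 \<in> twm m ` g'" for m by (rule cvs.subspace_0[OF subspace_tw_image])
  have W0: "0 \<in> W" by (rule cvs.subspace_0[OF W_subspace])
  have H0: "twm 0 (H 0) = 0" by (simp add: clinear_zero[OF clinear_H] tw_zero)
  have "aff_t m (twm m x) \<in> T" if "x \<in> g'" for m x
    unfolding twisted_aff_iff using that zero
    by (intro bexI[OF _ W0]) (auto simp: H0 aff_t_def lookup_single when_def)
  moreover have "aff_t 0 (twm 0 (H w)) \<in> T" if "w \<in> W" for w
    unfolding twisted_aff_iff by (intro bexI[OF _ that]) (simp add: aff_t_def zero)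
  moreover have "aff_c \<in> T" "aff_d \<in> T"
    unfolding twisted_aff_iff by (auto intro!: bexI[OF _ W0] simp: H0 aff_c_def aff_d_def zero)
  ultimately show "cvs.span twisted_spanning \<subseteq> T"
    by (intro cvs.span_minimal subspace_T) (auto simp: twisted_spanning_def)
qed

lemma twisted_aff_br_closed:
  assumes "p \<in> T" "q \<in> T"
  shows "abr p q \<in> T"
  unfolding twisted_aff_eq_span
proof (rule aff.br_span_closed)
  have c: "aff_c \<in> cvs.span twisted_spanning" by (rule cvs.span_base) (simp add: twisted_spanning_def)
  \<comment> \<open>Arbitrary \<open>x\<close> and \<open>y\<close> are allowed, which also covers
    the generators from \<open>W\<close>: any bracket lies in \<open>g'\<close>, and being an
    eigenvector for \<open>\<xi>^(m + n)\<close> it is the twisted sum of \<open>1/N\<close> times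
    itself.\<close>
  have tt: "abr (aff_t m (twm m x)) (aff_t n (twm n y)) \<in> cvs.span twisted_spanning" for m n x y
  proof -
    let ?z = "br (twm m x) (twm n y)"
    have "mg ?z = (\<xi> powi (m + n)) *\<^sub>C ?z"
      by (simp add: mg_br mg_tw br_scale_left br_scale_right cscale_cscale xi_powi_add mult.commute)
    then have z: "?z = twm (m + n) ((1 / of_nat N) *\<^sub>C ?z)" by (rule eigenvector_eq_tw)
    have "(1 / of_nat N) *\<^sub>C ?z \<in> g'" by (intro cvs.subspace_scale[OF subspace_derived] br_derived)
    then have "aff_t (m + n) (twm (m + n) ((1 / of_nat N) *\<^sub>C ?z)) \<in> twisted_spanning"
      unfolding twisted_spanning_def by blast
    then have "aff_t (m + n) ?z \<in> twisted_spanning" unfolding z[symmetric] .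
    then show ?thesis unfolding aff_br_t_t by (intro cvs.span_add cvs.span_scale c cvs.span_base)
  qed
  have dt: "abr aff_d (aff_t n (twm n x)) \<in> cvs.span twisted_spanning"
    "abr (aff_t n (twm n x)) aff_d \<in> cvs.span twisted_spanning"
    if "aff_t n (twm n x) \<in> twisted_spanning" for n x
    unfolding aff_br_d_t aff_br_t_d aff_t_scale
    by (intro cvs.span_neg cvs.span_scale cvs.span_base that)+
  show "abr s t \<in> cvs.span twisted_spanning" if s: "s \<in> twisted_spanning" and t: "t \<in> twisted_spanning" for s t
  proof -
    have cases: "(\<exists>m x. u = aff_t m (twm m x)) \<or> u = aff_c \<or> u = aff_d" if "u \<in> twisted_spanning" for u
      using that unfolding twisted_spanning_def by blast
    show ?thesis
      using cases[OF s] cases[OF t] s t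
      by (elim disjE exE) (simp_all add: tt dt aff_br_c_left aff_br_c_right aff_br_d_d cvs.span_zero)
  qed
qed (use assms twisted_aff_eq_span in auto)

lemma e_derived: "e s i \<in> g'"
proof -
  have "sgnc s * 2 \<noteq> 0" by (cases s) auto
  then have "e s i = (1 / (sgnc s * 2)) *\<^sub>C br (H (av i)) (e s i)"
    by (simp add: br_H_e \<alpha>_av a_diag cscale_cscale cscale_one)
  then show ?thesis using cvs.subspace_scale[OF subspace_derived br_derived] by metis
qed

lemma H_coroot_derived: "y \<in> coroot_span \<Longrightarrow> H y \<in> g'"
proof -
  have "H (av i) \<in> g'" for i using br_derived[of "e Plus i" "e Minus i"] by (simp add: br_e_f)
  moreover have "cvs.subspace {y. H y \<in> g'}"
    by (auto simp: cvs.subspace_def clinear_zero[OF clinear_H] clinear_add[OF clinear_H] clinear_scale[OF clinear_H]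
        intro: cvs.subspace_0[OF subspace_derived] cvs.subspace_add[OF subspace_derived] cvs.subspace_scale[OF subspace_derived])
  ultimately have "coroot_span \<subseteq> {y. H y \<in> g'}" by (intro cvs.span_minimal) auto
  then show "y \<in> coroot_span \<Longrightarrow> H y \<in> g'" by auto
qed

lemma gen_image_in_T:
  assumes "x \<in> hat_gens mh"
  shows "gen_image x \<in> T"
proof -
  have base: "aff_t m (c *\<^sub>C twm m y) \<in> T" if "y \<in> g'" for m c y
    unfolding aff_t_scale twisted_aff_eq_span
    by (intro cvs.span_scale cvs.span_base) (use that in \<open>auto simp: twisted_spanning_def\<close>)
  have W: "aff_t 0 (twm 0 (H w)) \<in> T" if "w \<in> W" for w
    unfolding twisted_aff_eq_span by (rule cvs.span_base) (use that in \<open>auto simp: twisted_spanning_def\<close>)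
  have cd: "aff_c \<in> T" "aff_d \<in> T"
    unfolding twisted_aff_eq_span by (auto intro!: cvs.span_base simp: twisted_spanning_def)
  show ?thesis
  proof (cases x)
    case (GL h)
    \<comment> \<open>The coroot part of \<open>h\<close> lands in the summand from
      \<open>g'\<close>, the part in \<open>W\<close> in the other one.\<close>
    obtain y w where y: "y \<in> coroot_span" and w: "w \<in> W" and h: "h = y + w" using W_sum by blast
    have "aff_t 0 ((1 / of_nat N) *\<^sub>C twm 0 (H y)) + (1 / of_nat N) *\<^sub>C aff_t 0 (twm 0 (H w)) \<in> T"
      by (intro cvs.subspace_add[OF subspace_T] cvs.subspace_scale[OF subspace_T] base W H_coroot_derived y w)
    then show ?thesis
      by (simp add: GL gen_image_def h clinear_add[OF clinear_H] tw_add cscale_add_right aff_t_add aff_t_scale)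
  next
    case (GH i m)
    have "H (av i) \<in> g'" by (intro H_coroot_derived cvs.span_base) simp
    then show ?thesis by (simp add: GH gen_image_def base)
  next
    case (GX s i m)
    then show ?thesis using base[OF e_derived, of m 1] by (simp add: gen_image_def cscale_one)
  qed (simp_all add: gen_image_def cd cvs.subspace_scale[OF subspace_T])
qed

text \<open>Letters \<open>KH h\<close> are left out: for general \<open>h\<close> the generators
  provide only degree 0. Coroots are still covered, as brackets of \<open>e Plus i\<close> and
  \<open>e Minus i\<close>.\<close>

definition e_words :: "'g set"
  where "e_words = {eval_word br \<kappa> t | t. set_magma t \<subseteq> {KE s i | s i. True}}"

lemma e_words_br: "x \<in> cvs.span e_words \<Longrightarrow> y \<in> cvs.span e_words \<Longrightarrow> br x y \<in> cvs.span e_words"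
proof (rule br_span_closed)
  fix x y assume "x \<in> e_words" "y \<in> e_words"
  then obtain t u where "x = eval_word br \<kappa> t" "set_magma t \<subseteq> {KE s i | s i. True}"
    "y = eval_word br \<kappa> u" "set_magma u \<subseteq> {KE s i | s i. True}"
    unfolding e_words_def by blast
  then have "br x y = eval_word br \<kappa> (Node t u) \<and> set_magma (Node t u) \<subseteq> {KE s i | s i. True}" by simp
  then show "br x y \<in> cvs.span e_words" by (intro cvs.span_base) (unfold e_words_def, blast)
qed

lemma e_words_H: "x \<in> cvs.span e_words \<Longrightarrow> br (H h) x \<in> cvs.span e_words"
proof -
  have "br (H h) (eval_word br \<kappa> t) \<in> cvs.span e_words" if "set_magma t \<subseteq> {KE s i | s i. True}" for t
    using that
  proof (induction t)
    case (Letter x)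
    then obtain s i where x: "x = KE s i" by auto
    have "e s i \<in> e_words" unfolding e_words_def by (rule CollectI, rule exI[of _ "Letter (KE s i)"]) simp
    then show ?case by (simp add: x br_H_e cvs.span_scale cvs.span_base)
  next
    case (Node t u)
    then have "eval_word br \<kappa> t \<in> cvs.span e_words" "eval_word br \<kappa> u \<in> cvs.span e_words"
      by (auto intro!: cvs.span_base simp: e_words_def)
    then show ?case using Node by (simp add: br_leibniz[of "H h"] cvs.span_add e_words_br)
  qed
  then have "e_words \<subseteq> {x. br (H h) x \<in> cvs.span e_words}" by (auto simp: e_words_def)
  moreover have "cvs.subspace {x. br (H h) x \<in> cvs.span e_words}"
    by (auto simp: cvs.subspace_def br_bilinear intro: cvs.span_zero cvs.span_add cvs.span_scale)
  ultimately show "x \<in> cvs.span e_words \<Longrightarrow> br (H h) x \<in> cvs.span e_words"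
    using cvs.span_minimal by blast
qed

text \<open>Every element is a Cartan element modulo the span of \<open>e_words\<close>. The Cartan
  subalgebra is abelian and stabilizes that span, so every bracket lies in the span.\<close>

lemma derived_subset_e_words: "g' \<subseteq> cvs.span e_words"
proof -
  let ?S = "cvs.span e_words"
  let ?D = "{x. \<exists>h. x - H h \<in> ?S}"
  have mem: "x \<in> ?D \<longleftrightarrow> (\<exists>h. x - H h \<in> ?S)" for x
    by simp
  have br_D: "br x y \<in> ?S" if x: "x \<in> ?D" and y: "y \<in> ?D" for x y
  proof -
    obtain h k where hk: "x - H h \<in> ?S" "y - H k \<in> ?S" using x y by blast
    define u v where "u = x - H h" and "v = y - H k"
    then have u: "u \<in> ?S" "v \<in> ?S" "x = u + H h" "y = v + H k" using hk by simp_all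
    then have "br x y = br u v + - br (H k) u + br (H h) v"
      using br_antisym[of u "H k"] by (simp add: br_add_left br_add_right br_H_H)
    then show ?thesis using u by (simp add: cvs.span_add cvs.span_neg cvs.span_diff e_words_br e_words_H)
  qed
  have sub: "cvs.subspace ?D"
    unfolding cvs.subspace_def
  proof (intro conjI ballI allI)
    show "0 \<in> ?D" unfolding mem by (rule exI[of _ 0]) (simp add: clinear_zero[OF clinear_H] cvs.span_zero)
  next
    fix x y assume "x \<in> ?D" "y \<in> ?D"
    then obtain h k where "x - H h \<in> ?S" "y - H k \<in> ?S" unfolding mem by blast
    then have "(x - H h) + (y - H k) \<in> ?S" by (rule cvs.span_add)
    then show "x + y \<in> ?D" unfolding mem
      by (intro exI[of _ "h + k"]) (simp add: clinear_add[OF clinear_H] algebra_simps)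
  next
    fix c x assume "x \<in> ?D"
    then obtain h where "x - H h \<in> ?S" unfolding mem by blast
    then have "c *\<^sub>C (x - H h) \<in> ?S" by (rule cvs.span_scale)
    then show "c *\<^sub>C x \<in> ?D" unfolding mem
      by (intro exI[of _ "c *\<^sub>C h"]) (simp add: clinear_scale[OF clinear_H] cvs.scale_right_diff_distrib)
  qed
  have D: "x \<in> ?D" for x
  proof (rule presented_by_induct[OF km_presented sub])
    show "\<kappa> x \<in> ?D" for x
    proof (cases x)
      case (KH h)
      then show ?thesis unfolding mem by (intro exI[of _ h]) (simp add: cvs.span_zero)
    next
      case (KE s i)
      have "e s i \<in> e_words" unfolding e_words_def by (rule CollectI, rule exI[of _ "Letter (KE s i)"]) simp
      then show ?thesis unfolding mem KE
        by (intro exI[of _ 0]) (simp add: clinear_zero[OF clinear_H] cvs.span_base)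
    qed
    show "br x y \<in> ?D" if "x \<in> ?D" "y \<in> ?D" for x y
      unfolding mem using br_D[OF that] by (intro exI[of _ 0]) (simp add: clinear_zero[OF clinear_H])
  qed
  show ?thesis
    unfolding derived_alg_def by (rule cvs.span_minimal) (use br_D D in auto)
qed

lemma range_eq_twisted_aff:
  assumes pres: "presented_by brq \<gamma> (hat_gens mh) (hat_relators a r \<mu> \<alpha> av mh)"
    and hom: "lie_hom brq abr \<phi>" and gens: "\<And>x. x \<in> hat_gens mh \<Longrightarrow> \<phi> (\<gamma> x) = gen_image x"
  shows "range \<phi> = T"
proof
  have lin: "clinear \<phi>" and br: "\<phi> (brq x y) = abr (\<phi> x) (\<phi> y)" for x y
    using hom by (auto simp: lie_hom_def)
  let ?R = "range \<phi>"
  have sub: "cvs.subspace ?R" by (rule subspace_range_clinear[OF lin])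
  have br_R: "abr p q \<in> ?R" if "p \<in> ?R" "q \<in> ?R" for p q
    using that by (auto simp flip: br)
  have gen_R: "gen_image x \<in> ?R" if "x \<in> hat_gens mh" for x
    using gens[OF that] by (metis rangeI)
  have "cvs.subspace {z. \<phi> z \<in> T}"
    by (auto simp: cvs.subspace_def clinear_zero[OF lin] clinear_add[OF lin] clinear_scale[OF lin]
        intro: cvs.subspace_0[OF subspace_T] cvs.subspace_add[OF subspace_T] cvs.subspace_scale[OF subspace_T])
  then have "z \<in> {z. \<phi> z \<in> T}" for z
    by (rule presented_by_induct[OF pres]) (simp_all add: gens gen_image_in_T br twisted_aff_br_closed)
  then show "range \<phi> \<subseteq> T" by auto
  have "(1 / of_nat N) *\<^sub>C gen_image GC \<in> ?R"
    by (intro cvs.subspace_scale[OF sub] gen_R) (simp add: hat_gens_def)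
  then have c: "aff_c \<in> ?R" using order_pos by (simp add: gen_image_def cscale_cscale cscale_one)
  have d: "aff_d \<in> ?R" using gen_R[of GD] by (simp add: hat_gens_def gen_image_def)
  \<comment> \<open>The elements whose twisted sums occur in the image in every degree; a subalgebra
    by \<open>tw_br_from_brackets\<close>, since \<open>aff_c\<close> is already in the
    image.\<close>
  let ?Q = "{x. \<forall>m. aff_t m (twm m x) \<in> ?R}"
  have subQ: "cvs.subspace ?Q"
    by (auto simp: cvs.subspace_def tw_zero tw_add tw_scale aff_t_zero aff_t_add aff_t_scale
        simp del: image_iff range_eqI intro: cvs.subspace_0[OF sub] cvs.subspace_add[OF sub] cvs.subspace_scale[OF sub])
  have brQ: "br x y \<in> ?Q" if x: "x \<in> ?Q" and y: "y \<in> ?Q" for x y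
  proof (intro CollectI allI)
    fix m
    let ?b = "\<lambda>b. abr (aff_t (m - b) (twm (m - b) x)) (aff_t b (twm b y))"
    define f where "f b = (if m = 0 then of_int (m - b) * B (twm (m - b) x) (twm b y) else 0)" for b
    have f: "?b b = aff_t m (br (twm (m - b) x) (twm b y)) + f b *\<^sub>C aff_c" for b
      by (simp add: aff_br_t_t f_def)
    have "(\<Sum>b\<in>residues_of \<mu>. ?b b) = aff_t m (\<Sum>b\<in>residues_of \<mu>. br (twm (m - b) x) (twm b y)) +
        (\<Sum>b\<in>residues_of \<mu>. f b) *\<^sub>C aff_c"
      unfolding f by (simp add: sum.distrib aff_t_sum cvs.scale_sum_left)
    then have "of_nat N *\<^sub>C aff_t m (twm m (br x y)) =
        (\<Sum>b\<in>residues_of \<mu>. ?b b) - (\<Sum>b\<in>residues_of \<mu>. f b) *\<^sub>C aff_c"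
      by (simp add: tw_br_from_brackets aff_t_scale)
    also have "\<dots> \<in> ?R"
      by (intro cvs.subspace_diff[OF sub] cvs.subspace_sum[OF sub] cvs.subspace_scale[OF sub] c br_R)
        (use x y in auto)
    finally have "(1 / of_nat N) *\<^sub>C of_nat N *\<^sub>C aff_t m (twm m (br x y)) \<in> ?R"
      by (rule cvs.subspace_scale[OF sub])
    then show "aff_t m (twm m (br x y)) \<in> ?R" using order_pos by (simp add: cscale_cscale cscale_one)
  qed
  have eQ: "e s i \<in> ?Q" for s i
    using gen_R[of "GX s i _"] by (auto simp: hat_gens_def gen_image_def)
  have "eval_word br \<kappa> t \<in> ?Q" if "set_magma t \<subseteq> {KE s i | s i. True}" for t
    using that
  proof (induction t)
    case (Letter x)
    then show ?case using eQ by auto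
  next
    case (Node t u)
    then show ?case using brQ[of "eval_word br \<kappa> t" "eval_word br \<kappa> u"] by simp
  qed
  then have "e_words \<subseteq> ?Q" unfolding e_words_def by blast
  then have "cvs.span e_words \<subseteq> ?Q" by (rule cvs.span_minimal[OF _ subQ])
  then have "g' \<subseteq> ?Q" using derived_subset_e_words by blast
  \<comment> \<open>\<open>twm 0 (H w)\<close> is \<open>H\<close> of the orbit sum of
    \<open>w\<close>, which is fixed by \<open>mh\<close> and therefore an admissible index of
    \<open>GL\<close>.\<close>
  moreover have "aff_t 0 (twm 0 (H w)) \<in> ?R" for w
  proof -
    let ?h = "\<Sum>k\<in>residues_of \<mu>. ipow N mh k w"
    have "gen_image (GL ?h) \<in> ?R" by (rule gen_R) (simp add: hat_gens_def sum_orbit_fixed)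
    moreover have "gen_image (GL ?h) = aff_t 0 (H ?h)"
      using ev_LL[OF sum_orbit_fixed] by (simp add: eval_free_letter)
    ultimately show ?thesis by (simp add: tw_0_H)
  qed
  ultimately have "twisted_spanning \<subseteq> ?R" using c d unfolding twisted_spanning_def by blast
  then show "T \<subseteq> ?R" unfolding twisted_aff_eq_span by (rule cvs.span_minimal[OF _ sub])
qed

end

theorem proposition7p4:
  fixes a :: "'i::finite \<Rightarrow> 'i \<Rightarrow> int" and r :: "'i \<Rightarrow> nat" and \<mu> :: "'i \<Rightarrow> 'i"
    and \<alpha> :: "'i \<Rightarrow> 'h::complex_vs \<Rightarrow> complex" and av :: "'i \<Rightarrow> 'h" and W :: "'h set"
    and br :: "'g::complex_vs \<Rightarrow> 'g \<Rightarrow> 'g" and \<kappa> :: "('i, 'h) km_gen \<Rightarrow> 'g"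
    and B :: "'g \<Rightarrow> 'g \<Rightarrow> complex" and mh :: "'h \<Rightarrow> 'h" and mg :: "'g \<Rightarrow> 'g"
    and brq :: "'q::complex_vs \<Rightarrow> 'q \<Rightarrow> 'q" and \<gamma> :: "('i, 'h) hat_gen \<Rightarrow> 'q"
  assumes "symmetrizable_gcm a r"
    and "realization a \<alpha> av"
    and "kac_moody a \<alpha> av br \<kappa>"
    and "stable_complement a \<alpha> av W"
    and "invariant_form r \<alpha> av W br \<kappa> B"
    and "admissible a r \<mu>"
    and "mu_action \<mu> \<alpha> av W br \<kappa> mh mg"
    and "LC1 a \<mu>"
    and "LC2 a \<mu>"
    and "presented_by brq \<gamma> (hat_gens mh) (hat_relators a r \<mu> \<alpha> av mh)"
  defines "N \<equiv> perm_order \<mu>"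
  defines "assignment \<equiv> \<lambda>\<phi> :: 'q \<Rightarrow> 'g aff.
      (\<forall>h\<in>fixed_cartan mh. \<phi> (\<gamma> (GL h)) = aff_t 0 ((1 / of_nat N) *\<^sub>C tw \<mu> mg 0 (\<kappa> (KH h)))) \<and>
      (\<forall>i m. \<phi> (\<gamma> (GH i m)) = aff_t m (of_nat (r i) *\<^sub>C tw \<mu> mg m (\<kappa> (KH (av i))))) \<and>
      (\<forall>s i m. \<phi> (\<gamma> (GX s i m)) = aff_t m (tw \<mu> mg m (\<kappa> (KE s i)))) \<and>
      \<phi> (\<gamma> GC) = of_nat N *\<^sub>C aff_c \<and>
      \<phi> (\<gamma> GD) = aff_d"
  shows "(\<exists>!\<phi>. lie_hom brq (aff_br br B) \<phi> \<and> assignment \<phi>) \<and>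
    (\<forall>\<phi>. lie_hom brq (aff_br br B) \<phi> \<and> assignment \<phi> \<longrightarrow> range \<phi> = twisted_aff \<mu> W br \<kappa> mg)"
proof -
  interpret L: linking_twisted_kac_moody a r \<mu> \<alpha> av W br \<kappa> B mh mg
    using assms(1-9)
    by (simp add: linking_twisted_kac_moody_def linking_twisted_kac_moody_axioms_def twisted_kac_moody_def)
  note pres = assms(10)
  have GH: "(\<forall>x\<in>{GH i m | i m. True}. P x) \<longleftrightarrow> (\<forall>i m. P (GH i m))"
    and GX: "(\<forall>x\<in>{GX s i m | s i m. True}. P x) \<longleftrightarrow> (\<forall>s i m. P (GX s i m))"
    for P :: "('i, 'h) hat_gen \<Rightarrow> bool"
    by blast+
  \<comment> \<open>\<open>GL h\<close> is a generator only for fixed \<open>h\<close>, which is the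
    range of \<open>h\<close> in \<open>assignment\<close>; so the latter is agreement with
    \<open>L.gen_image\<close> on all generators.\<close>
  have assignment: "assignment \<phi> \<longleftrightarrow> (\<forall>x\<in>hat_gens mh. \<phi> (\<gamma> x) = L.gen_image x)" for \<phi>
    unfolding assignment_def N_def hat_gens_def ball_Un GH GX by (auto simp: L.gen_image_def)
  obtain \<phi> where \<phi>: "lie_hom brq (aff_br br B) \<phi>" "\<And>x. x \<in> hat_gens mh \<Longrightarrow> \<phi> (\<gamma> x) = L.gen_image x"
    using presented_by_lift[OF pres L.lie_algebra_aff_br L.hat_relator_zero] by blast
  have "\<psi> = \<phi>" if "lie_hom brq (aff_br br B) \<psi>" "assignment \<psi>" for \<psi>
    by (rule lie_hom_eq_on_generators[OF pres that(1) \<phi>(1)]) (use that(2) \<phi>(2) assignment in simp)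
  moreover have "assignment \<phi>" using \<phi>(2) assignment by simp
  moreover have "range \<psi> = twisted_aff \<mu> W br \<kappa> mg" if "lie_hom brq (aff_br br B) \<psi>" "assignment \<psi>" for \<psi>
    by (rule L.range_eq_twisted_aff[OF pres that(1)]) (use that(2) assignment in simp)
  ultimately show ?thesis using \<phi>(1) by blast
qed

end
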